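(* Let $(\mathbb{K},|\cdot|)$ be a valued field. Let $(E_i)_{i\in I}$ and $(F_i)_{i\in I}$ be families of topological $\mathbb{K}$-vector spaces indexed by a set $I$. Let $k\in\mathbb{N}_0\cup\{\infty\}$, and for each $i\in I$ let $f_i\colon U_i\to F_i$ be a map of class $C^k_{\mathbb{K}}$, defined on an open non-empty subset $U_i$ of $E_i$. Suppose that there is a finite subset $J\subseteq I$ such that $0\in U_i$ and $f_i(0)=0$ for all $i\in I\setminus J$. Then $U:=\bigoplus_{i\in I}U_i:=\bigl(\bigoplus_{i\in I}E_i\bigr)\cap\prod_{i\in I}U_i$ is an open subset of $E:=\bigoplus_{i\in I}E_i$, and $$f:=\bigoplus_{i\in I}f_i\colon U\to F,\qquad f((x_i)_{i\in I}):=(f_i(x_i))_{i\in I}$$ is a map of class $C^k_{\mathbb{K}}$ into $F:=\bigoplus_{i\in I}F_i$, where direct sums carry the box topology. Moreover, for each $j\in\mathbb{N}$ with $j\le k$, identifying $E^{2^j}$ with $\bigoplus_{i\in I}E_i^{2^j}$ in the natural way, we have $$U^{\{j\}}=\{((x_i)_{i\in I},p)\in E^{2^j}\times\mathbb{K}^{2^j-1}:\ (x_i,p)\in U_i^{\{j\}}\text{ for all }i\in I\}$$ and $f^{\{j\}}((x_i)_{i\in I},p)=(f_i^{\{j\}}(x_i,p))_{i\in I}$.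
   Context: All topological spaces and topological vector spaces are Hausdorff. A valued field is a field with an absolute value $|\cdot|\colon\mathbb{K}\to[0,\infty[$ defining a non-discrete topology. Box topology: the direct sum $\bigoplus_{i\in I}E_i$ of topological $\mathbb{K}$-vector spaces is given the vector topology for which the sets $\bigl(\bigoplus_iE_i\bigr)\cap\prod_iV_i$, with $V_i\subseteq E_i$ open (balanced) zero-neighbourhoods, form a basis of zero-neighbourhoods ($V$ balanced: $tV\subseteq V$ for all $|t|\le1$). Differential calculus over $\mathbb{K}$: For a topological $\mathbb{K}$-vector space $E$ and $U\subseteq E$ open, put $U^{[0]}:=U$, $U^{[1]}:=\{(x,y,t)\in U\times E\times\mathbb{K}: x+ty\in U\}$ and $U^{[j+1]}:=(U^{[j]})^{[1]}$. A map $f\colon U\to F$ into a topological $\mathbb{K}$-vector space is $C^0_{\mathbb{K}}$ if it is continuous ($f^{[0]}:=f$); it is $C^1_{\mathbb{K}}$ if it is continuous and there is a (necessarily unique) continuous map $f^{[1]}\colon U^{[1]}\to F$ with $f^{[1]}(x,y,t)=\frac1t(f(x+ty)-f(x))$ for all $(x,y,t)\in U^{[1]}$ with $t\neq0$; for $k\ge2$ it is $C^k_{\mathbb{K}}$ if it is $C^{k-1}_{\mathbb{K}}$ and $f^{[k-1]}$ is $C^1_{\mathbb{K}}$, and then $f^{[k]}:=(f^{[k-1]})^{[1]}$; it is $C^\infty_{\mathbb{K}}$ if it is $C^k_{\mathbb{K}}$ for all $k$. Reordered difference quotients: for $U\subseteq E$ open and $f\colon U\to F$ of class $C^k_{\mathbb{K}}$,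 put $U^{\{0\}}:=U$, $f^{\{0\}}:=f$, $U^{\{1\}}:=U^{[1]}\subseteq E^2\times\mathbb{K}$, $f^{\{1\}}:=f^{[1]}$, and recursively for $j\in\mathbb{N}$, $j<k$: $U^{\{j+1\}}:=\{(x,y,u,v,t)\in E^{2^j}\times E^{2^j}\times\mathbb{K}^{2^j-1}\times\mathbb{K}^{2^j-1}\times\mathbb{K}:((x,u),(y,v),t)\in(U^{\{j\}})^{[1]}\}$ and $f^{\{j+1\}}(x,y,u,v,t):=(f^{\{j\}})^{[1]}((x,u),(y,v),t)$. Thus $U^{\{j\}}\subseteq E^{2^j}\times\mathbb{K}^{2^j-1}$. *)

theory Defs
  imports "HOL-Analysis.Analysis" "HOL-Algebra.Module" "HOL-Library.Extended_Nat"
begin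

section \<open>Valued fields and topological vector spaces\<close>

record 'k valued_ring = "'k ring" +
  absv :: "'k \<Rightarrow> real"

text \<open>
  The value outside the carrier is fixed to 0 only because the library's metric spaces
  require nonnegativity and symmetry on the whole type.
\<close>
definition val_dist :: "'k valued_ring \<Rightarrow> 'k \<Rightarrow> 'k \<Rightarrow> real" where
  "val_dist K s t =
     (if s \<in> carrier K \<and> t \<in> carrier K then absv K (s \<ominus>\<^bsub>K\<^esub> t) else 0)"

definition val_topology :: "'k valued_ring \<Rightarrow> 'k topology" where
  "val_topology K = Metric_space.mtopology (carrier K) (val_dist K)"

locale valued_field = Ring.field K for K :: "'k valued_ring" (structure) +
  assumes absv_nonneg: "s \<in> carrier K \<Longrightarrow> 0 \<le> absv K s"
    and absv_eq_0_iff: "s \<in> carrier K \<Longrightarrow> absv K s = 0 \<longleftrightarrow> s = \<zero>"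
    and absv_mult:
      "\<lbrakk>s \<in> carrier K; t \<in> carrier K\<rbrakk> \<Longrightarrow> absv K (s \<otimes> t) = absv K s * absv K t"
    and absv_triangle:
      "\<lbrakk>s \<in> carrier K; t \<in> carrier K\<rbrakk> \<Longrightarrow> absv K (s \<oplus> t) \<le> absv K s + absv K t"
    and non_discrete: "val_topology K \<noteq> discrete_topology (carrier K)"

text \<open>
  The fields mult and one inherited from the ring record carry no meaning for vector spaces;
  they are left undefined in the constructions below.
\<close>
record ('k, 'a) tvs = "('k, 'a) module" +
  topol :: "'a topology"

locale topological_vector_space = valued_field K + Module.module K E
  for K :: "'k valued_ring" and E :: "('k, 'a) tvs" +
  assumes topspace_topol: "topspace (topol E) = carrier E"
    and Hausdorff: "Hausdorff_space (topol E)"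
    and continuous_add:
      "continuous_map (prod_topology (topol E) (topol E)) (topol E) (\<lambda>(x, y). x \<oplus>\<^bsub>E\<^esub> y)"
    and continuous_smult:
      "continuous_map (prod_topology (val_topology K) (topol E)) (topol E)
         (\<lambda>(t, x). t \<odot>\<^bsub>E\<^esub> x)"

definition scalar_tvs :: "'k valued_ring \<Rightarrow> ('k, 'k) tvs" where
  "scalar_tvs K =
     \<lparr>carrier = carrier K, mult = undefined, one = undefined,
      zero = \<zero>\<^bsub>K\<^esub>, add = (\<lambda>s t. s \<oplus>\<^bsub>K\<^esub> t), smult = (\<lambda>s t. s \<otimes>\<^bsub>K\<^esub> t),
      topol = val_topology K\<rparr>"

definition prod_tvs :: "('k, 'a) tvs \<Rightarrow> ('k, 'b) tvs \<Rightarrow> ('k, 'a \<times> 'b) tvs" where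
  "prod_tvs E F =
     \<lparr>carrier = carrier E \<times> carrier F, mult = undefined, one = undefined,
      zero = (\<zero>\<^bsub>E\<^esub>, \<zero>\<^bsub>F\<^esub>),
      add = (\<lambda>z w. (fst z \<oplus>\<^bsub>E\<^esub> fst w, snd z \<oplus>\<^bsub>F\<^esub> snd w)),
      smult = (\<lambda>t z. (t \<odot>\<^bsub>E\<^esub> fst z, t \<odot>\<^bsub>F\<^esub> snd z)),
      topol = prod_topology (topol E) (topol F)\<rparr>"

text \<open>The power \<open>E\<^sup>n\<close>: extensional functions on \<open>{..<n}\<close> with the product topology.\<close>

definition power_tvs :: "('k, 'a) tvs \<Rightarrow> nat \<Rightarrow> ('k, nat \<Rightarrow> 'a) tvs" where
  "power_tvs E n =
     \<lparr>carrier = (\<Pi>\<^sub>E m\<in>{..<n}. carrier E), mult = undefined, one = undefined,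
      zero = (\<lambda>m\<in>{..<n}. \<zero>\<^bsub>E\<^esub>),
      add = (\<lambda>x y. \<lambda>m\<in>{..<n}. x m \<oplus>\<^bsub>E\<^esub> y m),
      smult = (\<lambda>t x. \<lambda>m\<in>{..<n}. t \<odot>\<^bsub>E\<^esub> x m),
      topol = product_topology (\<lambda>m. topol E) {..<n}\<rparr>"

text \<open>Transport of the structure along an injection \<open>enc\<close> with left inverse \<open>dec\<close>.\<close>

definition transport_tvs :: "('a \<Rightarrow> 'b) \<Rightarrow> ('b \<Rightarrow> 'a) \<Rightarrow> ('k, 'a) tvs \<Rightarrow> ('k, 'b) tvs" where
  "transport_tvs enc dec E =
     \<lparr>carrier = enc ` carrier E, mult = undefined, one = undefined,
      zero = enc \<zero>\<^bsub>E\<^esub>,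
      add = (\<lambda>x y. enc (dec x \<oplus>\<^bsub>E\<^esub> dec y)),
      smult = (\<lambda>t x. enc (t \<odot>\<^bsub>E\<^esub> dec x)),
      topol = pullback_topology (enc ` carrier E) dec (topol E)\<rparr>"


section \<open>Direct sums with the box topology\<close>

definition dsum_carrier :: "'i set \<Rightarrow> ('i \<Rightarrow> ('k, 'a) tvs) \<Rightarrow> ('i \<Rightarrow> 'a) set" where
  "dsum_carrier I E = {x \<in> (\<Pi>\<^sub>E i\<in>I. carrier (E i)). finite {i \<in> I. x i \<noteq> \<zero>\<^bsub>E i\<^esub>}}"

definition dsum_set ::
  "'i set \<Rightarrow> ('i \<Rightarrow> ('k, 'a) tvs) \<Rightarrow> ('i \<Rightarrow> 'a set) \<Rightarrow> ('i \<Rightarrow> 'a) set" where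
  "dsum_set I E U = dsum_carrier I E \<inter> (\<Pi>\<^sub>E i\<in>I. U i)"

definition dsum_add ::
  "'i set \<Rightarrow> ('i \<Rightarrow> ('k, 'a) tvs) \<Rightarrow> ('i \<Rightarrow> 'a) \<Rightarrow> ('i \<Rightarrow> 'a) \<Rightarrow> 'i \<Rightarrow> 'a" where
  "dsum_add I E x y = (\<lambda>i\<in>I. x i \<oplus>\<^bsub>E i\<^esub> y i)"

text \<open>
  A set is open iff with each point \<open>x\<close> it contains a translate \<open>x + V\<close> of a basic
  zero-neighbourhood \<open>V\<close>, the latter being boxes of open zero-neighbourhoods.
\<close>
definition box_open :: "'i set \<Rightarrow> ('i \<Rightarrow> ('k, 'a) tvs) \<Rightarrow> ('i \<Rightarrow> 'a) set \<Rightarrow> bool" where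
  "box_open I E W \<longleftrightarrow>
     W \<subseteq> dsum_carrier I E \<and>
     (\<forall>x\<in>W. \<exists>V. (\<forall>i\<in>I. openin (topol (E i)) (V i) \<and> \<zero>\<^bsub>E i\<^esub> \<in> V i) \<and>
                dsum_add I E x ` dsum_set I E V \<subseteq> W)"

definition box_topology :: "'i set \<Rightarrow> ('i \<Rightarrow> ('k, 'a) tvs) \<Rightarrow> ('i \<Rightarrow> 'a) topology" where
  "box_topology I E = topology (box_open I E)"

lemma istopology_box_open: "istopology (box_open I E)"
proof -
  define N where "N V \<longleftrightarrow> (\<forall>i\<in>I. openin (topol (E i)) (V i) \<and> \<zero>\<^bsub>E i\<^esub> \<in> V i)" for V
  define B where "B x V = dsum_add I E x ` dsum_set I E V" for x V
  have box_open_iff: "box_open I E W \<longleftrightarrow>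
      W \<subseteq> dsum_carrier I E \<and> (\<forall>x\<in>W. \<exists>V. N V \<and> B x V \<subseteq> W)" for W
    by (simp only: box_open_def N_def B_def)
  have N_Int: "N (\<lambda>i. V i \<inter> V' i)" if "N V" "N V'" for V V'
    using that by (simp add: N_def openin_Int)
  have B_Int: "B x (\<lambda>i. V i \<inter> V' i) \<subseteq> B x V \<inter> B x V'" for x V V'
    unfolding B_def by (intro Int_greatest image_mono) (auto simp: dsum_set_def PiE_iff)
  have "box_open I E (S \<inter> T)" if S: "box_open I E S" and T: "box_open I E T" for S T
    unfolding box_open_iff
  proof (intro conjI ballI)
    show "S \<inter> T \<subseteq> dsum_carrier I E"
      using S by (auto simp: box_open_iff)
    fix x assume x: "x \<in> S \<inter> T"
    obtain V where "N V" "B x V \<subseteq> S"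
      using S x by (auto simp: box_open_iff)
    moreover obtain V' where "N V'" "B x V' \<subseteq> T"
      using T x by (auto simp: box_open_iff)
    ultimately have "N (\<lambda>i. V i \<inter> V' i)" "B x (\<lambda>i. V i \<inter> V' i) \<subseteq> S \<inter> T"
      using N_Int B_Int[of x V V'] by auto
    then show "\<exists>V. N V \<and> B x V \<subseteq> S \<inter> T"
      by metis
  qed
  moreover have "box_open I E (\<Union>\<K>)" if "\<forall>S\<in>\<K>. box_open I E S" for \<K>
    using that unfolding box_open_iff by (meson Sup_least Sup_upper UnionE order_trans)
  ultimately show ?thesis
    by (auto simp: istopology_def)
qed

lemma openin_box_topology: "openin (box_topology I E) W \<longleftrightarrow> box_open I E W"
  by (simp add: box_topology_def istopology_box_open)

definition dsum_tvs :: "'i set \<Rightarrow> ('i \<Rightarrow> ('k, 'a) tvs) \<Rightarrow> ('k, 'i \<Rightarrow> 'a) tvs" where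
  "dsum_tvs I E =
     \<lparr>carrier = dsum_carrier I E, mult = undefined, one = undefined,
      zero = (\<lambda>i\<in>I. \<zero>\<^bsub>E i\<^esub>),
      add = dsum_add I E,
      smult = (\<lambda>t x. \<lambda>i\<in>I. t \<odot>\<^bsub>E i\<^esub> x i),
      topol = box_topology I E\<rparr>"

definition dsum_map :: "'i set \<Rightarrow> ('i \<Rightarrow> 'a \<Rightarrow> 'b) \<Rightarrow> ('i \<Rightarrow> 'a) \<Rightarrow> 'i \<Rightarrow> 'b" where
  "dsum_map I f x = (\<lambda>i\<in>I. f i (x i))"


section \<open>Differential calculus over a valued field\<close>

text \<open>
  \<open>bracket_tvs K E\<close> is the ambient space \<open>E \<times> E \<times> K\<close> of \<open>U\<^sup>[\<^sup>1\<^sup>]\<close>.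
\<close>
definition bracket_tvs :: "'k valued_ring \<Rightarrow> ('k, 'a) tvs \<Rightarrow> ('k, 'a \<times> 'a \<times> 'k) tvs" where
  "bracket_tvs K E = prod_tvs E (prod_tvs E (scalar_tvs K))"

definition bracket_dom ::
  "'k valued_ring \<Rightarrow> ('k, 'a) tvs \<Rightarrow> 'a set \<Rightarrow> ('a \<times> 'a \<times> 'k) set" where
  "bracket_dom K E U =
     {(x, y, t). x \<in> U \<and> y \<in> carrier E \<and> t \<in> carrier K \<and> x \<oplus>\<^bsub>E\<^esub> t \<odot>\<^bsub>E\<^esub> y \<in> U}"

definition is_bracket_map ::
  "'k valued_ring \<Rightarrow> ('k, 'a) tvs \<Rightarrow> 'a set \<Rightarrow> ('k, 'b) tvs \<Rightarrow> ('a \<Rightarrow> 'b) \<Rightarrow>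
   ('a \<times> 'a \<times> 'k \<Rightarrow> 'b) \<Rightarrow> bool" where
  "is_bracket_map K E U F f g \<longleftrightarrow>
     continuous_map (subtopology (topol (bracket_tvs K E)) (bracket_dom K E U)) (topol F) g \<and>
     (\<forall>(x, y, t) \<in> bracket_dom K E U. t \<noteq> \<zero>\<^bsub>K\<^esub> \<longrightarrow>
        g (x, y, t) = inv\<^bsub>K\<^esub> t \<odot>\<^bsub>F\<^esub> (f (x \<oplus>\<^bsub>E\<^esub> t \<odot>\<^bsub>E\<^esub> y) \<ominus>\<^bsub>F\<^esub> f x))"

definition C0_on ::
  "('k, 'a) tvs \<Rightarrow> 'a set \<Rightarrow> ('k, 'b) tvs \<Rightarrow> ('a \<Rightarrow> 'b) \<Rightarrow> bool" where
  "C0_on E U F f \<longleftrightarrow> continuous_map (subtopology (topol E) U) (topol F) f"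

definition C1_on ::
  "'k valued_ring \<Rightarrow> ('k, 'a) tvs \<Rightarrow> 'a set \<Rightarrow> ('k, 'b) tvs \<Rightarrow> ('a \<Rightarrow> 'b) \<Rightarrow> bool" where
  "C1_on K E U F f \<longleftrightarrow> C0_on E U F f \<and> (\<exists>g. is_bracket_map K E U F f g)"

text \<open>
  The map \<open>f\<^sup>[\<^sup>1\<^sup>]\<close>. For open \<open>U\<close>, Hausdorff \<open>F\<close> and non-discrete \<open>K\<close> it is unique on
  \<open>bracket_dom K E U\<close>; the choice operator only affects its values off that set.
\<close>
definition bracket_map ::
  "'k valued_ring \<Rightarrow> ('k, 'a) tvs \<Rightarrow> 'a set \<Rightarrow> ('k, 'b) tvs \<Rightarrow> ('a \<Rightarrow> 'b) \<Rightarrow>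
   'a \<times> 'a \<times> 'k \<Rightarrow> 'b" where
  "bracket_map K E U F f = (SOME g. is_bracket_map K E U F f g)"

text \<open>
  The iterated spaces \<open>E\<^sup>[\<^sup>0\<^sup>] = E\<close>, \<open>E\<^sup>[\<^sup>j\<^sup>+\<^sup>1\<^sup>] = E\<^sup>[\<^sup>j\<^sup>] \<times> E\<^sup>[\<^sup>j\<^sup>] \<times> K\<close> have different types;
  to have them in a single type, an element of \<open>E\<^sup>[\<^sup>j\<^sup>]\<close> is written as a
  complete binary tree of depth \<open>j\<close>, with vectors at the leaves and scalars at the inner nodes.
\<close>
datatype ('a, 'k) dtree = Leaf 'a | Node "('a, 'k) dtree" "('a, 'k) dtree" 'k

fun unLeaf :: "('a, 'k) dtree \<Rightarrow> 'a" where
  "unLeaf (Leaf x) = x"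
| "unLeaf (Node _ _ _) = undefined"

definition node :: "('a, 'k) dtree \<times> ('a, 'k) dtree \<times> 'k \<Rightarrow> ('a, 'k) dtree" where
  "node = (\<lambda>(x, y, t). Node x y t)"

fun unNode :: "('a, 'k) dtree \<Rightarrow> ('a, 'k) dtree \<times> ('a, 'k) dtree \<times> 'k" where
  "unNode (Node x y t) = (x, y, t)"
| "unNode (Leaf _) = undefined"

primrec iter_tvs ::
  "'k valued_ring \<Rightarrow> ('k, 'a) tvs \<Rightarrow> nat \<Rightarrow> ('k, ('a, 'k) dtree) tvs" where
  "iter_tvs K E 0 = transport_tvs Leaf unLeaf E"
| "iter_tvs K E (Suc j) = transport_tvs node unNode (bracket_tvs K (iter_tvs K E j))"

primrec iter_dom ::
  "'k valued_ring \<Rightarrow> ('k, 'a) tvs \<Rightarrow> 'a set \<Rightarrow> nat \<Rightarrow> ('a, 'k) dtree set" where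
  "iter_dom K E U 0 = Leaf ` U"
| "iter_dom K E U (Suc j) = node ` bracket_dom K (iter_tvs K E j) (iter_dom K E U j)"

primrec iter_map ::
  "'k valued_ring \<Rightarrow> ('k, 'a) tvs \<Rightarrow> 'a set \<Rightarrow> ('k, 'b) tvs \<Rightarrow> ('a \<Rightarrow> 'b) \<Rightarrow> nat \<Rightarrow>
   ('a, 'k) dtree \<Rightarrow> 'b" where
  "iter_map K E U F f 0 = f \<circ> unLeaf"
| "iter_map K E U F f (Suc j) =
     bracket_map K (iter_tvs K E j) (iter_dom K E U j) F (iter_map K E U F f j) \<circ> unNode"

fun Cn_on ::
  "'k valued_ring \<Rightarrow> ('k, 'a) tvs \<Rightarrow> 'a set \<Rightarrow> ('k, 'b) tvs \<Rightarrow> nat \<Rightarrow> ('a \<Rightarrow> 'b) \<Rightarrow> bool"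
where
  "Cn_on K E U F 0 f \<longleftrightarrow> C0_on E U F f"
| "Cn_on K E U F (Suc 0) f \<longleftrightarrow> C1_on K E U F f"
| "Cn_on K E U F (Suc (Suc n)) f \<longleftrightarrow>
     Cn_on K E U F (Suc n) f \<and>
     C1_on K (iter_tvs K E (Suc n)) (iter_dom K E U (Suc n)) F (iter_map K E U F f (Suc n))"

definition Ck_on ::
  "'k valued_ring \<Rightarrow> ('k, 'a) tvs \<Rightarrow> 'a set \<Rightarrow> ('k, 'b) tvs \<Rightarrow> enat \<Rightarrow> ('a \<Rightarrow> 'b) \<Rightarrow> bool"
where
  "Ck_on K E U F k f \<longleftrightarrow>
     (case k of enat n \<Rightarrow> Cn_on K E U F n f | \<infinity> \<Rightarrow> \<forall>n. Cn_on K E U F n f)"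


section \<open>Reordered difference quotients\<close>

text \<open>The ambient space \<open>E\<^sup>m \<times> K\<^sup>n\<close> with \<open>m = 2 ^ j\<close> and \<open>n = 2 ^ j - 1\<close>.\<close>

definition brace_tvs ::
  "'k valued_ring \<Rightarrow> ('k, 'a) tvs \<Rightarrow> nat \<Rightarrow> ('k, (nat \<Rightarrow> 'a) \<times> (nat \<Rightarrow> 'k)) tvs" where
  "brace_tvs K E j = prod_tvs (power_tvs E (2 ^ j)) (power_tvs (scalar_tvs K) (2 ^ j - 1))"

text \<open>
  An element of \<open>brace_tvs K E (Suc j)\<close> is read as \<open>(x, y, u, v, t)\<close>, where \<open>(x, y)\<close> are the two
  halves of the vector part and \<open>(u, v, t)\<close> are consecutive blocks of lengths
  \<open>2 ^ j - 1\<close>, \<open>2 ^ j - 1\<close>, \<open>1\<close> of the scalar part; it is sent to \<open>((x, u), (y, v), t)\<close>.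
\<close>
definition regroup ::
  "nat \<Rightarrow> (nat \<Rightarrow> 'a) \<times> (nat \<Rightarrow> 'k) \<Rightarrow>
   ((nat \<Rightarrow> 'a) \<times> (nat \<Rightarrow> 'k)) \<times> ((nat \<Rightarrow> 'a) \<times> (nat \<Rightarrow> 'k)) \<times> 'k" where
  "regroup j = (\<lambda>(X, p).
     ((\<lambda>m\<in>{..<2 ^ j}. X m, \<lambda>m\<in>{..<2 ^ j - 1}. p m),
      (\<lambda>m\<in>{..<2 ^ j}. X (2 ^ j + m), \<lambda>m\<in>{..<2 ^ j - 1}. p (2 ^ j - 1 + m)),
      p (2 * (2 ^ j - 1))))"

primrec brace_dom ::
  "'k valued_ring \<Rightarrow> ('k, 'a) tvs \<Rightarrow> 'a set \<Rightarrow> nat \<Rightarrow> ((nat \<Rightarrow> 'a) \<times> (nat \<Rightarrow> 'k)) set" where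
  "brace_dom K E U 0 = {z \<in> carrier (brace_tvs K E 0). fst z 0 \<in> U}"
| "brace_dom K E U (Suc j) =
     {z \<in> carrier (brace_tvs K E (Suc j)).
        regroup j z \<in> bracket_dom K (brace_tvs K E j) (brace_dom K E U j)}"

primrec brace_map ::
  "'k valued_ring \<Rightarrow> ('k, 'a) tvs \<Rightarrow> 'a set \<Rightarrow> ('k, 'b) tvs \<Rightarrow> ('a \<Rightarrow> 'b) \<Rightarrow> nat \<Rightarrow>
   (nat \<Rightarrow> 'a) \<times> (nat \<Rightarrow> 'k) \<Rightarrow> 'b" where
  "brace_map K E U F f 0 = (\<lambda>z. f (fst z 0))"
| "brace_map K E U F f (Suc j) =
     bracket_map K (brace_tvs K E j) (brace_dom K E U j) F (brace_map K E U F f j) \<circ> regroup j"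

text \<open>
  The \<open>i\<close>-th component \<open>x\<^sub>i \<in> E\<^sub>i\<^sup>n\<close> of an \<open>n\<close>-tuple \<open>X\<close> of elements of the direct sum of the
  spaces \<open>E\<^sub>i\<close>, under the identification of the \<open>n\<close>-th power of the direct sum with the direct
  sum of the \<open>n\<close>-th powers.
\<close>
definition component :: "nat \<Rightarrow> 'i \<Rightarrow> (nat \<Rightarrow> 'i \<Rightarrow> 'a) \<Rightarrow> nat \<Rightarrow> 'a" where
  "component n i X = (\<lambda>m\<in>{..<n}. X m i)"

end

theory Submission
  imports Defs
begin

text \<open>
  All constructions commute with the projections onto the components, and a direct sum \<open>f\<close> has
  the componentwise difference quotients. The point is their continuity in the box topology: almost
  all components of the vector arguments at a given point vanish, but the scalar arguments are
  shared by infinitely many components, so for \<open>f\<^sub>i(0) = 0\<close> a neighbourhood of the scalars is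
  needed that serves all \<open>i\<close> at once. As \<open>K\<close> need not be locally compact, compactness cannot
  provide it. Instead, homogeneity does: in \<open>f\<^sub>i\<^sup>[\<^sup>j\<^sup>]\<close> the scalars can be made arbitrarily small at the
  expense of enlarging the vectors, so continuity at the single point \<open>0\<close> controls
  \<open>f\<^sub>i\<^sup>[\<^sup>j\<^sup>]\<close> for all scalars of absolute value at most \<open>R\<close>, with \<open>R\<close> independent of \<open>i\<close>, once
  the vectors are small enough, depending on \<open>i\<close>.
\<close>

section \<open>Valued fields\<close>

text \<open>The choice operator in \<open>bracket_map\<close> leaves one way to identify a
  difference quotient: name a candidate, prove it continuous, verify the quotient formula for
  \<open>t \<noteq> \<zero>\<close>, and let uniqueness settle \<open>t = \<zero>\<close>, where no
  formula is available. The scaling law, the componentwise formula and the passage from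
  \<open>f^[j]\<close> to \<open>f^{j}\<close> are all obtained so. For the direct sum the candidate
  \<open>dsum_der\<close> must therefore be continuous, and even have values of finite support,
  before \<open>f\<close> is known to be differentiable; hence its continuity is derived at each
  depth directly from the components. Finiteness of the supports is not immediate: outside finitely
  many i a tree has zero vectors but arbitrary scalars, while \<open>f_i(0) = 0\<close> gives at
  first only the value 0 at the tree whose scalars vanish too. Vanishing for arbitrary scalars is a
  second consequence of the uniform smallness estimate, obtained by shrinking the target
  neighbourhood. The estimates are never repeated for the reordered quotients: a linear reordering
  of the variables carries these to trees.\<close>

lemma (in abelian_group) minus_eq_zero_iff:
  assumes "x \<in> carrier G" "y \<in> carrier G" shows "x \<ominus> y = \<zero> \<longleftrightarrow> x = y"
  using assms by (metis a_minus_def add.inv_solve_right' l_zero r_neg zero_closed)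

context valued_field
begin

lemma absv_zero [simp]: "absv K \<zero> = 0"
  by (simp add: absv_eq_0_iff)

lemma absv_pos: "\<lbrakk>s \<in> carrier K; s \<noteq> \<zero>\<rbrakk> \<Longrightarrow> 0 < absv K s"
  using absv_nonneg absv_eq_0_iff by fastforce

lemma absv_one [simp]: "absv K \<one> = 1"
  using absv_mult[of \<one> \<one>] absv_pos[of \<one>] by simp

lemma absv_uminus [simp]:
  assumes "s \<in> carrier K" shows "absv K (\<ominus> s) = absv K s"
proof -
  have "absv K (\<ominus> \<one>) * absv K (\<ominus> \<one>) = 1"
    using absv_mult[of "\<ominus> \<one>" "\<ominus> \<one>"] by (simp add: l_minus r_minus)
  then have "absv K (\<ominus> \<one>) = 1"
    using absv_nonneg[of "\<ominus> \<one>"] by (metis a_inv_closed abs_of_nonneg one_closed real_sqrt_abs2 real_sqrt_one)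
  moreover have "\<ominus> s = \<ominus> \<one> \<otimes> s" using assms by (simp add: l_minus)
  ultimately show ?thesis using assms absv_mult[of "\<ominus> \<one>" s] by simp
qed

lemma absv_minus_commute:
  assumes "s \<in> carrier K" "t \<in> carrier K" shows "absv K (s \<ominus> t) = absv K (t \<ominus> s)"
proof -
  have "s \<ominus> t = \<ominus> (t \<ominus> s)" using assms by algebra
  then show ?thesis using assms by simp
qed

lemma inv_nonzero:
  assumes "s \<in> carrier K" "s \<noteq> \<zero>"
  shows inv_carrier: "inv s \<in> carrier K" and inv_l: "inv s \<otimes> s = \<one>" and inv_r: "s \<otimes> inv s = \<one>"
    and inv_not_zero: "inv s \<noteq> \<zero>"
proof -
  have "s \<in> Units K" using assms by (simp add: field_Units)
  then show 1: "inv s \<in> carrier K" "inv s \<otimes> s = \<one>" "s \<otimes> inv s = \<one>" by auto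
  then show "inv s \<noteq> \<zero>" using assms by force
qed

lemma absv_inv:
  assumes "s \<in> carrier K" "s \<noteq> \<zero>" shows "absv K (inv s) = inverse (absv K s)"
  using assms inv_nonzero[OF assms] absv_mult[of s "inv s"] absv_pos[OF assms]
  by (simp add: field_simps)

section \<open>The metric topology of the field; scalars of small and of large absolute
  value\<close>

lemma val_Metric_space: "Metric_space (carrier K) (val_dist K)"
proof
  show "0 \<le> val_dist K x y" for x y
    by (simp add: val_dist_def absv_nonneg)
  show "val_dist K x y = val_dist K y x" for x y
    by (simp add: val_dist_def absv_minus_commute)
  show "(val_dist K x y = 0) = (x = y)" if "x \<in> carrier K" "y \<in> carrier K" for x y
    using that by (simp add: val_dist_def absv_eq_0_iff minus_eq_zero_iff)
  show "val_dist K x z \<le> val_dist K x y + val_dist K y z"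
    if "x \<in> carrier K" "y \<in> carrier K" "z \<in> carrier K" for x y z
  proof -
    have "x \<ominus> z = (x \<ominus> y) \<oplus> (y \<ominus> z)" using that by algebra
    then show ?thesis using that absv_triangle[of "x \<ominus> y" "y \<ominus> z"]
      by (simp add: val_dist_def)
  qed
qed

lemma topspace_val [simp]: "topspace (val_topology K) = carrier K"
  by (simp add: val_topology_def Metric_space.topspace_mtopology val_Metric_space)

text \<open>Expressing openness through \<open>absv\<close> on the carrier keeps the default value
  of \<open>val_dist\<close> out of later arguments with balls.\<close>

lemma openin_val_iff:
  "openin (val_topology K) S \<longleftrightarrow>
     S \<subseteq> carrier K \<and> (\<forall>x\<in>S. \<exists>r>0. \<forall>y\<in>carrier K. absv K (y \<ominus> x) < r \<longrightarrow> y \<in> S)"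
proof -
  have ball: "Metric_space.mball (carrier K) (val_dist K) x r = {y \<in> carrier K. absv K (y \<ominus> x) < r}"
    if "x \<in> carrier K" for x r
    using that by (auto simp: Metric_space.in_mball[OF val_Metric_space] val_dist_def absv_minus_commute)
  have *: "(\<exists>r>0. Metric_space.mball (carrier K) (val_dist K) x r \<subseteq> S) \<longleftrightarrow>
        (\<exists>r>0. \<forall>y\<in>carrier K. absv K (y \<ominus> x) < r \<longrightarrow> y \<in> S)" if "x \<in> carrier K" for x
    unfolding ball[OF that] by (simp add: subset_iff Ball_def imp_conjL)
  show ?thesis
    unfolding val_topology_def Metric_space.openin_mtopology[OF val_Metric_space] Ball_def[of S]
    by (intro conj_cong all_cong1 imp_cong refl *) (rule subsetD)
qed

text \<open>These balls are the scalar neighbourhoods that serve infinitely many components at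
  once.\<close>

lemma openin_absv_less: "openin (val_topology K) {t \<in> carrier K. absv K t < r}"
  unfolding openin_val_iff
proof (intro conjI ballI)
  fix x assume x: "x \<in> {t \<in> carrier K. absv K t < r}"
  have "absv K y < r" if "y \<in> carrier K" "absv K (y \<ominus> x) < r - absv K x" for y
  proof -
    have "y = (y \<ominus> x) \<oplus> x" using that x by (simp add: a_minus_def a_assoc l_neg)
    then show ?thesis using that x absv_triangle[of "y \<ominus> x" x] by auto
  qed
  then show "\<exists>s>0. \<forall>y\<in>carrier K. absv K (y \<ominus> x) < s \<longrightarrow> y \<in> {t \<in> carrier K. absv K t < r}"
    using x by (intro exI[of _ "r - absv K x"]) auto
qed auto

lemma openin_val_zero:
  assumes "openin (val_topology K) S" "\<zero> \<in> S"
  obtains r where "0 < r" "\<And>t. \<lbrakk>t \<in> carrier K; absv K t < r\<rbrakk> \<Longrightarrow> t \<in> S"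
  using assms unfolding openin_val_iff by (metis minus_zero a_minus_def r_zero)

text \<open>If 0 were isolated, then by translation every point would be, and the topology would be
  discrete. This is where non-discreteness enters; it makes limits for t tending to 0 meaningful
  and, through inverses, provides the large scalars used for rescaling.\<close>

lemma small_scalar:
  assumes "0 < r"
  obtains t where "t \<in> carrier K" "t \<noteq> \<zero>" "absv K t < r"
proof (rule ccontr)
  assume "\<not> thesis"
  with that have *: "t = \<zero>" if "t \<in> carrier K" "absv K t < r" for t
    using that by blast
  have "openin (val_topology K) S \<longleftrightarrow> S \<subseteq> carrier K" for S
  proof
    show "openin (val_topology K) S" if "S \<subseteq> carrier K"
      unfolding openin_val_iff
    proof (intro conjI ballI that exI[of _ r] impI assms)
      fix x y assume "x \<in> S" "y \<in> carrier K" "absv K (y \<ominus> x) < r"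
      then show "y \<in> S" using * that by (metis minus_eq_zero_iff minus_closed subsetD)
    qed
  qed (simp add: openin_val_iff)
  then show False
    using non_discrete by (auto simp: topology_eq)
qed

lemma large_scalar:
  obtains t where "t \<in> carrier K" "t \<noteq> \<zero>" "r < absv K t"
proof -
  \<comment> \<open>The maximum with 1 makes the bound positive for every real
    \<open>r\<close>.\<close>
  obtain t where t: "t \<in> carrier K" "t \<noteq> \<zero>" "absv K t < inverse (max r 1)"
    using small_scalar[of "inverse (max r 1)"] by (metis less_max_iff_disj positive_imp_inverse_positive zero_less_one)
  then have "max r 1 < inverse (absv K t)"
    using absv_pos[of t] by (metis inverse_inverse_eq inverse_less_iff_less less_max_iff_disj positive_imp_inverse_positive zero_less_one)
  then show thesis using that[of "inv t"] t inv_nonzero[of t] absv_inv[of t] by auto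
qed

lemma continuous_map_val_iff:
  "continuous_map X (val_topology K) f \<longleftrightarrow>
     (\<forall>x\<in>topspace X. f x \<in> carrier K) \<and>
     (\<forall>x\<in>topspace X. \<forall>r>0. \<exists>N. openin X N \<and> x \<in> N \<and> (\<forall>y\<in>N. absv K (f y \<ominus> f x) < r))"
proof (intro iffI conjI)
  assume L: "continuous_map X (val_topology K) f"
  show c: "\<forall>x\<in>topspace X. f x \<in> carrier K"
    using L continuous_map_image_subset_topspace by fastforce
  show "\<forall>x\<in>topspace X. \<forall>r>0. \<exists>N. openin X N \<and> x \<in> N \<and> (\<forall>y\<in>N. absv K (f y \<ominus> f x) < r)"
  proof (intro ballI allI impI)
    fix x and r :: real assume x: "x \<in> topspace X" and r: "0 < r"
    have fx: "f x \<in> carrier K" using c x by blast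
    have "openin (val_topology K) {t \<in> carrier K. absv K (t \<ominus> f x) < r}"
      unfolding openin_val_iff
    proof (intro conjI ballI)
      fix y assume y: "y \<in> {t \<in> carrier K. absv K (t \<ominus> f x) < r}"
      have "absv K (z \<ominus> f x) < r" if "z \<in> carrier K" "absv K (z \<ominus> y) < r - absv K (y \<ominus> f x)" for z
      proof -
        have "z \<ominus> f x = (z \<ominus> y) \<oplus> (y \<ominus> f x)" using that y fx by (simp, algebra)
        then show ?thesis using that y fx absv_triangle[of "z \<ominus> y" "y \<ominus> f x"] by auto
      qed
      then show "\<exists>s>0. \<forall>z\<in>carrier K. absv K (z \<ominus> y) < s \<longrightarrow> z \<in> {t \<in> carrier K. absv K (t \<ominus> f x) < r}"
        using y by (intro exI[of _ "r - absv K (y \<ominus> f x)"]) auto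
    qed auto
    from openin_continuous_map_preimage[OF L this]
    have "openin X {y \<in> topspace X. f y \<in> {t \<in> carrier K. absv K (t \<ominus> f x) < r}}" .
    moreover have "absv K (f x \<ominus> f x) < r" using fx r by (simp add: a_minus_def r_neg)
    ultimately show "\<exists>N. openin X N \<and> x \<in> N \<and> (\<forall>y\<in>N. absv K (f y \<ominus> f x) < r)"
      using x fx by blast
  qed
next
  assume R: "(\<forall>x\<in>topspace X. f x \<in> carrier K) \<and>
     (\<forall>x\<in>topspace X. \<forall>r>0. \<exists>N. openin X N \<and> x \<in> N \<and> (\<forall>y\<in>N. absv K (f y \<ominus> f x) < r))"
  show "continuous_map X (val_topology K) f"
    unfolding continuous_map_def
  proof (intro conjI allI impI)
    show "f \<in> topspace X \<rightarrow> topspace (val_topology K)" using R by auto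
    fix S assume S: "openin (val_topology K) S"
    show "openin X {x \<in> topspace X. f x \<in> S}"
    proof (subst openin_subopen, intro ballI)
      fix x assume x: "x \<in> {x \<in> topspace X. f x \<in> S}"
      then obtain r where r: "r > 0" "\<And>y. \<lbrakk>y \<in> carrier K; absv K (y \<ominus> f x) < r\<rbrakk> \<Longrightarrow> y \<in> S"
        using S unfolding openin_val_iff by blast
      obtain N where N: "openin X N" "x \<in> N" "\<forall>y\<in>N. absv K (f y \<ominus> f x) < r"
        using R x r(1) by blast
      have "y \<in> topspace X \<and> f y \<in> S" if "y \<in> N" for y
        using r(2)[of "f y"] R N that openin_subset[OF N(1)] by auto
      then show "\<exists>T. openin X T \<and> x \<in> T \<and> T \<subseteq> {x \<in> topspace X. f x \<in> S}"
        using N by (intro exI[of _ N]) auto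
    qed
  qed
qed

section \<open>Separation and continuity of the field operations\<close>

lemma Hausdorff_val: "Hausdorff_space (val_topology K)"
  by (simp add: val_topology_def Metric_space.Hausdorff_space_mtopology val_Metric_space)

lemma continuous_map_val_add:
  assumes f: "continuous_map X (val_topology K) f" and g: "continuous_map X (val_topology K) g"
  shows "continuous_map X (val_topology K) (\<lambda>x. f x \<oplus> g x)"
  unfolding continuous_map_val_iff
proof (intro conjI ballI allI impI)
  note F = f[unfolded continuous_map_val_iff] g[unfolded continuous_map_val_iff]
  fix x assume x: "x \<in> topspace X"
  show "f x \<oplus> g x \<in> carrier K" using F x by simp
  fix r :: real assume "0 < r"
  then obtain M N where *: "openin X M" "x \<in> M" "\<forall>y\<in>M. absv K (f y \<ominus> f x) < r/2"
     "openin X N" "x \<in> N" "\<forall>y\<in>N. absv K (g y \<ominus> g x) < r/2"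
    using F x by (meson half_gt_zero)
  show "\<exists>N. openin X N \<and> x \<in> N \<and> (\<forall>y\<in>N. absv K (f y \<oplus> g y \<ominus> (f x \<oplus> g x)) < r)"
  proof (intro exI[of _ "M \<inter> N"] conjI ballI)
    fix y assume y: "y \<in> M \<inter> N"
    then have yX: "y \<in> topspace X" using * openin_subset by blast
    have c: "f x \<in> carrier K" "g x \<in> carrier K" "f y \<in> carrier K" "g y \<in> carrier K"
      using F x yX by auto
    have "f y \<oplus> g y \<ominus> (f x \<oplus> g x) = (f y \<ominus> f x) \<oplus> (g y \<ominus> g x)" using c by algebra
    then show "absv K (f y \<oplus> g y \<ominus> (f x \<oplus> g x)) < r"
      using c * y absv_triangle[of "f y \<ominus> f x" "g y \<ominus> g x"] by fastforce
  qed (use * in auto)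
qed

lemma continuous_map_val_mult:
  assumes f: "continuous_map X (val_topology K) f" and g: "continuous_map X (val_topology K) g"
  shows "continuous_map X (val_topology K) (\<lambda>x. f x \<otimes> g x)"
  unfolding continuous_map_val_iff
proof (intro conjI ballI allI impI)
  note F = f[unfolded continuous_map_val_iff] g[unfolded continuous_map_val_iff]
  fix x assume x: "x \<in> topspace X"
  show "f x \<otimes> g x \<in> carrier K" using F x by simp
  fix r :: real assume r: "0 < r"
  define a where "a = absv K (f x)"
  define b where "b = absv K (g x)"
  have ab: "0 \<le> a" "0 \<le> b" using F x by (auto simp: a_def b_def absv_nonneg)
  \<comment> \<open>The increments p, q of the factors will satisfy |p|, |q| < e, and the product
    changes by pq + f(x)q + pg(x), of absolute value at most e(1 + a + b). The cap 1 bounds |q| in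
    the term pq; the summand 2 instead of 1 makes the final inequality strict.\<close>
  define e where "e = min 1 (r / (a + b + 2))"
  have "e \<le> r / (a + b + 2)" by (simp add: e_def)
  then have e: "e * (a + b + 2) \<le> r" "0 < e" "e \<le> 1"
    using r ab by (simp add: pos_le_divide_eq, simp_all add: e_def)
  obtain M N where *: "openin X M" "x \<in> M" "\<forall>y\<in>M. absv K (f y \<ominus> f x) < e"
     "openin X N" "x \<in> N" "\<forall>y\<in>N. absv K (g y \<ominus> g x) < e"
    using F x e(2) by meson
  show "\<exists>N. openin X N \<and> x \<in> N \<and> (\<forall>y\<in>N. absv K (f y \<otimes> g y \<ominus> f x \<otimes> g x) < r)"
  proof (intro exI[of _ "M \<inter> N"] conjI ballI)
    fix y assume y: "y \<in> M \<inter> N"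
    then have yX: "y \<in> topspace X" using * openin_subset by blast
    have c: "f x \<in> carrier K" "g x \<in> carrier K" "f y \<in> carrier K" "g y \<in> carrier K"
      using F x yX by auto
    define p where "p = f y \<ominus> f x"
    define q where "q = g y \<ominus> g x"
    have pq: "p \<in> carrier K" "q \<in> carrier K" "absv K p < e" "absv K q < e"
      using c * y by (auto simp: p_def q_def)
    have "f y \<otimes> g y \<ominus> f x \<otimes> g x = p \<otimes> q \<oplus> (f x \<otimes> q \<oplus> p \<otimes> g x)"
      unfolding p_def q_def using c by algebra
    then have "absv K (f y \<otimes> g y \<ominus> f x \<otimes> g x) \<le> absv K p * absv K q + (a * absv K q + absv K p * b)"
      using c pq absv_triangle[of "p \<otimes> q" "f x \<otimes> q \<oplus> p \<otimes> g x"] absv_triangle[of "f x \<otimes> q" "p \<otimes> g x"]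
      by (simp add: absv_mult a_def b_def)
    also have "\<dots> \<le> e * 1 + (a * e + e * b)"
      using pq ab e by (intro add_mono mult_mono) (auto simp: absv_nonneg)
    also have "\<dots> < e * (a + b + 2)" using e by (simp add: algebra_simps)
    finally show "absv K (f y \<otimes> g y \<ominus> f x \<otimes> g x) < r" using e by simp
  qed (use * in auto)
qed

end

section \<open>Topological vector spaces\<close>

context topological_vector_space
begin

lemma continuous_map_add:
  assumes "continuous_map X (topol E) f" "continuous_map X (topol E) g"
  shows "continuous_map X (topol E) (\<lambda>x. f x \<oplus>\<^bsub>E\<^esub> g x)"
  using continuous_map_compose[OF continuous_map_pairedI[OF assms] continuous_add]
  by (simp add: o_def)

lemma continuous_map_smult:
  assumes "continuous_map X (val_topology K) f" "continuous_map X (topol E) g"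
  shows "continuous_map X (topol E) (\<lambda>x. f x \<odot>\<^bsub>E\<^esub> g x)"
  using continuous_map_compose[OF continuous_map_pairedI[OF assms] continuous_smult]
  by (simp add: o_def)

lemma continuous_map_smult_const:
  "\<lbrakk>a \<in> carrier K; continuous_map X (topol E) g\<rbrakk> \<Longrightarrow>
    continuous_map X (topol E) (\<lambda>x. a \<odot>\<^bsub>E\<^esub> g x)"
  by (rule continuous_map_smult) simp_all

lemma openin_translate:
  assumes "x \<in> carrier E" "openin (topol E) A"
  shows "openin (topol E) {v \<in> carrier E. x \<oplus>\<^bsub>E\<^esub> v \<in> A}"
proof -
  have "continuous_map (topol E) (topol E) (\<lambda>v. x \<oplus>\<^bsub>E\<^esub> v)"
    using assms by (intro continuous_map_add) (auto simp: topspace_topol)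
  from openin_continuous_map_preimage[OF this assms(2)] show ?thesis
    by (simp add: topspace_topol)
qed

lemma openin_smult_preimage:
  assumes "a \<in> carrier K" "openin (topol E) A"
  shows "openin (topol E) {v \<in> carrier E. a \<odot>\<^bsub>E\<^esub> v \<in> A}"
  using openin_continuous_map_preimage[OF continuous_map_smult_const[OF assms(1) continuous_map_id] assms(2)]
  by (simp add: topspace_topol)

text \<open>Rescaling by a large scalar replaces the small radius given by continuity at \<open>(0, 0)\<close>.\<close>

lemma bounded_smult_nbhd:
  assumes W: "openin (topol E) W" "\<zero>\<^bsub>E\<^esub> \<in> W"
  obtains V where "openin (topol E) V" "\<zero>\<^bsub>E\<^esub> \<in> V"
    "\<And>b x. \<lbrakk>b \<in> carrier K; absv K b \<le> R; x \<in> V\<rbrakk> \<Longrightarrow> b \<odot>\<^bsub>E\<^esub> x \<in> W"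
proof -
  define P where "P = {z \<in> topspace (prod_topology (val_topology K) (topol E)). (\<lambda>(t, x). t \<odot>\<^bsub>E\<^esub> x) z \<in> W}"
  have P: "openin (prod_topology (val_topology K) (topol E)) P"
    unfolding P_def by (rule openin_continuous_map_preimage[OF continuous_smult W(1)])
  have zP: "(\<zero>\<^bsub>K\<^esub>, \<zero>\<^bsub>E\<^esub>) \<in> P"
    using W by (simp add: P_def topspace_topol)
  obtain S V0 where SV: "openin (val_topology K) S" "openin (topol E) V0"
    "\<zero>\<^bsub>K\<^esub> \<in> S" "\<zero>\<^bsub>E\<^esub> \<in> V0" "S \<times> V0 \<subseteq> P"
    using openin_prod_topology_alt[THEN iffD1, rule_format, OF P zP] by (elim exE conjE)
  obtain d where d: "0 < d" "\<And>t. \<lbrakk>t \<in> carrier K; absv K t < d\<rbrakk> \<Longrightarrow> t \<in> S"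
    using openin_val_zero[OF SV(1,3)] by blast
  \<comment> \<open>So large that |b/c| < d whenever |b| <= R. The neighbourhood sought is then the
    preimage of \<open>V0\<close> under multiplication by \<open>c\<close>, because bx =
    (b/c)(cx).\<close>
  obtain c where c: "c \<in> carrier K" "c \<noteq> \<zero>\<^bsub>K\<^esub>" "max 0 (R / d) < absv K c"
    using large_scalar by blast
  have Rc: "R < d * absv K c" using c d by (simp add: pos_divide_less_eq mult.commute)
  note ic = inv_nonzero[OF c(1,2)]
  show thesis
  proof
    show "openin (topol E) {v \<in> carrier E. c \<odot>\<^bsub>E\<^esub> v \<in> V0}"
      using c SV by (intro openin_smult_preimage) auto
    show "\<zero>\<^bsub>E\<^esub> \<in> {v \<in> carrier E. c \<odot>\<^bsub>E\<^esub> v \<in> V0}"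
      using c SV by simp
    fix b x assume b: "b \<in> carrier K" "absv K b \<le> R" and x: "x \<in> {v \<in> carrier E. c \<odot>\<^bsub>E\<^esub> v \<in> V0}"
    have "absv K (b \<otimes>\<^bsub>K\<^esub> inv\<^bsub>K\<^esub> c) < d"
      using b Rc c absv_pos[OF c(1,2)] ic by (simp add: absv_mult absv_inv field_simps)
    then have "b \<otimes>\<^bsub>K\<^esub> inv\<^bsub>K\<^esub> c \<in> S" using d b ic by simp
    then have "(b \<otimes>\<^bsub>K\<^esub> inv\<^bsub>K\<^esub> c) \<odot>\<^bsub>E\<^esub> (c \<odot>\<^bsub>E\<^esub> x) \<in> W" using SV(5) x by (auto simp: P_def)
    moreover have "(b \<otimes>\<^bsub>K\<^esub> inv\<^bsub>K\<^esub> c) \<odot>\<^bsub>E\<^esub> (c \<odot>\<^bsub>E\<^esub> x) = b \<odot>\<^bsub>E\<^esub> x"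
      using b c x ic by (simp add: smult_assoc1[symmetric] m_assoc)
    ultimately show "b \<odot>\<^bsub>E\<^esub> x \<in> W" by simp
  qed
qed

lemma smult_minus_right:
  assumes "a \<in> carrier K" "x \<in> carrier E" "y \<in> carrier E"
  shows "a \<odot>\<^bsub>E\<^esub> (x \<ominus>\<^bsub>E\<^esub> y) = a \<odot>\<^bsub>E\<^esub> x \<ominus>\<^bsub>E\<^esub> a \<odot>\<^bsub>E\<^esub> y"
  using assms by (simp add: a_minus_def smult_r_distr smult_r_minus)

end

text \<open>Negatives are obtained as multiples by -1, so that additive inverses need not be
  exhibited in each of the constructions below.\<close>

lemma topological_vector_spaceI:
  fixes K :: "'k valued_ring" and E :: "('k, 'a) tvs"
  assumes K: "valued_field K"
    and add_closed: "\<And>x y. \<lbrakk>x \<in> carrier E; y \<in> carrier E\<rbrakk> \<Longrightarrow> x \<oplus>\<^bsub>E\<^esub> y \<in> carrier E"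
    and zero: "\<zero>\<^bsub>E\<^esub> \<in> carrier E"
    and add_assoc: "\<And>x y z. \<lbrakk>x \<in> carrier E; y \<in> carrier E; z \<in> carrier E\<rbrakk> \<Longrightarrow>
      x \<oplus>\<^bsub>E\<^esub> y \<oplus>\<^bsub>E\<^esub> z = x \<oplus>\<^bsub>E\<^esub> (y \<oplus>\<^bsub>E\<^esub> z)"
    and add_commute: "\<And>x y. \<lbrakk>x \<in> carrier E; y \<in> carrier E\<rbrakk> \<Longrightarrow> x \<oplus>\<^bsub>E\<^esub> y = y \<oplus>\<^bsub>E\<^esub> x"
    and zero_add: "\<And>x. x \<in> carrier E \<Longrightarrow> \<zero>\<^bsub>E\<^esub> \<oplus>\<^bsub>E\<^esub> x = x"
    and smult_closed: "\<And>a x. \<lbrakk>a \<in> carrier K; x \<in> carrier E\<rbrakk> \<Longrightarrow> a \<odot>\<^bsub>E\<^esub> x \<in> carrier E"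
    and smult_add_left: "\<And>a b x. \<lbrakk>a \<in> carrier K; b \<in> carrier K; x \<in> carrier E\<rbrakk> \<Longrightarrow>
      (a \<oplus>\<^bsub>K\<^esub> b) \<odot>\<^bsub>E\<^esub> x = a \<odot>\<^bsub>E\<^esub> x \<oplus>\<^bsub>E\<^esub> b \<odot>\<^bsub>E\<^esub> x"
    and smult_add_right: "\<And>a x y. \<lbrakk>a \<in> carrier K; x \<in> carrier E; y \<in> carrier E\<rbrakk> \<Longrightarrow>
      a \<odot>\<^bsub>E\<^esub> (x \<oplus>\<^bsub>E\<^esub> y) = a \<odot>\<^bsub>E\<^esub> x \<oplus>\<^bsub>E\<^esub> a \<odot>\<^bsub>E\<^esub> y"
    and smult_assoc: "\<And>a b x. \<lbrakk>a \<in> carrier K; b \<in> carrier K; x \<in> carrier E\<rbrakk> \<Longrightarrow>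
      (a \<otimes>\<^bsub>K\<^esub> b) \<odot>\<^bsub>E\<^esub> x = a \<odot>\<^bsub>E\<^esub> (b \<odot>\<^bsub>E\<^esub> x)"
    and one_smult: "\<And>x. x \<in> carrier E \<Longrightarrow> \<one>\<^bsub>K\<^esub> \<odot>\<^bsub>E\<^esub> x = x"
    and zero_smult: "\<And>x. x \<in> carrier E \<Longrightarrow> \<zero>\<^bsub>K\<^esub> \<odot>\<^bsub>E\<^esub> x = \<zero>\<^bsub>E\<^esub>"
    and top: "topspace (topol E) = carrier E"
    and Hausdorff: "Hausdorff_space (topol E)"
    and "continuous_map (prod_topology (topol E) (topol E)) (topol E) (\<lambda>z. fst z \<oplus>\<^bsub>E\<^esub> snd z)"
    and "continuous_map (prod_topology (val_topology K) (topol E)) (topol E) (\<lambda>z. fst z \<odot>\<^bsub>E\<^esub> snd z)"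
  shows "topological_vector_space K E"
proof -
  interpret valued_field K by (rule K)
  have "abelian_group E"
  proof (rule abelian_groupI)
    fix x assume x: "x \<in> carrier E"
    have "(\<ominus>\<^bsub>K\<^esub> \<one>\<^bsub>K\<^esub>) \<odot>\<^bsub>E\<^esub> x \<oplus>\<^bsub>E\<^esub> x = (\<ominus>\<^bsub>K\<^esub> \<one>\<^bsub>K\<^esub> \<oplus>\<^bsub>K\<^esub> \<one>\<^bsub>K\<^esub>) \<odot>\<^bsub>E\<^esub> x"
      using x by (simp add: smult_add_left one_smult)
    also have "\<dots> = \<zero>\<^bsub>E\<^esub>" using x by (simp add: l_neg zero_smult)
    finally show "\<exists>y\<in>carrier E. y \<oplus>\<^bsub>E\<^esub> x = \<zero>\<^bsub>E\<^esub>"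
      using x smult_closed[of "\<ominus>\<^bsub>K\<^esub> \<one>\<^bsub>K\<^esub>" x] by (metis a_inv_closed one_closed)
  qed (use assms in auto)
  then have "Module.module K E"
    by (intro moduleI) (use assms is_cring in auto)
  then show ?thesis
    using assms
    by (auto simp: topological_vector_space_def topological_vector_space_axioms_def case_prod_unfold)
qed

section \<open>Scalars, products and transported spaces as topological vector spaces\<close>

lemma scalar_tvs_simps [simp]:
  "carrier (scalar_tvs K) = carrier K" "\<zero>\<^bsub>scalar_tvs K\<^esub> = \<zero>\<^bsub>K\<^esub>"
  "s \<oplus>\<^bsub>scalar_tvs K\<^esub> t = s \<oplus>\<^bsub>K\<^esub> t" "s \<odot>\<^bsub>scalar_tvs K\<^esub> t = s \<otimes>\<^bsub>K\<^esub> t"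
  "topol (scalar_tvs K) = val_topology K"
  by (simp_all add: scalar_tvs_def)

lemma prod_tvs_simps [simp]:
  "carrier (prod_tvs E F) = carrier E \<times> carrier F" "\<zero>\<^bsub>prod_tvs E F\<^esub> = (\<zero>\<^bsub>E\<^esub>, \<zero>\<^bsub>F\<^esub>)"
  "z \<oplus>\<^bsub>prod_tvs E F\<^esub> w = (fst z \<oplus>\<^bsub>E\<^esub> fst w, snd z \<oplus>\<^bsub>F\<^esub> snd w)"
  "t \<odot>\<^bsub>prod_tvs E F\<^esub> z = (t \<odot>\<^bsub>E\<^esub> fst z, t \<odot>\<^bsub>F\<^esub> snd z)"
  "topol (prod_tvs E F) = prod_topology (topol E) (topol F)"
  by (simp_all add: prod_tvs_def)

lemma transport_tvs_simps [simp]: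
  "carrier (transport_tvs enc dec E) = enc ` carrier E" "\<zero>\<^bsub>transport_tvs enc dec E\<^esub> = enc \<zero>\<^bsub>E\<^esub>"
  "x \<oplus>\<^bsub>transport_tvs enc dec E\<^esub> y = enc (dec x \<oplus>\<^bsub>E\<^esub> dec y)"
  "t \<odot>\<^bsub>transport_tvs enc dec E\<^esub> x = enc (t \<odot>\<^bsub>E\<^esub> dec x)"
  "topol (transport_tvs enc dec E) = pullback_topology (enc ` carrier E) dec (topol E)"
  by (simp_all add: transport_tvs_def)

lemma scalar_tvs_tvs:
  assumes "valued_field K" shows "topological_vector_space K (scalar_tvs K)"
proof -
  interpret valued_field K by fact
  show ?thesis
    by (rule topological_vector_spaceI)
      (auto simp: assms a_ac m_assoc l_distr r_distr Hausdorff_val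
        intro!: continuous_map_val_add continuous_map_val_mult continuous_map_fst continuous_map_snd)
qed

lemma prod_tvs_tvs:
  assumes "topological_vector_space K E" "topological_vector_space K F"
  shows "topological_vector_space K (prod_tvs E F)"
proof -
  interpret E: topological_vector_space K E by fact
  interpret F: topological_vector_space K F by fact
  note fs = continuous_map_fst continuous_map_snd
    continuous_map_compose[OF continuous_map_fst, unfolded o_def]
    continuous_map_compose[OF continuous_map_snd, unfolded o_def]
  show ?thesis
  proof (rule topological_vector_spaceI)
    show "valued_field K" by unfold_locales
    show "continuous_map (prod_topology (topol (prod_tvs E F)) (topol (prod_tvs E F))) (topol (prod_tvs E F))
      (\<lambda>z. fst z \<oplus>\<^bsub>prod_tvs E F\<^esub> snd z)"
      by (auto intro!: continuous_map_pairedI E.continuous_map_add F.continuous_map_add fs)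
    show "continuous_map (prod_topology (val_topology K) (topol (prod_tvs E F))) (topol (prod_tvs E F))
      (\<lambda>z. fst z \<odot>\<^bsub>prod_tvs E F\<^esub> snd z)"
      by (auto intro!: continuous_map_pairedI E.continuous_map_smult F.continuous_map_smult fs)
  qed (auto simp: E.M.add.m_ac F.M.add.m_ac E.smult_l_distr F.smult_l_distr
      E.smult_r_distr F.smult_r_distr E.smult_assoc1 F.smult_assoc1 E.topspace_topol F.topspace_topol
      Hausdorff_space_prod_topology E.Hausdorff F.Hausdorff)
qed

lemma continuous_map_transport_dec:
  assumes "\<And>x. x \<in> carrier E \<Longrightarrow> dec (enc x) = x" "topspace (topol E) = carrier E"
  shows "continuous_map (topol (transport_tvs enc dec E)) (topol E) dec"
  using continuous_map_pullback[OF continuous_map_id[of "topol E"], of "enc ` carrier E" dec]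
  by simp

lemma continuous_map_into_transport:
  assumes dec: "\<And>x. x \<in> carrier E \<Longrightarrow> dec (enc x) = x" and "topspace (topol E) = carrier E"
    and f: "continuous_map X (topol E) f"
  shows "continuous_map X (topol (transport_tvs enc dec E)) (\<lambda>x. enc (f x))"
  unfolding transport_tvs_simps
proof (rule continuous_map_pullback')
  have c: "f x \<in> carrier E" if "x \<in> topspace X" for x
    using f that assms(2) continuous_map_image_subset_topspace by fastforce
  show "topspace X \<subseteq> (\<lambda>x. enc (f x)) -` enc ` carrier E" using c by auto
  show "continuous_map X (topol E) (dec \<circ> (\<lambda>x. enc (f x)))"
    using f by (rule continuous_map_eq) (simp add: c dec)
qed

text \<open>The topology is initial for \<open>dec\<close>, which is injective on the image of
  \<open>enc\<close>; so continuity into the transported space is tested after \<open>dec\<close>,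
  and separation is inherited.\<close>

lemma transport_tvs_tvs:
  assumes "topological_vector_space K E" and dec: "\<And>x. x \<in> carrier E \<Longrightarrow> dec (enc x) = x"
  shows "topological_vector_space K (transport_tvs enc dec E)"
proof -
  interpret E: topological_vector_space K E by fact
  have dc: "continuous_map (topol (transport_tvs enc dec E)) (topol E) dec"
    using dec E.topspace_topol by (rule continuous_map_transport_dec)
  note cs = continuous_map_compose[OF continuous_map_fst dc, unfolded o_def]
    continuous_map_compose[OF continuous_map_snd dc, unfolded o_def]
  have top: "topspace (topol (transport_tvs enc dec E)) = enc ` carrier E"
    by (auto simp: topspace_pullback_topology E.topspace_topol dec)
  show ?thesis
  proof (rule topological_vector_spaceI)
    show "valued_field K" by unfold_locales
    show "Hausdorff_space (topol (transport_tvs enc dec E))"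
      by (rule Hausdorff_space_injective_preimage[OF E.Hausdorff dc]) (auto simp only: top inj_on_def dec)
    show "continuous_map (prod_topology (topol (transport_tvs enc dec E)) (topol (transport_tvs enc dec E)))
       (topol (transport_tvs enc dec E)) (\<lambda>z. fst z \<oplus>\<^bsub>transport_tvs enc dec E\<^esub> snd z)"
      unfolding transport_tvs_simps(3)
      by (intro continuous_map_into_transport dec E.topspace_topol E.continuous_map_add cs)
    show "continuous_map (prod_topology (val_topology K) (topol (transport_tvs enc dec E)))
       (topol (transport_tvs enc dec E)) (\<lambda>z. fst z \<odot>\<^bsub>transport_tvs enc dec E\<^esub> snd z)"
      unfolding transport_tvs_simps(4)
      by (intro continuous_map_into_transport dec E.topspace_topol E.continuous_map_smult cs continuous_map_fst)
  qed (auto simp: dec E.M.add.m_ac E.smult_l_distr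
      E.smult_r_distr E.smult_assoc1 E.topspace_topol topspace_pullback_topology)
qed

lemma bracket_tvs_tvs:
  "topological_vector_space K E \<Longrightarrow> topological_vector_space K (bracket_tvs K E)"
  unfolding bracket_tvs_def topological_vector_space_def
  by (metis prod_tvs_tvs scalar_tvs_tvs topological_vector_space_def)

lemma unNode_node [simp]: "unNode (node z) = z"
  by (cases z) (simp add: node_def)

lemma iter_tvs_tvs:
  "topological_vector_space K E \<Longrightarrow> topological_vector_space K (iter_tvs K E j)"
  by (induction j) (simp_all add: transport_tvs_tvs bracket_tvs_tvs)

section \<open>The box topology\<close>

lemma dsum_carrier_iff:
  "x \<in> dsum_carrier I E \<longleftrightarrow>
    x \<in> extensional I \<and> (\<forall>i\<in>I. x i \<in> carrier (E i)) \<and> finite {i \<in> I. x i \<noteq> \<zero>\<^bsub>E i\<^esub>}"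
  by (auto simp: dsum_carrier_def PiE_iff)

lemma dsum_set_iff:
  "x \<in> dsum_set I E A \<longleftrightarrow> x \<in> dsum_carrier I E \<and> (\<forall>i\<in>I. x i \<in> A i)"
  by (auto simp: dsum_set_def dsum_carrier_def PiE_iff)

lemma dsum_tvs_simps [simp]:
  "carrier (dsum_tvs I E) = dsum_carrier I E" "\<zero>\<^bsub>dsum_tvs I E\<^esub> = (\<lambda>i\<in>I. \<zero>\<^bsub>E i\<^esub>)"
  "x \<oplus>\<^bsub>dsum_tvs I E\<^esub> y = (\<lambda>i\<in>I. x i \<oplus>\<^bsub>E i\<^esub> y i)"
  "t \<odot>\<^bsub>dsum_tvs I E\<^esub> x = (\<lambda>i\<in>I. t \<odot>\<^bsub>E i\<^esub> x i)"
  "topol (dsum_tvs I E) = box_topology I E"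
  by (simp_all add: dsum_tvs_def dsum_add_def)

lemma dsum_carrier_restrict:
  assumes "\<And>i. i \<in> I \<Longrightarrow> g i \<in> carrier (E i)" "finite D" "\<And>i. \<lbrakk>i \<in> I; i \<notin> D\<rbrakk> \<Longrightarrow> g i = \<zero>\<^bsub>E i\<^esub>"
  shows "(\<lambda>i\<in>I. g i) \<in> dsum_carrier I E"
proof -
  have "{i \<in> I. restrict g I i \<noteq> \<zero>\<^bsub>E i\<^esub>} \<subseteq> D" using assms(3) by auto
  then have "finite {i \<in> I. restrict g I i \<noteq> \<zero>\<^bsub>E i\<^esub>}" using assms(2) by (rule finite_subset)
  then show ?thesis unfolding dsum_carrier_iff using assms(1) by simp
qed

section \<open>The direct sum as a topological vector space\<close>

locale tvs_family =
  fixes K :: "'k valued_ring" and I :: "'i set" and E :: "'i \<Rightarrow> ('k, 'a) tvs"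
  assumes valued_field: "valued_field K"
    and tvs: "i \<in> I \<Longrightarrow> topological_vector_space K (E i)"
begin

lemma module_E: "i \<in> I \<Longrightarrow> Module.module K (E i)"
  using tvs by (simp add: topological_vector_space_def)

lemma abelian_E: "i \<in> I \<Longrightarrow> abelian_group (E i)"
  using module_E by (simp add: Module.module_def)

lemma topspace_E: "i \<in> I \<Longrightarrow> topspace (topol (E i)) = carrier (E i)"
  using tvs topological_vector_space.topspace_topol by blast

lemma zero_E: "i \<in> I \<Longrightarrow> \<zero>\<^bsub>E i\<^esub> \<in> carrier (E i)"
  using abelian_E by (simp add: abelian_group.axioms(1) abelian_monoid.zero_closed)

lemma dsum_add_closed:
  assumes "x \<in> dsum_carrier I E" "y \<in> dsum_carrier I E"
  shows "(\<lambda>i\<in>I. x i \<oplus>\<^bsub>E i\<^esub> y i) \<in> dsum_carrier I E"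
proof (rule dsum_carrier_restrict[of _ _ _ "{i \<in> I. x i \<noteq> \<zero>\<^bsub>E i\<^esub>} \<union> {i \<in> I. y i \<noteq> \<zero>\<^bsub>E i\<^esub>}"])
  fix i assume i: "i \<in> I"
  interpret abelian_group "E i" by (rule abelian_E[OF i])
  show "x i \<oplus>\<^bsub>E i\<^esub> y i \<in> carrier (E i)" using assms i by (simp add: dsum_carrier_iff)
  show "x i \<oplus>\<^bsub>E i\<^esub> y i = \<zero>\<^bsub>E i\<^esub>" if "i \<notin> {i \<in> I. x i \<noteq> \<zero>\<^bsub>E i\<^esub>} \<union> {i \<in> I. y i \<noteq> \<zero>\<^bsub>E i\<^esub>}"
    using that i by simp
qed (use assms in \<open>auto simp: dsum_carrier_iff\<close>)

lemma dsum_smult_closed: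
  assumes "t \<in> carrier K" "x \<in> dsum_carrier I E"
  shows "(\<lambda>i\<in>I. t \<odot>\<^bsub>E i\<^esub> x i) \<in> dsum_carrier I E"
proof (rule dsum_carrier_restrict[of _ _ _ "{i \<in> I. x i \<noteq> \<zero>\<^bsub>E i\<^esub>}"])
  fix i assume i: "i \<in> I"
  interpret Module.module K "E i" by (rule module_E[OF i])
  show "t \<odot>\<^bsub>E i\<^esub> x i \<in> carrier (E i)" using assms i by (simp add: dsum_carrier_iff)
  show "t \<odot>\<^bsub>E i\<^esub> x i = \<zero>\<^bsub>E i\<^esub>" if "i \<notin> {i \<in> I. x i \<noteq> \<zero>\<^bsub>E i\<^esub>}"
    using that i assms by simp
qed (use assms in \<open>auto simp: dsum_carrier_iff\<close>)

lemma dsum_zero_closed: "(\<lambda>i\<in>I. \<zero>\<^bsub>E i\<^esub>) \<in> dsum_carrier I E"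
  by (rule dsum_carrier_restrict[of _ _ _ "{}"]) (auto simp: zero_E)

text \<open>Translations are homeomorphisms of each \<open>E i\<close>, so a translated box around 0
  may be replaced by a box around the point itself. This is the form in which the box topology is
  used from here on.\<close>

lemma openin_box_iff:
  "openin (box_topology I E) W \<longleftrightarrow>
    W \<subseteq> dsum_carrier I E \<and>
    (\<forall>x\<in>W. \<exists>A. (\<forall>i\<in>I. openin (topol (E i)) (A i)) \<and> x \<in> dsum_set I E A \<and> dsum_set I E A \<subseteq> W)"
  unfolding openin_box_topology box_open_def
proof (intro conj_cong refl ball_cong iffI)
  fix x assume W: "W \<subseteq> dsum_carrier I E" and "x \<in> W"
  then have x: "x \<in> dsum_carrier I E" by blast
  then have xi: "x i \<in> carrier (E i)" if "i \<in> I" for i using that by (simp add: dsum_carrier_iff)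
  show "\<exists>A. (\<forall>i\<in>I. openin (topol (E i)) (A i)) \<and> x \<in> dsum_set I E A \<and> dsum_set I E A \<subseteq> W"
    if ex: "\<exists>V. (\<forall>i\<in>I. openin (topol (E i)) (V i) \<and> \<zero>\<^bsub>E i\<^esub> \<in> V i) \<and> dsum_add I E x ` dsum_set I E V \<subseteq> W"
  proof -
    obtain V where V0: "\<forall>i\<in>I. openin (topol (E i)) (V i) \<and> \<zero>\<^bsub>E i\<^esub> \<in> V i"
      and VW: "dsum_add I E x ` dsum_set I E V \<subseteq> W" using ex by blast
    have V: "openin (topol (E i)) (V i)" "\<zero>\<^bsub>E i\<^esub> \<in> V i" if "i \<in> I" for i
      using V0 that by simp_all
    \<comment> \<open>This is -x, written with the scalar -1: closure under scalar multiples is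
      already known, whereas the group structure of the direct sum is not.\<close>
    define m where "m = (\<lambda>i\<in>I. (\<ominus>\<^bsub>K\<^esub> \<one>\<^bsub>K\<^esub>) \<odot>\<^bsub>E i\<^esub> x i)"
    have minus1: "\<ominus>\<^bsub>K\<^esub> \<one>\<^bsub>K\<^esub> \<in> carrier K"
    proof -
      interpret valued_field K by (rule valued_field)
      show ?thesis by simp
    qed
    have m: "m \<in> dsum_carrier I E" unfolding m_def by (rule dsum_smult_closed[OF minus1 x])
    have mi: "m i = \<ominus>\<^bsub>E i\<^esub> x i" if "i \<in> I" for i
    proof -
      interpret Module.module K "E i" by (rule module_E[OF that])
      show ?thesis using that xi[OF that] by (simp add: m_def smult_l_minus)
    qed
    define A where "A i = {y \<in> carrier (E i). m i \<oplus>\<^bsub>E i\<^esub> y \<in> V i}" for i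
    show ?thesis
    proof (intro exI[of _ A] conjI ballI subsetI)
      fix i assume i: "i \<in> I"
      interpret topological_vector_space K "E i" by (rule tvs[OF i])
      show "openin (topol (E i)) (A i)"
        unfolding A_def by (rule openin_translate) (use m V i in \<open>auto simp: dsum_carrier_iff\<close>)
    next
      have "x i \<in> A i" if i: "i \<in> I" for i
      proof -
        interpret topological_vector_space K "E i" by (rule tvs[OF i])
        show ?thesis using i V(2)[OF i] xi[OF i] by (simp add: A_def mi M.l_neg)
      qed
      then show "x \<in> dsum_set I E A" using x by (simp add: dsum_set_iff)
    next
      fix y assume y: "y \<in> dsum_set I E A"
      define v where "v = (\<lambda>i\<in>I. m i \<oplus>\<^bsub>E i\<^esub> y i)"
      have v: "v \<in> dsum_set I E V"
        using dsum_add_closed[OF m, of y] y by (auto simp: v_def dsum_set_iff A_def)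
      have "x i \<oplus>\<^bsub>E i\<^esub> v i = y i" if i: "i \<in> I" for i
      proof -
        interpret topological_vector_space K "E i" by (rule tvs[OF i])
        have "y i \<in> carrier (E i)" using y i by (simp add: dsum_set_iff dsum_carrier_iff)
        then show ?thesis using xi[OF i] i by (simp add: v_def mi M.a_assoc[symmetric] M.r_neg)
      qed
      then have "dsum_add I E x v = y"
        using y by (auto simp: dsum_add_def dsum_set_iff dsum_carrier_iff extensional_def)
      then show "y \<in> W" using VW v by blast
    qed
  qed
  show "\<exists>V. (\<forall>i\<in>I. openin (topol (E i)) (V i) \<and> \<zero>\<^bsub>E i\<^esub> \<in> V i) \<and> dsum_add I E x ` dsum_set I E V \<subseteq> W"
    if ex: "\<exists>A. (\<forall>i\<in>I. openin (topol (E i)) (A i)) \<and> x \<in> dsum_set I E A \<and> dsum_set I E A \<subseteq> W"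
  proof -
    obtain A where A: "\<forall>i\<in>I. openin (topol (E i)) (A i)" "x \<in> dsum_set I E A" "dsum_set I E A \<subseteq> W"
      using ex by blast
    define V where "V i = {v \<in> carrier (E i). x i \<oplus>\<^bsub>E i\<^esub> v \<in> A i}" for i
    have "dsum_add I E x v \<in> dsum_set I E A" if "v \<in> dsum_set I E V" for v
      using that dsum_add_closed[OF x, of v] by (auto simp: dsum_set_iff dsum_add_def V_def)
    moreover have "openin (topol (E i)) (V i) \<and> \<zero>\<^bsub>E i\<^esub> \<in> V i" if i: "i \<in> I" for i
    proof -
      interpret topological_vector_space K "E i" by (rule tvs[OF i])
      show ?thesis
        using openin_translate[OF xi[OF i] A(1)[rule_format, OF i]] A(2) i xi[OF i] by (simp add: V_def dsum_set_iff)
    qed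
    ultimately show ?thesis using A(3) by (intro exI[of _ V]) blast
  qed
qed

lemma topspace_box: "topspace (box_topology I E) = dsum_carrier I E"
proof
  show "topspace (box_topology I E) \<subseteq> dsum_carrier I E"
    using openin_topspace[of "box_topology I E"] unfolding openin_box_iff by blast
  have "openin (box_topology I E) (dsum_carrier I E)"
    unfolding openin_box_iff
    by (auto intro!: exI[of _ "\<lambda>i. topspace (topol (E i))"] simp: dsum_set_iff topspace_E dsum_carrier_iff)
  then show "dsum_carrier I E \<subseteq> topspace (box_topology I E)"
    by (rule openin_subset)
qed

lemma openin_dsum_set:
  "(\<And>i. i \<in> I \<Longrightarrow> openin (topol (E i)) (A i)) \<Longrightarrow> openin (box_topology I E) (dsum_set I E A)"
  unfolding openin_box_iff by (intro conjI ballI exI[of _ A]) (auto simp: dsum_set_iff)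

text \<open>Isolates the difficulty of the box topology: a single neighbourhood \<open>N\<close> has
  to serve all indices at once.\<close>

lemma continuous_map_into_box:
  assumes c: "\<And>x. x \<in> topspace X \<Longrightarrow> g x \<in> dsum_carrier I E"
    and nb: "\<And>x A. \<lbrakk>x \<in> topspace X; \<And>i. i \<in> I \<Longrightarrow> openin (topol (E i)) (A i) \<and> g x i \<in> A i\<rbrakk> \<Longrightarrow>
       \<exists>N. openin X N \<and> x \<in> N \<and> (\<forall>y\<in>N. \<forall>i\<in>I. g y i \<in> A i)"
  shows "continuous_map X (box_topology I E) g"
  unfolding continuous_map_def
proof (intro conjI allI impI)
  show "g \<in> topspace X \<rightarrow> topspace (box_topology I E)" using c by (simp add: topspace_box)
  fix W assume W: "openin (box_topology I E) W"
  show "openin X {x \<in> topspace X. g x \<in> W}"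
  proof (subst openin_subopen, intro ballI)
    fix x assume x: "x \<in> {x \<in> topspace X. g x \<in> W}"
    then obtain A where A: "\<forall>i\<in>I. openin (topol (E i)) (A i)" "g x \<in> dsum_set I E A" "dsum_set I E A \<subseteq> W"
      using W unfolding openin_box_iff by fastforce
    then obtain N where N: "openin X N" "x \<in> N" "\<forall>y\<in>N. \<forall>i\<in>I. g y i \<in> A i"
      using nb[of x A] x by (auto simp: dsum_set_iff)
    have "y \<in> topspace X \<and> g y \<in> W" if "y \<in> N" for y
      using that N A(3) c openin_subset[OF N(1)] by (auto simp: dsum_set_iff subset_iff)
    then show "\<exists>T. openin X T \<and> x \<in> T \<and> T \<subseteq> {x \<in> topspace X. g x \<in> W}"
      using N by (intro exI[of _ N]) auto
  qed
qed

lemma continuous_map_component: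
  assumes i: "i \<in> I" shows "continuous_map (box_topology I E) (topol (E i)) (\<lambda>x. x i)"
  unfolding continuous_map_def
proof (intro conjI allI impI)
  show "(\<lambda>x. x i) \<in> topspace (box_topology I E) \<rightarrow> topspace (topol (E i))"
    using i by (auto simp: topspace_box topspace_E dsum_carrier_iff)
  fix A assume A: "openin (topol (E i)) A"
  have "openin (box_topology I E) (dsum_set I E (\<lambda>j. if j = i then A else topspace (topol (E j))))"
    using A by (intro openin_dsum_set) auto
  also have "dsum_set I E (\<lambda>j. if j = i then A else topspace (topol (E j))) =
      {x \<in> topspace (box_topology I E). x i \<in> A}"
  proof (intro equalityI subsetI)
    fix x assume "x \<in> dsum_set I E (\<lambda>j. if j = i then A else topspace (topol (E j)))"
    then have "x \<in> dsum_carrier I E" "x i \<in> (if i = i then A else topspace (topol (E i)))"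
      using i by (simp only: dsum_set_iff, simp only: dsum_set_iff)
    then show "x \<in> {x \<in> topspace (box_topology I E). x i \<in> A}" by (simp add: topspace_box)
  qed (auto simp: topspace_box topspace_E dsum_carrier_iff dsum_set_iff)
  finally show "openin (box_topology I E) {x \<in> topspace (box_topology I E). x i \<in> A}" .
qed

lemma Hausdorff_box: "Hausdorff_space (box_topology I E)"
  unfolding Hausdorff_space_def
proof (intro allI impI, elim conjE)
  fix x y assume xy: "x \<in> topspace (box_topology I E)" "y \<in> topspace (box_topology I E)" "x \<noteq> y"
  then have "x \<in> extensional I" "y \<in> extensional I" by (simp_all add: topspace_box dsum_carrier_iff)
  then obtain i where i: "i \<in> I" "x i \<noteq> y i"
    using extensionalityI[of x I y] xy(3) by blast
  interpret topological_vector_space K "E i" by (rule tvs[OF i(1)])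
  have "x i \<in> topspace (topol (E i))" "y i \<in> topspace (topol (E i))"
    using xy i by (auto simp: topspace_box topspace_topol dsum_carrier_iff)
  then obtain A B where AB: "openin (topol (E i)) A" "openin (topol (E i)) B" "x i \<in> A" "y i \<in> B" "disjnt A B"
    using Hausdorff[unfolded Hausdorff_space_def, rule_format, of "x i" "y i"] i by auto
  let ?p = "\<lambda>S. {z \<in> topspace (box_topology I E). z i \<in> S}"
  have "openin (box_topology I E) (?p A)" "openin (box_topology I E) (?p B)"
    using openin_continuous_map_preimage[OF continuous_map_component[OF i(1)]] AB by blast+
  then show "\<exists>U V. openin (box_topology I E) U \<and> openin (box_topology I E) V \<and> x \<in> U \<and> y \<in> V \<and> disjnt U V"
    using AB xy by (intro exI[of _ "?p A"] exI[of _ "?p B"]) (auto simp: disjnt_iff)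
qed

text \<open>No argument is shared between components, so neighbourhoods can be chosen for each index
  separately and assembled into two boxes.\<close>

lemma continuous_add_box:
  "continuous_map (prod_topology (box_topology I E) (box_topology I E)) (box_topology I E)
    (\<lambda>z. \<lambda>i\<in>I. fst z i \<oplus>\<^bsub>E i\<^esub> snd z i)"
proof (rule continuous_map_into_box)
  let ?X = "prod_topology (box_topology I E) (box_topology I E)"
  fix z assume z: "z \<in> topspace ?X"
  then have z': "fst z \<in> dsum_carrier I E" "snd z \<in> dsum_carrier I E" by (auto simp: topspace_box)
  then show "(\<lambda>i\<in>I. fst z i \<oplus>\<^bsub>E i\<^esub> snd z i) \<in> dsum_carrier I E" by (rule dsum_add_closed)
  fix A assume A: "\<And>i. i \<in> I \<Longrightarrow> openin (topol (E i)) (A i) \<and> (\<lambda>i\<in>I. fst z i \<oplus>\<^bsub>E i\<^esub> snd z i) i \<in> A i"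
  have "\<exists>B C. openin (topol (E i)) B \<and> openin (topol (E i)) C \<and> fst z i \<in> B \<and> snd z i \<in> C \<and>
      (\<forall>x\<in>B. \<forall>y\<in>C. x \<oplus>\<^bsub>E i\<^esub> y \<in> A i)" if i: "i \<in> I" for i
  proof -
    interpret topological_vector_space K "E i" by (rule tvs[OF i])
    define P where "P = {w \<in> topspace (prod_topology (topol (E i)) (topol (E i))). (\<lambda>(x, y). x \<oplus>\<^bsub>E i\<^esub> y) w \<in> A i}"
    have P: "openin (prod_topology (topol (E i)) (topol (E i))) P"
      unfolding P_def by (rule openin_continuous_map_preimage[OF continuous_add]) (use A i in blast)
    have "(fst z i, snd z i) \<in> P"
      using A[OF i] z' i by (simp add: P_def topspace_topol dsum_carrier_iff)
    from openin_prod_topology_alt[THEN iffD1, rule_format, OF P this]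
    obtain B C where "openin (topol (E i)) B" "openin (topol (E i)) C" "fst z i \<in> B" "snd z i \<in> C" "B \<times> C \<subseteq> P"
      by (elim exE conjE)
    then show ?thesis by (intro exI[of _ B] exI[of _ C]) (auto simp: P_def)
  qed
  then obtain B C where BC: "\<And>i. i \<in> I \<Longrightarrow> openin (topol (E i)) (B i) \<and> openin (topol (E i)) (C i) \<and> fst z i \<in> B i \<and>
      snd z i \<in> C i \<and> (\<forall>x\<in>B i. \<forall>y\<in>C i. x \<oplus>\<^bsub>E i\<^esub> y \<in> A i)" by metis
  show "\<exists>N. openin ?X N \<and> z \<in> N \<and> (\<forall>y\<in>N. \<forall>i\<in>I. (\<lambda>i\<in>I. fst y i \<oplus>\<^bsub>E i\<^esub> snd y i) i \<in> A i)"
  proof (intro exI[of _ "dsum_set I E B \<times> dsum_set I E C"] conjI)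
    show "openin ?X (dsum_set I E B \<times> dsum_set I E C)"
      unfolding openin_prod_Times_iff using openin_dsum_set BC by blast
    show "z \<in> dsum_set I E B \<times> dsum_set I E C"
      using BC z' by (simp add: dsum_set_iff mem_Times_iff)
  qed (use BC in \<open>auto simp: dsum_set_iff\<close>)
qed

text \<open>The simplest instance of the main argument: the scalar is shared by all components. On
  the finite support of the vector, ordinary continuity suffices; elsewhere the vector component is
  0, and \<open>bounded_smult_nbhd\<close> lets all those indices use the same ball of
  scalars.\<close>

lemma continuous_smult_box:
  "continuous_map (prod_topology (val_topology K) (box_topology I E)) (box_topology I E)
    (\<lambda>z. \<lambda>i\<in>I. fst z \<odot>\<^bsub>E i\<^esub> snd z i)"
proof (rule continuous_map_into_box)
  interpret valued_field K by (rule valued_field)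
  let ?X = "prod_topology (val_topology K) (box_topology I E)"
  fix z assume z: "z \<in> topspace ?X"
  then have z': "fst z \<in> carrier K" "snd z \<in> dsum_carrier I E" by (auto simp: topspace_box)
  then show "(\<lambda>i\<in>I. fst z \<odot>\<^bsub>E i\<^esub> snd z i) \<in> dsum_carrier I E" by (rule dsum_smult_closed)
  fix A assume A: "\<And>i. i \<in> I \<Longrightarrow> openin (topol (E i)) (A i) \<and> (\<lambda>i\<in>I. fst z \<odot>\<^bsub>E i\<^esub> snd z i) i \<in> A i"
  define D where "D = {i \<in> I. snd z i \<noteq> \<zero>\<^bsub>E i\<^esub>}"
  have fD: "finite D" using z' by (simp add: D_def dsum_carrier_iff)
  \<comment> \<open>Any radius above |t| would do, t being the scalar \<open>fst z\<close>; it only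
    has to lie in the open ball \<open>S\<close>.\<close>
  define R where "R = absv K (fst z) + 1"
  define S where "S = {t \<in> carrier K. absv K t < R}"
  have "\<exists>P B. openin (val_topology K) P \<and> openin (topol (E i)) B \<and> fst z \<in> P \<and> snd z i \<in> B \<and>
      (i \<notin> D \<longrightarrow> P = S) \<and> (\<forall>t\<in>P. \<forall>x\<in>B. t \<odot>\<^bsub>E i\<^esub> x \<in> A i)" if i: "i \<in> I" for i
  proof -
    interpret topological_vector_space K "E i" by (rule tvs[OF i])
    show ?thesis
    proof (cases "i \<in> D")
      case True
      define P where "P = {w \<in> topspace (prod_topology (val_topology K) (topol (E i))). (\<lambda>(t, x). t \<odot>\<^bsub>E i\<^esub> x) w \<in> A i}"
      have P: "openin (prod_topology (val_topology K) (topol (E i))) P"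
        unfolding P_def by (rule openin_continuous_map_preimage[OF continuous_smult]) (use A i in blast)
      have "(fst z, snd z i) \<in> P"
        using A[OF i] z' i by (simp add: P_def topspace_topol dsum_carrier_iff)
      from openin_prod_topology_alt[THEN iffD1, rule_format, OF P this]
      obtain B C where "openin (val_topology K) B" "openin (topol (E i)) C" "fst z \<in> B" "snd z i \<in> C" "B \<times> C \<subseteq> P"
        by (elim exE conjE)
      then show ?thesis using True by (intro exI[of _ B] exI[of _ C]) (auto simp: P_def)
    next
      case False
      then have z0: "snd z i = \<zero>\<^bsub>E i\<^esub>" using i by (simp add: D_def)
      then have "\<zero>\<^bsub>E i\<^esub> \<in> A i" using A[OF i] z' i by simp
      from bounded_smult_nbhd[OF conjunct1[OF A[OF i]] this, of R]
      obtain V where "openin (topol (E i)) V" "\<zero>\<^bsub>E i\<^esub> \<in> V"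
        "\<And>b x. \<lbrakk>b \<in> carrier K; absv K b \<le> R; x \<in> V\<rbrakk> \<Longrightarrow> b \<odot>\<^bsub>E i\<^esub> x \<in> A i" by blast
      then show ?thesis
        using z0 z' openin_absv_less[of R] by (intro exI[of _ S] exI[of _ V]) (auto simp: S_def R_def)
    qed
  qed
  then obtain P B where PB: "\<And>i. i \<in> I \<Longrightarrow> openin (val_topology K) (P i) \<and> openin (topol (E i)) (B i) \<and>
      fst z \<in> P i \<and> snd z i \<in> B i \<and> (i \<notin> D \<longrightarrow> P i = S) \<and> (\<forall>t\<in>P i. \<forall>x\<in>B i. t \<odot>\<^bsub>E i\<^esub> x \<in> A i)" by metis
  have S: "openin (val_topology K) S" "fst z \<in> S"
    using z' openin_absv_less[of R] by (auto simp: S_def R_def)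
  have DI: "D \<subseteq> I" by (auto simp: D_def)
  \<comment> \<open>Only the finitely many indices in \<open>D\<close> contribute a set of their
    own; all others have \<open>P i = S\<close>.\<close>
  define N where "N = S \<inter> \<Inter>(P ` D)"
  have N: "openin (val_topology K) N"
  proof (cases "D = {}")
    case False
    then show ?thesis unfolding N_def using S fD DI PB by (intro openin_Int openin_Inter) auto
  qed (simp add: N_def S)
  have zN: "fst z \<in> N" using S PB DI by (auto simp: N_def)
  have NP: "N \<subseteq> P i" if "i \<in> I" for i using PB[OF that] by (auto simp: N_def)
  show "\<exists>N. openin ?X N \<and> z \<in> N \<and> (\<forall>y\<in>N. \<forall>i\<in>I. (\<lambda>i\<in>I. fst y \<odot>\<^bsub>E i\<^esub> snd y i) i \<in> A i)"
  proof (intro exI[of _ "N \<times> dsum_set I E B"] conjI)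
    show "openin ?X (N \<times> dsum_set I E B)"
      unfolding openin_prod_Times_iff using openin_dsum_set N PB by blast
    show "z \<in> N \<times> dsum_set I E B"
      using PB z' zN by (simp add: dsum_set_iff mem_Times_iff)
    show "\<forall>y\<in>N \<times> dsum_set I E B. \<forall>i\<in>I. (\<lambda>i\<in>I. fst y \<odot>\<^bsub>E i\<^esub> snd y i) i \<in> A i"
      using PB NP by (fastforce simp: dsum_set_iff)
  qed
qed

lemma dsum_tvs_tvs: "topological_vector_space K (dsum_tvs I E)"
proof (rule topological_vector_spaceI)
  have ext: "(\<lambda>i\<in>I. x i) = x" if "x \<in> dsum_carrier I E" for x
    using that by (simp add: dsum_carrier_iff extensional_restrict)
  have mem: "x i \<in> carrier (E i)" if "i \<in> I" "x \<in> dsum_carrier I E" for i x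
    using that by (simp add: dsum_carrier_iff)
  note ac = abelian_E[THEN abelian_group.axioms(1)]
  note ab = abelian_monoid.a_comm[OF ac] abelian_monoid.a_assoc[OF ac] abelian_monoid.l_zero[OF ac]
  note md = Module.module.smult_l_distr[OF module_E] Module.module.smult_r_distr[OF module_E]
    Module.module.smult_assoc1[OF module_E] Module.module.smult_one[OF module_E]
    Module.module.smult_l_null[OF module_E]
  show "valued_field K" by (rule valued_field)
  show "x \<oplus>\<^bsub>dsum_tvs I E\<^esub> y \<oplus>\<^bsub>dsum_tvs I E\<^esub> z = x \<oplus>\<^bsub>dsum_tvs I E\<^esub> (y \<oplus>\<^bsub>dsum_tvs I E\<^esub> z)"
    if "x \<in> carrier (dsum_tvs I E)" "y \<in> carrier (dsum_tvs I E)" "z \<in> carrier (dsum_tvs I E)" for x y z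
    using that by (auto simp: mem intro!: restrict_ext ab)
  show "x \<oplus>\<^bsub>dsum_tvs I E\<^esub> y = y \<oplus>\<^bsub>dsum_tvs I E\<^esub> x"
    if "x \<in> carrier (dsum_tvs I E)" "y \<in> carrier (dsum_tvs I E)" for x y
    using that by (auto simp: mem intro!: restrict_ext ab)
  show "\<zero>\<^bsub>dsum_tvs I E\<^esub> \<oplus>\<^bsub>dsum_tvs I E\<^esub> x = x" if "x \<in> carrier (dsum_tvs I E)" for x
    using that by (simp add: ab(3) mem ext cong: restrict_cong)
  show "(a \<oplus>\<^bsub>K\<^esub> b) \<odot>\<^bsub>dsum_tvs I E\<^esub> x = a \<odot>\<^bsub>dsum_tvs I E\<^esub> x \<oplus>\<^bsub>dsum_tvs I E\<^esub> b \<odot>\<^bsub>dsum_tvs I E\<^esub> x"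
    if "a \<in> carrier K" "b \<in> carrier K" "x \<in> carrier (dsum_tvs I E)" for a b x
    using that by (auto simp: mem intro!: restrict_ext md)
  show "a \<odot>\<^bsub>dsum_tvs I E\<^esub> (x \<oplus>\<^bsub>dsum_tvs I E\<^esub> y) = a \<odot>\<^bsub>dsum_tvs I E\<^esub> x \<oplus>\<^bsub>dsum_tvs I E\<^esub> a \<odot>\<^bsub>dsum_tvs I E\<^esub> y"
    if "a \<in> carrier K" "x \<in> carrier (dsum_tvs I E)" "y \<in> carrier (dsum_tvs I E)" for a x y
    using that by (auto simp: mem intro!: restrict_ext md)
  show "(a \<otimes>\<^bsub>K\<^esub> b) \<odot>\<^bsub>dsum_tvs I E\<^esub> x = a \<odot>\<^bsub>dsum_tvs I E\<^esub> (b \<odot>\<^bsub>dsum_tvs I E\<^esub> x)"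
    if "a \<in> carrier K" "b \<in> carrier K" "x \<in> carrier (dsum_tvs I E)" for a b x
    using that by (auto simp: mem intro!: restrict_ext md)
  show "\<one>\<^bsub>K\<^esub> \<odot>\<^bsub>dsum_tvs I E\<^esub> x = x" if "x \<in> carrier (dsum_tvs I E)" for x
    using that by (simp add: md mem ext cong: restrict_cong)
  show "\<zero>\<^bsub>K\<^esub> \<odot>\<^bsub>dsum_tvs I E\<^esub> x = \<zero>\<^bsub>dsum_tvs I E\<^esub>" if "x \<in> carrier (dsum_tvs I E)" for x
    using that by (simp add: md mem cong: restrict_cong)
qed (use continuous_add_box continuous_smult_box in
    \<open>auto simp: dsum_add_closed dsum_smult_closed dsum_zero_closed topspace_box Hausdorff_box\<close>)

text \<open>The additive inverse of a record is not given by a component formula, but multiplication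
  by -1 is; comparing the two settles the claim.\<close>

lemma dsum_minus:
  assumes x: "x \<in> dsum_carrier I E" and y: "y \<in> dsum_carrier I E"
  shows "x \<ominus>\<^bsub>dsum_tvs I E\<^esub> y = (\<lambda>i\<in>I. x i \<ominus>\<^bsub>E i\<^esub> y i)"
proof -
  interpret D: topological_vector_space K "dsum_tvs I E" by (rule dsum_tvs_tvs)
  have "(\<ominus>\<^bsub>K\<^esub> \<one>\<^bsub>K\<^esub>) \<odot>\<^bsub>dsum_tvs I E\<^esub> y = \<ominus>\<^bsub>dsum_tvs I E\<^esub> y"
    using y by (subst D.smult_l_minus) (auto simp del: dsum_tvs_simps(4) intro!: arg_cong[where f="a_inv (dsum_tvs I E)"] D.smult_one)
  moreover have "(\<ominus>\<^bsub>K\<^esub> \<one>\<^bsub>K\<^esub>) \<odot>\<^bsub>E i\<^esub> y i = \<ominus>\<^bsub>E i\<^esub> y i" if "i \<in> I" for i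
  proof -
    interpret E: Module.module K "E i" by (rule module_E[OF that])
    show ?thesis using y that by (simp add: E.smult_l_minus dsum_carrier_iff)
  qed
  ultimately have "\<ominus>\<^bsub>dsum_tvs I E\<^esub> y = (\<lambda>i\<in>I. \<ominus>\<^bsub>E i\<^esub> y i)"
    by (metis (no_types, lifting) dsum_tvs_simps(4) restrict_ext)
  then show ?thesis
    unfolding a_minus_def by (auto intro!: restrict_ext)
qed

end

section \<open>Difference quotients\<close>

text \<open>All changes of variables in the proof are continuous linear maps: projections to a
  component, encodings of trees, rescalings and regroupings.\<close>

definition tvs_hom :: "'k valued_ring \<Rightarrow> ('k, 'a) tvs \<Rightarrow> ('k, 'b) tvs \<Rightarrow> ('a \<Rightarrow> 'b) \<Rightarrow> bool" where
  "tvs_hom K E F \<phi> \<longleftrightarrow>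
     continuous_map (topol E) (topol F) \<phi> \<and>
     (\<forall>x\<in>carrier E. \<phi> x \<in> carrier F) \<and>
     (\<forall>x\<in>carrier E. \<forall>y\<in>carrier E. \<phi> (x \<oplus>\<^bsub>E\<^esub> y) = \<phi> x \<oplus>\<^bsub>F\<^esub> \<phi> y) \<and>
     (\<forall>t\<in>carrier K. \<forall>x\<in>carrier E. \<phi> (t \<odot>\<^bsub>E\<^esub> x) = t \<odot>\<^bsub>F\<^esub> \<phi> x)"

lemma tvs_homI:
  assumes "topological_vector_space K E" "topological_vector_space K F"
    and "continuous_map (topol E) (topol F) \<phi>"
    and "\<And>x y. \<lbrakk>x \<in> carrier E; y \<in> carrier E\<rbrakk> \<Longrightarrow> \<phi> (x \<oplus>\<^bsub>E\<^esub> y) = \<phi> x \<oplus>\<^bsub>F\<^esub> \<phi> y"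
    and "\<And>t x. \<lbrakk>t \<in> carrier K; x \<in> carrier E\<rbrakk> \<Longrightarrow> \<phi> (t \<odot>\<^bsub>E\<^esub> x) = t \<odot>\<^bsub>F\<^esub> \<phi> x"
  shows "tvs_hom K E F \<phi>"
proof -
  interpret E: topological_vector_space K E by fact
  interpret F: topological_vector_space K F by fact
  have "\<phi> x \<in> carrier F" if "x \<in> carrier E" for x
    using continuous_map_funspace[OF assms(3)] that by (auto simp: E.topspace_topol F.topspace_topol)
  then show ?thesis using assms by (simp add: tvs_hom_def)
qed

lemma tvs_homD:
  assumes "tvs_hom K E F \<phi>"
  shows tvs_hom_continuous: "continuous_map (topol E) (topol F) \<phi>"
    and tvs_hom_closed: "x \<in> carrier E \<Longrightarrow> \<phi> x \<in> carrier F"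
    and tvs_hom_add: "\<lbrakk>x \<in> carrier E; y \<in> carrier E\<rbrakk> \<Longrightarrow> \<phi> (x \<oplus>\<^bsub>E\<^esub> y) = \<phi> x \<oplus>\<^bsub>F\<^esub> \<phi> y"
    and tvs_hom_smult: "\<lbrakk>t \<in> carrier K; x \<in> carrier E\<rbrakk> \<Longrightarrow> \<phi> (t \<odot>\<^bsub>E\<^esub> x) = t \<odot>\<^bsub>F\<^esub> \<phi> x"
  using assms by (auto simp: tvs_hom_def)

lemma tvs_hom_compose:
  "\<lbrakk>tvs_hom K E F \<phi>; tvs_hom K F G \<psi>\<rbrakk> \<Longrightarrow> tvs_hom K E G (\<psi> \<circ> \<phi>)"
  by (auto simp: tvs_hom_def intro: continuous_map_compose)

lemma power_tvs_simps [simp]: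
  "carrier (power_tvs E n) = (\<Pi>\<^sub>E m\<in>{..<n}. carrier E)"
  "\<zero>\<^bsub>power_tvs E n\<^esub> = (\<lambda>m\<in>{..<n}. \<zero>\<^bsub>E\<^esub>)"
  "x \<oplus>\<^bsub>power_tvs E n\<^esub> y = (\<lambda>m\<in>{..<n}. x m \<oplus>\<^bsub>E\<^esub> y m)"
  "t \<odot>\<^bsub>power_tvs E n\<^esub> x = (\<lambda>m\<in>{..<n}. t \<odot>\<^bsub>E\<^esub> x m)"
  "topol (power_tvs E n) = product_topology (\<lambda>m. topol E) {..<n}"
  by (simp_all add: power_tvs_def)

lemma power_tvs_tvs:
  assumes "topological_vector_space K E"
  shows "topological_vector_space K (power_tvs E n)"
proof -
  interpret topological_vector_space K E by fact
  have ext: "(\<lambda>m\<in>{..<n}. x m) = x" if "x \<in> (\<Pi>\<^sub>E m\<in>{..<n}. carrier E)" for x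
    using that by (simp add: PiE_def extensional_restrict)
  have mem: "x m \<in> carrier E" if "x \<in> (\<Pi>\<^sub>E m\<in>{..<n}. carrier E)" "m < n" for x m
    using that by auto
  note fs = continuous_map_compose[OF continuous_map_fst continuous_map_product_projection, unfolded o_def]
    continuous_map_compose[OF continuous_map_snd continuous_map_product_projection, unfolded o_def]
  show ?thesis
  proof (rule topological_vector_spaceI)
    show "valued_field K" by unfold_locales
    show "continuous_map (prod_topology (topol (power_tvs E n)) (topol (power_tvs E n))) (topol (power_tvs E n))
      (\<lambda>z. fst z \<oplus>\<^bsub>power_tvs E n\<^esub> snd z)"
      by (auto simp: continuous_map_componentwise intro!: continuous_map_add fs)
    show "continuous_map (prod_topology (val_topology K) (topol (power_tvs E n))) (topol (power_tvs E n))
      (\<lambda>z. fst z \<odot>\<^bsub>power_tvs E n\<^esub> snd z)"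
      by (auto simp: continuous_map_componentwise intro!: continuous_map_smult fs continuous_map_fst)
    show "\<zero>\<^bsub>power_tvs E n\<^esub> \<oplus>\<^bsub>power_tvs E n\<^esub> x = x" if "x \<in> carrier (power_tvs E n)" for x
      using that by (simp add: mem ext cong: restrict_cong)
    show "\<one>\<^bsub>K\<^esub> \<odot>\<^bsub>power_tvs E n\<^esub> x = x" if "x \<in> carrier (power_tvs E n)" for x
      using that by (simp add: mem ext cong: restrict_cong)
    show "x \<oplus>\<^bsub>power_tvs E n\<^esub> y \<oplus>\<^bsub>power_tvs E n\<^esub> z = x \<oplus>\<^bsub>power_tvs E n\<^esub> (y \<oplus>\<^bsub>power_tvs E n\<^esub> z)"
      if "x \<in> carrier (power_tvs E n)" "y \<in> carrier (power_tvs E n)" "z \<in> carrier (power_tvs E n)" for x y z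
      using that by (simp, intro restrict_ext, simp add: mem M.a_assoc)
    show "x \<oplus>\<^bsub>power_tvs E n\<^esub> y = y \<oplus>\<^bsub>power_tvs E n\<^esub> x"
      if "x \<in> carrier (power_tvs E n)" "y \<in> carrier (power_tvs E n)" for x y
      using that by (simp, intro restrict_ext, simp add: mem M.a_comm)
    show "(a \<oplus>\<^bsub>K\<^esub> b) \<odot>\<^bsub>power_tvs E n\<^esub> x = a \<odot>\<^bsub>power_tvs E n\<^esub> x \<oplus>\<^bsub>power_tvs E n\<^esub> b \<odot>\<^bsub>power_tvs E n\<^esub> x"
      if "a \<in> carrier K" "b \<in> carrier K" "x \<in> carrier (power_tvs E n)" for a b x
      using that by (simp, intro restrict_ext, simp add: mem smult_l_distr)
    show "a \<odot>\<^bsub>power_tvs E n\<^esub> (x \<oplus>\<^bsub>power_tvs E n\<^esub> y) = a \<odot>\<^bsub>power_tvs E n\<^esub> x \<oplus>\<^bsub>power_tvs E n\<^esub> a \<odot>\<^bsub>power_tvs E n\<^esub> y"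
      if "a \<in> carrier K" "x \<in> carrier (power_tvs E n)" "y \<in> carrier (power_tvs E n)" for a x y
      using that by (simp, intro restrict_ext, simp add: mem smult_r_distr)
    show "(a \<otimes>\<^bsub>K\<^esub> b) \<odot>\<^bsub>power_tvs E n\<^esub> x = a \<odot>\<^bsub>power_tvs E n\<^esub> (b \<odot>\<^bsub>power_tvs E n\<^esub> x)"
      if "a \<in> carrier K" "b \<in> carrier K" "x \<in> carrier (power_tvs E n)" for a b x
      using that by (simp, intro restrict_ext, simp add: mem smult_assoc1)
    show "\<zero>\<^bsub>K\<^esub> \<odot>\<^bsub>power_tvs E n\<^esub> x = \<zero>\<^bsub>power_tvs E n\<^esub>"
      if "x \<in> carrier (power_tvs E n)" for x
      using that by (simp, intro restrict_ext, simp add: mem)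
    show "x \<oplus>\<^bsub>power_tvs E n\<^esub> y \<in> carrier (power_tvs E n)"
      if "x \<in> carrier (power_tvs E n)" "y \<in> carrier (power_tvs E n)" for x y
      using that by (simp add: mem PiE_iff)
    show "a \<odot>\<^bsub>power_tvs E n\<^esub> x \<in> carrier (power_tvs E n)"
      if "a \<in> carrier K" "x \<in> carrier (power_tvs E n)" for a x
      using that by (simp add: mem PiE_iff)
  qed (simp_all add: topspace_topol Hausdorff Hausdorff_space_product_topology)
qed

lemma brace_tvs_tvs:
  assumes "topological_vector_space K E"
  shows "topological_vector_space K (brace_tvs K E j)"
  unfolding brace_tvs_def
  using assms by (intro prod_tvs_tvs power_tvs_tvs scalar_tvs_tvs) (auto simp: topological_vector_space_def)

definition bracket_lift :: "('a \<Rightarrow> 'b) \<Rightarrow> 'a \<times> 'a \<times> 'k \<Rightarrow> 'b \<times> 'b \<times> 'k" where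
  "bracket_lift \<phi> = (\<lambda>(x, y, t). (\<phi> x, \<phi> y, t))"

lemma bracket_lift_simp [simp]: "bracket_lift \<phi> (x, y, t) = (\<phi> x, \<phi> y, t)"
  by (simp add: bracket_lift_def)

lemma bracket_tvs_simps [simp]:
  "carrier (bracket_tvs K E) = carrier E \<times> carrier E \<times> carrier K"
  "(x, y, s) \<oplus>\<^bsub>bracket_tvs K E\<^esub> (x', y', s') = (x \<oplus>\<^bsub>E\<^esub> x', y \<oplus>\<^bsub>E\<^esub> y', s \<oplus>\<^bsub>K\<^esub> s')"
  "t \<odot>\<^bsub>bracket_tvs K E\<^esub> (x, y, s) = (t \<odot>\<^bsub>E\<^esub> x, t \<odot>\<^bsub>E\<^esub> y, t \<otimes>\<^bsub>K\<^esub> s)"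
  "\<zero>\<^bsub>bracket_tvs K E\<^esub> = (\<zero>\<^bsub>E\<^esub>, \<zero>\<^bsub>E\<^esub>, \<zero>\<^bsub>K\<^esub>)"
  "topol (bracket_tvs K E) = prod_topology (topol E) (prod_topology (topol E) (val_topology K))"
  by (simp_all add: bracket_tvs_def)

lemma tvs_hom_bracket_lift:
  assumes "topological_vector_space K E" "topological_vector_space K F" and \<phi>: "tvs_hom K E F \<phi>"
  shows "tvs_hom K (bracket_tvs K E) (bracket_tvs K F) (bracket_lift \<phi>)"
proof (rule tvs_homI)
  let ?X = "prod_topology (topol E) (prod_topology (topol E) (val_topology K))"
  have "continuous_map ?X (topol F) (\<lambda>z. \<phi> (fst z))" "continuous_map ?X (topol F) (\<lambda>z. \<phi> (fst (snd z)))"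
    using continuous_map_compose[OF continuous_map_fst tvs_hom_continuous[OF \<phi>]]
      continuous_map_compose[OF continuous_map_compose[OF continuous_map_snd continuous_map_fst] tvs_hom_continuous[OF \<phi>]]
    by (simp_all add: o_def)
  moreover have "continuous_map ?X (val_topology K) (\<lambda>z. snd (snd z))"
    using continuous_map_compose[OF continuous_map_snd continuous_map_snd] by (simp add: o_def)
  ultimately show "continuous_map (topol (bracket_tvs K E)) (topol (bracket_tvs K F)) (bracket_lift \<phi>)"
    by (simp add: bracket_lift_def case_prod_unfold continuous_map_pairedI)
qed (use assms in \<open>auto simp: bracket_tvs_tvs tvs_homD\<close>)

lemma tvs_hom_dec:
  assumes E: "topological_vector_space K E" and dec: "\<And>x. x \<in> carrier E \<Longrightarrow> dec (enc x) = x"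
  shows "tvs_hom K (transport_tvs enc dec E) E dec"
proof -
  interpret topological_vector_space K E by (rule E)
  show ?thesis
  proof (rule tvs_homI[OF _ E])
    show "topological_vector_space K (transport_tvs enc dec E)"
      using E dec by (rule transport_tvs_tvs)
    show "continuous_map (topol (transport_tvs enc dec E)) (topol E) dec"
      using dec topspace_topol by (rule continuous_map_transport_dec)
  qed (auto simp: dec)
qed

lemma tvs_hom_enc:
  assumes E: "topological_vector_space K E" and dec: "\<And>x. x \<in> carrier E \<Longrightarrow> dec (enc x) = x"
  shows "tvs_hom K E (transport_tvs enc dec E) enc"
proof -
  interpret topological_vector_space K E by (rule E)
  show ?thesis
  proof (rule tvs_homI[OF E])
    show "topological_vector_space K (transport_tvs enc dec E)"
      using E dec by (rule transport_tvs_tvs)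
    show "continuous_map (topol E) (topol (transport_tvs enc dec E)) enc"
      using dec topspace_topol continuous_map_id[unfolded id_def] by (rule continuous_map_into_transport)
  qed (auto simp: dec)
qed

lemma tvs_hom_cong:
  assumes "topological_vector_space K E" "tvs_hom K E F \<phi>" "\<And>x. x \<in> carrier E \<Longrightarrow> \<phi> x = \<psi> x"
  shows "tvs_hom K E F \<psi>"
proof -
  interpret topological_vector_space K E by fact
  have "continuous_map (topol E) (topol F) \<psi>"
    using tvs_hom_continuous[OF assms(2)] by (rule continuous_map_eq) (simp add: topspace_topol assms(3))
  then show ?thesis
    using assms(2) by (simp add: tvs_hom_def assms(3)[symmetric])
qed

text \<open>The scalars at the inner nodes stay as they are. Applied to a projection, this extracts
  one component of a tree, and all components share the same scalars.\<close>

abbreviation tree_map :: "('a \<Rightarrow> 'b) \<Rightarrow> ('a, 'k) dtree \<Rightarrow> ('b, 'k) dtree" where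
  "tree_map \<phi> \<equiv> map_dtree \<phi> (\<lambda>t. t)"

lemma tree_map_node: "tree_map \<phi> (node z) = node (bracket_lift (tree_map \<phi>) z)"
  by (cases z) (simp add: node_def)

lemma tvs_hom_tree_map:
  assumes E: "topological_vector_space K E" and F: "topological_vector_space K F" and \<phi>: "tvs_hom K E F \<phi>"
  shows "tvs_hom K (iter_tvs K E j) (iter_tvs K F j) (tree_map \<phi>)"
proof (induction j)
  case 0
  have "tvs_hom K (iter_tvs K E 0) E unLeaf" "tvs_hom K F (iter_tvs K F 0) Leaf"
    unfolding iter_tvs.simps by (rule tvs_hom_dec[OF E] tvs_hom_enc[OF F], simp)+
  then have "tvs_hom K (iter_tvs K E 0) (iter_tvs K F 0) (Leaf \<circ> (\<phi> \<circ> unLeaf))"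
    using \<phi> by (blast intro: tvs_hom_compose)
  then show ?case
    by (rule tvs_hom_cong[OF iter_tvs_tvs[OF E]]) auto
next
  case (Suc j)
  have "tvs_hom K (iter_tvs K E (Suc j)) (bracket_tvs K (iter_tvs K E j)) unNode"
    "tvs_hom K (bracket_tvs K (iter_tvs K F j)) (iter_tvs K F (Suc j)) node"
    unfolding iter_tvs.simps
    by (rule tvs_hom_dec tvs_hom_enc, simp_all add: bracket_tvs_tvs iter_tvs_tvs E F)+
  moreover have "tvs_hom K (bracket_tvs K (iter_tvs K E j)) (bracket_tvs K (iter_tvs K F j)) (bracket_lift (tree_map \<phi>))"
    by (intro tvs_hom_bracket_lift iter_tvs_tvs Suc E F)
  ultimately have "tvs_hom K (iter_tvs K E (Suc j)) (iter_tvs K F (Suc j)) (node \<circ> (bracket_lift (tree_map \<phi>) \<circ> unNode))"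
    by (blast intro: tvs_hom_compose)
  then show ?case
    by (rule tvs_hom_cong[OF iter_tvs_tvs[OF E]])
      (auto simp only: iter_tvs.simps transport_tvs_simps o_apply unNode_node tree_map_node)
qed

lemma bracket_lift_in_bracket_dom:
  assumes "topological_vector_space K E" and \<phi>: "tvs_hom K E F \<phi>"
    and U: "U' = {x \<in> carrier E. \<phi> x \<in> U}"
  shows "z \<in> bracket_dom K E U' \<longleftrightarrow> z \<in> carrier (bracket_tvs K E) \<and> bracket_lift \<phi> z \<in> bracket_dom K F U"
proof -
  interpret topological_vector_space K E by fact
  show ?thesis
    using tvs_homD[OF \<phi>] by (cases z) (auto simp: bracket_dom_def U)
qed

lemma is_bracket_mapD:
  assumes "is_bracket_map K E U F f g"
  shows "continuous_map (subtopology (topol (bracket_tvs K E)) (bracket_dom K E U)) (topol F) g"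
    and "\<lbrakk>(x, y, t) \<in> bracket_dom K E U; t \<noteq> \<zero>\<^bsub>K\<^esub>\<rbrakk> \<Longrightarrow>
      g (x, y, t) = inv\<^bsub>K\<^esub> t \<odot>\<^bsub>F\<^esub> (f (x \<oplus>\<^bsub>E\<^esub> t \<odot>\<^bsub>E\<^esub> y) \<ominus>\<^bsub>F\<^esub> f x)"
  using assms unfolding is_bracket_map_def by blast+

text \<open>A chain rule that needs no limit: \<phi>(x + ty) = \<phi>(x) + t\<phi>(y) for linear
  \<phi>, so difference quotients of the composite are those of \<open>f\<close> at the transformed
  arguments, with the same t.\<close>

lemma is_bracket_map_comp:
  assumes E: "topological_vector_space K E" and F: "topological_vector_space K F" and \<phi>: "tvs_hom K E F \<phi>"
    and U': "U' \<subseteq> carrier E" "\<And>x. x \<in> U' \<Longrightarrow> \<phi> x \<in> U" and f': "\<And>x. x \<in> U' \<Longrightarrow> f' x = f (\<phi> x)"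
    and g: "is_bracket_map K F U G f g"
  shows "is_bracket_map K E U' G f' (g \<circ> bracket_lift \<phi>)"
proof -
  have mem: "bracket_lift \<phi> z \<in> bracket_dom K F U" if "z \<in> bracket_dom K E U'" for z
    using that U' tvs_homD[OF \<phi>]
    by (cases z) (auto simp: bracket_dom_def subset_iff, metis E F topological_vector_space.axioms(2) Module.module.smult_closed)
  have "continuous_map (subtopology (topol (bracket_tvs K E)) (bracket_dom K E U'))
     (subtopology (topol (bracket_tvs K F)) (bracket_dom K F U)) (bracket_lift \<phi>)"
    using continuous_map_from_subtopology[OF tvs_hom_continuous[OF tvs_hom_bracket_lift[OF E F \<phi>]]] mem
    by (auto simp: continuous_map_in_subtopology)
  moreover have "(g \<circ> bracket_lift \<phi>) (x, y, t) = inv\<^bsub>K\<^esub> t \<odot>\<^bsub>G\<^esub> (f' (x \<oplus>\<^bsub>E\<^esub> t \<odot>\<^bsub>E\<^esub> y) \<ominus>\<^bsub>G\<^esub> f' x)"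
    if z: "(x, y, t) \<in> bracket_dom K E U'" and t: "t \<noteq> \<zero>\<^bsub>K\<^esub>" for x y t
  proof -
    interpret E: topological_vector_space K E by (rule E)
    have c: "x \<in> carrier E" "y \<in> carrier E" "t \<in> carrier K" "x \<in> U'" "x \<oplus>\<^bsub>E\<^esub> t \<odot>\<^bsub>E\<^esub> y \<in> U'"
      using z U' by (auto simp: bracket_dom_def)
    then have "\<phi> (x \<oplus>\<^bsub>E\<^esub> t \<odot>\<^bsub>E\<^esub> y) = \<phi> x \<oplus>\<^bsub>F\<^esub> t \<odot>\<^bsub>F\<^esub> \<phi> y" using tvs_homD[OF \<phi>] by simp
    then show ?thesis
      using g mem[OF z] t c f' by (auto simp: is_bracket_map_def)
  qed
  ultimately show ?thesis
    using g unfolding is_bracket_map_def by (auto intro: continuous_map_compose)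
qed

section \<open>Uniqueness of the difference quotient\<close>

lemma openin_bracket_dom:
  assumes "topological_vector_space K E" "openin (topol E) U"
  shows "openin (topol (bracket_tvs K E)) (bracket_dom K E U)"
proof -
  interpret topological_vector_space K E by fact
  let ?X = "topol (bracket_tvs K E)"
  have c: "continuous_map ?X (topol E) fst" "continuous_map ?X (topol E) (\<lambda>z. fst (snd z))"
    "continuous_map ?X (val_topology K) (\<lambda>z. snd (snd z))"
    using continuous_map_compose[OF continuous_map_snd continuous_map_fst]
      continuous_map_compose[OF continuous_map_snd continuous_map_snd] continuous_map_fst by (simp_all add: o_def)
  have "continuous_map ?X (topol E) (\<lambda>z. fst z \<oplus>\<^bsub>E\<^esub> snd (snd z) \<odot>\<^bsub>E\<^esub> fst (snd z))"
    by (intro continuous_map_add continuous_map_smult c)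
  from openin_Int[OF openin_continuous_map_preimage[OF c(1) assms(2)] openin_continuous_map_preimage[OF this assms(2)]]
  have "openin ?X ({z \<in> topspace ?X. fst z \<in> U} \<inter>
      {z \<in> topspace ?X. fst z \<oplus>\<^bsub>E\<^esub> snd (snd z) \<odot>\<^bsub>E\<^esub> fst (snd z) \<in> U})" .
  also have "\<dots> = bracket_dom K E U"
    using openin_subset[OF assms(2)] by (auto simp: bracket_dom_def topspace_topol)
  finally show ?thesis .
qed

text \<open>With x and y fixed, the open domain contains (x, y, t) for all small t, among them
  nonzero ones; separation in the target then forces equality at t = 0. The maps are arbitrary, not
  just difference quotients, so that a quotient can also be compared with the constant 0.\<close>

lemma bracket_zero_limit:
  assumes E: "topological_vector_space K E" and U: "openin (topol E) U" and F: "Hausdorff_space (topol F)"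
    and h1: "continuous_map (subtopology (topol (bracket_tvs K E)) (bracket_dom K E U)) (topol F) h1"
    and h2: "continuous_map (subtopology (topol (bracket_tvs K E)) (bracket_dom K E U)) (topol F) h2"
    and z: "(x, y, \<zero>\<^bsub>K\<^esub>) \<in> bracket_dom K E U"
    and eq: "\<And>t. \<lbrakk>t \<noteq> \<zero>\<^bsub>K\<^esub>; (x, y, t) \<in> bracket_dom K E U\<rbrakk> \<Longrightarrow> h1 (x, y, t) = h2 (x, y, t)"
  shows "h1 (x, y, \<zero>\<^bsub>K\<^esub>) = h2 (x, y, \<zero>\<^bsub>K\<^esub>)"
proof (rule ccontr)
  interpret topological_vector_space K E by (rule E)
  assume neq: "h1 (x, y, \<zero>\<^bsub>K\<^esub>) \<noteq> h2 (x, y, \<zero>\<^bsub>K\<^esub>)"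
  let ?X = "topol (bracket_tvs K E)" and ?D = "bracket_dom K E U"
  have D: "openin ?X ?D" by (rule openin_bracket_dom[OF E U])
  have top: "topspace (subtopology ?X ?D) = ?D" using openin_subset[OF D] by auto
  have m: "h1 (x, y, \<zero>\<^bsub>K\<^esub>) \<in> topspace (topol F)" "h2 (x, y, \<zero>\<^bsub>K\<^esub>) \<in> topspace (topol F)"
    using continuous_map_funspace[OF h1] continuous_map_funspace[OF h2] z top by blast+
  obtain A B where AB: "openin (topol F) A" "openin (topol F) B" "h1 (x, y, \<zero>\<^bsub>K\<^esub>) \<in> A" "h2 (x, y, \<zero>\<^bsub>K\<^esub>) \<in> B" "disjnt A B"
    using F[unfolded Hausdorff_space_def, rule_format, of "h1 (x, y, \<zero>\<^bsub>K\<^esub>)" "h2 (x, y, \<zero>\<^bsub>K\<^esub>)"] m neq by auto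
  define N where "N = {z \<in> ?D. h1 z \<in> A} \<inter> {z \<in> ?D. h2 z \<in> B}"
  have "openin (subtopology ?X ?D) N"
    using openin_Int[OF openin_continuous_map_preimage[OF h1 AB(1)] openin_continuous_map_preimage[OF h2 AB(2)]]
    unfolding top N_def .
  then have N: "openin ?X N" using D openin_trans_full by blast
  have xy: "x \<in> carrier E" "y \<in> carrier E"
    using z openin_subset[OF U] by (auto simp: bracket_dom_def topspace_topol)
  have "continuous_map (val_topology K) ?X (\<lambda>t. (x, y, t))"
    using xy continuous_map_id[of "val_topology K"]
    by (simp add: continuous_map_paired topspace_topol id_def)
  from openin_continuous_map_preimage[OF this N]
  have "openin (val_topology K) {t \<in> carrier K. (x, y, t) \<in> N}" by simp
  moreover have "\<zero>\<^bsub>K\<^esub> \<in> {t \<in> carrier K. (x, y, t) \<in> N}" using z AB by (simp add: N_def)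
  ultimately obtain r where r: "0 < r" "\<And>t. \<lbrakk>t \<in> carrier K; absv K t < r\<rbrakk> \<Longrightarrow> t \<in> {t \<in> carrier K. (x, y, t) \<in> N}"
    using openin_val_zero[of "{t \<in> carrier K. (x, y, t) \<in> N}"] by auto
  obtain t where t: "t \<in> carrier K" "t \<noteq> \<zero>\<^bsub>K\<^esub>" "absv K t < r" using small_scalar[OF r(1)] by blast
  then have "(x, y, t) \<in> N" using r by blast
  then show False using eq[OF t(2)] AB(5) by (auto simp: N_def disjnt_iff)
qed

lemma is_bracket_map_unique:
  assumes E: "topological_vector_space K E" and U: "openin (topol E) U" and F: "topological_vector_space K F"
    and g: "is_bracket_map K E U F f g" "is_bracket_map K E U F f g'" and z: "z \<in> bracket_dom K E U"
  shows "g z = g' z"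
proof -
  obtain x y t where [simp]: "z = (x, y, t)" by (cases z)
  have eq: "g (x, y, s) = g' (x, y, s)" if "s \<noteq> \<zero>\<^bsub>K\<^esub>" "(x, y, s) \<in> bracket_dom K E U" for s
    using that by (simp add: is_bracket_mapD(2)[OF g(1)] is_bracket_mapD(2)[OF g(2)])
  show ?thesis
  proof (cases "t = \<zero>\<^bsub>K\<^esub>")
    case True
    then show ?thesis
      using bracket_zero_limit[OF E U topological_vector_space.Hausdorff[OF F], of g g' x y] is_bracket_mapD(1)[OF g(1)] is_bracket_mapD(1)[OF g(2)] z eq
      by simp
  qed (use eq z in auto)
qed

lemma is_bracket_map_bracket_map:
  "is_bracket_map K E U F f g \<Longrightarrow> is_bracket_map K E U F f (bracket_map K E U F f)"
  unfolding bracket_map_def by (rule someI[of "is_bracket_map K E U F f"])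

lemma bracket_map_eq:
  assumes "topological_vector_space K E" "openin (topol E) U" "topological_vector_space K F"
    and "is_bracket_map K E U F f g" "z \<in> bracket_dom K E U"
  shows "bracket_map K E U F f z = g z"
  using is_bracket_map_unique[OF assms(1-3) is_bracket_map_bracket_map[OF assms(4)] assms(4,5)] .

section \<open>Iterated domains and the classes C^k, level by level\<close>

lemma openin_transport:
  assumes "topological_vector_space K E" and dec: "\<And>x. x \<in> carrier E \<Longrightarrow> dec (enc x) = x"
    and A: "openin (topol E) A"
  shows "openin (topol (transport_tvs enc dec E)) (enc ` A)"
proof -
  interpret topological_vector_space K E by fact
  have "A \<subseteq> carrier E" using openin_subset[OF A] topspace_topol by simp
  then have "enc ` A = dec -` A \<inter> enc ` carrier E" by (auto simp: dec subset_iff)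
  then show ?thesis using A by (auto simp: openin_pullback_topology)
qed

lemma openin_iter_dom:
  assumes E: "topological_vector_space K E" and U: "openin (topol E) U"
  shows "openin (topol (iter_tvs K E j)) (iter_dom K E U j)"
proof (induction j)
  case 0
  show ?case unfolding iter_tvs.simps iter_dom.simps by (rule openin_transport[OF E _ U]) simp
next
  case (Suc j)
  note T = iter_tvs_tvs[OF E, of j]
  show ?case unfolding iter_tvs.simps iter_dom.simps
    by (rule openin_transport[OF bracket_tvs_tvs[OF T] _ openin_bracket_dom[OF T Suc]]) simp
qed

lemma iter_dom_subset:
  assumes E: "topological_vector_space K E" and U: "openin (topol E) U"
  shows "iter_dom K E U j \<subseteq> carrier (iter_tvs K E j)"
  using openin_subset[OF openin_iter_dom[OF assms]] topological_vector_space.topspace_topol[OF iter_tvs_tvs[OF E]]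
  by simp

text \<open>Isolates what a single level contributes to C^k. Continuity of \<open>f^[j]\<close> is
  left out because for j > 0 it comes from the level below.\<close>

definition iter_differentiable ::
  "'k valued_ring \<Rightarrow> ('k, 'a) tvs \<Rightarrow> 'a set \<Rightarrow> ('k, 'b) tvs \<Rightarrow> ('a \<Rightarrow> 'b) \<Rightarrow> nat \<Rightarrow> bool" where
  "iter_differentiable K E U F f j \<longleftrightarrow>
     (\<exists>g. is_bracket_map K (iter_tvs K E j) (iter_dom K E U j) F (iter_map K E U F f j) g)"

lemma iter_differentiableD:
  "iter_differentiable K E U F f j \<Longrightarrow>
    is_bracket_map K (iter_tvs K E j) (iter_dom K E U j) F (iter_map K E U F f j)
      (iter_map K E U F f (Suc j) \<circ> node)"
  unfolding iter_differentiable_def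
  by (auto dest!: is_bracket_map_bracket_map simp: o_def)

lemma iter_map_eq:
  assumes "topological_vector_space K E" "openin (topol E) U" "topological_vector_space K F"
    and "is_bracket_map K (iter_tvs K E j) (iter_dom K E U j) F (iter_map K E U F f j) g"
    and "z \<in> bracket_dom K (iter_tvs K E j) (iter_dom K E U j)"
  shows "iter_map K E U F f (Suc j) (node z) = g z"
  using bracket_map_eq[OF iter_tvs_tvs[OF assms(1)] openin_iter_dom[OF assms(1,2)] assms(3-5)]
  by simp

lemma C0_on_iter_map_Suc:
  assumes E: "topological_vector_space K E"
    and U: "openin (topol E) U" and D: "iter_differentiable K E U F f j"
  shows "C0_on (iter_tvs K E (Suc j)) (iter_dom K E U (Suc j)) F (iter_map K E U F f (Suc j))"
proof -
  let ?D = "bracket_dom K (iter_tvs K E j) (iter_dom K E U j)"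
  have "continuous_map (topol (iter_tvs K E (Suc j))) (topol (bracket_tvs K (iter_tvs K E j))) unNode"
    unfolding iter_tvs.simps
    by (rule tvs_hom_continuous[OF tvs_hom_dec]) (auto intro: bracket_tvs_tvs iter_tvs_tvs E)
  then have "continuous_map (subtopology (topol (iter_tvs K E (Suc j))) (iter_dom K E U (Suc j)))
     (subtopology (topol (bracket_tvs K (iter_tvs K E j))) ?D) unNode"
    by (auto simp: continuous_map_in_subtopology continuous_map_from_subtopology simp del: bracket_tvs_simps iter_tvs.simps)
  from continuous_map_compose[OF this] iter_differentiableD[OF D]
  have "continuous_map (subtopology (topol (iter_tvs K E (Suc j))) (iter_dom K E U (Suc j))) (topol F)
     (iter_map K E U F f (Suc j) \<circ> node \<circ> unNode)"
    unfolding is_bracket_map_def by blast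
  then show ?thesis
    unfolding C0_on_def by (rule continuous_map_eq) (auto simp del: iter_map.simps iter_tvs.simps)
qed

lemma C0_on_iter_map_0:
  assumes E: "topological_vector_space K E" and "C0_on E U F f"
  shows "C0_on (iter_tvs K E 0) (iter_dom K E U 0) F (iter_map K E U F f 0)"
proof -
  have "continuous_map (topol (iter_tvs K E 0)) (topol E) unLeaf"
    unfolding iter_tvs.simps by (rule tvs_hom_continuous[OF tvs_hom_dec]) (auto intro: E)
  then have "continuous_map (subtopology (topol (iter_tvs K E 0)) (iter_dom K E U 0)) (subtopology (topol E) U) unLeaf"
    by (auto simp: continuous_map_in_subtopology continuous_map_from_subtopology simp del: iter_tvs.simps)
  from continuous_map_compose[OF this] assms(2) show ?thesis by (simp add: C0_on_def)
qed

text \<open>\<open>Cn_on\<close> states its first step on \<open>E\<close> itself and the later ones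
  on trees; the encoding by \<open>Leaf\<close> bridges the two by linear change of
  variables.\<close>

lemma iter_differentiable_0_iff:
  assumes E: "topological_vector_space K E" and U: "openin (topol E) U"
  shows "iter_differentiable K E U F f 0 \<longleftrightarrow> (\<exists>g. is_bracket_map K E U F f g)"
proof
  interpret topological_vector_space K E by (rule E)
  have UE: "U \<subseteq> carrier E" using openin_subset[OF U] topspace_topol by simp
  show "\<exists>g. is_bracket_map K E U F f g" if D: "iter_differentiable K E U F f 0"
  proof -
    obtain g where g: "is_bracket_map K (iter_tvs K E 0) (iter_dom K E U 0) F (iter_map K E U F f 0) g"
      using D unfolding iter_differentiable_def by blast
    have hom: "tvs_hom K E (iter_tvs K E 0) Leaf"
      unfolding iter_tvs.simps by (rule tvs_hom_enc[OF E]) simp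
    have "is_bracket_map K E U F f (g \<circ> bracket_lift Leaf)"
      by (rule is_bracket_map_comp[OF E iter_tvs_tvs[OF E] hom UE _ _ g]) auto
    then show ?thesis by blast
  qed
  show "iter_differentiable K E U F f 0" if ex: "\<exists>g. is_bracket_map K E U F f g"
  proof -
    obtain g where g: "is_bracket_map K E U F f g" using ex by blast
    have hom: "tvs_hom K (iter_tvs K E 0) E unLeaf"
      unfolding iter_tvs.simps by (rule tvs_hom_dec[OF E]) simp
    have "is_bracket_map K (iter_tvs K E 0) (iter_dom K E U 0) F (iter_map K E U F f 0) (g \<circ> bracket_lift unLeaf)"
      by (rule is_bracket_map_comp[OF iter_tvs_tvs[OF E] E hom _ _ _ g]) (use UE in auto)
    then show ?thesis unfolding iter_differentiable_def by blast
  qed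
qed

text \<open>Being a difference quotient of level n - 1 already makes \<open>f^[n]\<close>
  continuous, so the continuity clause in \<open>C1_on\<close> has content only at the
  bottom.\<close>

lemma Cn_on_iff:
  assumes E: "topological_vector_space K E" and U: "openin (topol E) U"
  shows "Cn_on K E U F n f \<longleftrightarrow> C0_on E U F f \<and> (\<forall>j<n. iter_differentiable K E U F f j)"
proof (induction n)
  case (Suc n)
  show ?case
  proof (cases n)
    case 0
    then show ?thesis by (simp add: C1_on_def iter_differentiable_0_iff[OF E U])
  next
    case (Suc m)
    have "C1_on K (iter_tvs K E n) (iter_dom K E U n) F (iter_map K E U F f n) \<longleftrightarrow>
        iter_differentiable K E U F f n" if "iter_differentiable K E U F f m"
      unfolding C1_on_def iter_differentiable_def
      using C0_on_iter_map_Suc[OF E U that] by (simp only: Suc) blast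
    then show ?thesis
      using Suc.IH unfolding Suc by (auto simp only: Cn_on.simps less_Suc_eq all_simps)
  qed
qed simp

text \<open>The inequality is strict because level j produces \<open>f^[j + 1]\<close>. In this form
  finite and infinite \<open>k\<close> need no separate treatment.\<close>

lemma Ck_on_iff:
  assumes E: "topological_vector_space K E" and U: "openin (topol E) U"
  shows "Ck_on K E U F k f \<longleftrightarrow>
    C0_on E U F f \<and> (\<forall>j. enat j < k \<longrightarrow> iter_differentiable K E U F f j)"
  by (cases k) (auto simp: Ck_on_def Cn_on_iff[OF E U])

section \<open>Rescaling the scalar arguments\<close>

lemma node_eq_iff [simp]: "node z = node w \<longleftrightarrow> z = w"
  by (metis unNode_node)

lemma node_in_image [simp]: "node z \<in> node ` A \<longleftrightarrow> z \<in> A"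
  by (auto simp: image_iff)

lemma pred_dtree_node [simp]:
  "pred_dtree P Q (node (X, Y, t)) \<longleftrightarrow> pred_dtree P Q X \<and> pred_dtree P Q Y \<and> Q t"
  by (simp add: node_def)

lemma pred_dtree_mono:
  "\<lbrakk>pred_dtree P Q T; \<And>x. P x \<Longrightarrow> P' x; \<And>t. Q t \<Longrightarrow> Q' t\<rbrakk> \<Longrightarrow> pred_dtree P' Q' T"
  by (induction T) auto

lemma pred_dtree_conj:
  "\<lbrakk>pred_dtree P (\<lambda>_. True) T; pred_dtree (\<lambda>_. True) Q T\<rbrakk> \<Longrightarrow> pred_dtree P Q T"
  by (induction T) auto

text \<open>A tree carries only finitely many scalars; their bound supplies the radius common to all
  components.\<close>

lemma pred_dtree_absv_bound: "\<exists>R. pred_dtree (\<lambda>_. True) (\<lambda>t. absv K t \<le> R) T"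
proof (induction T)
  case (Node X Y t)
  then obtain R S where R: "pred_dtree (\<lambda>_. True) (\<lambda>t. absv K t \<le> R) X" and S: "pred_dtree (\<lambda>_. True) (\<lambda>t. absv K t \<le> S) Y"
    by blast
  let ?M = "max (absv K t) (max R S)"
  have "pred_dtree (\<lambda>_. True) (\<lambda>t. absv K t \<le> ?M) X" by (rule pred_dtree_mono[OF R]) auto
  moreover have "pred_dtree (\<lambda>_. True) (\<lambda>t. absv K t \<le> ?M) Y" by (rule pred_dtree_mono[OF S]) auto
  ultimately have "pred_dtree (\<lambda>_. True) (\<lambda>t. absv K t \<le> ?M) (Node X Y t)" by simp
  then show ?case by blast
qed simp

text \<open>Since (s/a)(aY) = sY, the second point X + sY of a node changes only through the scaling
  of the subtrees; so domains are preserved and quotients change by a scalar factor. The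
  multiplication by \<open>a\<close> acts on the whole right subtree, scalars included.\<close>

primrec tree_scale ::
  "'k valued_ring \<Rightarrow> ('k, 'a) tvs \<Rightarrow> nat \<Rightarrow> 'k \<Rightarrow> ('a, 'k) dtree \<Rightarrow> ('a, 'k) dtree" where
  "tree_scale K E 0 a = id"
| "tree_scale K E (Suc j) a = (\<lambda>T. case unNode T of (X, Y, s) \<Rightarrow>
     node (tree_scale K E j (a \<otimes>\<^bsub>K\<^esub> a) X,
       a \<odot>\<^bsub>iter_tvs K E j\<^esub> tree_scale K E j (a \<otimes>\<^bsub>K\<^esub> a) Y,
       inv\<^bsub>K\<^esub> a \<otimes>\<^bsub>K\<^esub> s))"

lemma tree_scale_node [simp]:
  "tree_scale K E (Suc j) a (node (X, Y, s)) =
     node (tree_scale K E j (a \<otimes>\<^bsub>K\<^esub> a) X,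
       a \<odot>\<^bsub>iter_tvs K E j\<^esub> tree_scale K E j (a \<otimes>\<^bsub>K\<^esub> a) Y,
       inv\<^bsub>K\<^esub> a \<otimes>\<^bsub>K\<^esub> s)"
  by simp

context topological_vector_space
begin

lemma tvs: "topological_vector_space K E"
  by unfold_locales

lemma iter_tvs: "topological_vector_space K (iter_tvs K E j)"
  by (rule iter_tvs_tvs[OF tvs])

lemma iter_carrier_Suc:
  "T \<in> carrier (iter_tvs K E (Suc j)) \<longleftrightarrow>
    (\<exists>X Y s. T = node (X, Y, s) \<and> X \<in> carrier (iter_tvs K E j) \<and> Y \<in> carrier (iter_tvs K E j) \<and> s \<in> carrier K)"
  by auto

lemma square_nonzero: "\<lbrakk>a \<in> carrier K; a \<noteq> \<zero>\<^bsub>K\<^esub>\<rbrakk> \<Longrightarrow> a \<otimes>\<^bsub>K\<^esub> a \<noteq> \<zero>\<^bsub>K\<^esub>"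
  using integral by blast

text \<open>For fixed \<open>a\<close> the map is linear in vectors and scalars together. It
  therefore commutes with forming X + tY, which is what the comparison of domains and of quotients
  rests on.\<close>

lemma tvs_hom_tree_scale:
  "\<lbrakk>a \<in> carrier K; a \<noteq> \<zero>\<^bsub>K\<^esub>\<rbrakk> \<Longrightarrow> tvs_hom K (iter_tvs K E j) (iter_tvs K E j) (tree_scale K E j a)"
proof (induction j arbitrary: a)
  case 0
  show ?case
    by (rule tvs_homI[OF iter_tvs iter_tvs]) auto
next
  case (Suc j)
  interpret J: topological_vector_space K "iter_tvs K E j" by (rule iter_tvs)
  let ?J = "iter_tvs K E j" and ?B = "bracket_tvs K (iter_tvs K E j)" and ?s = "tree_scale K E j (a \<otimes>\<^bsub>K\<^esub> a)"
  have s: "tvs_hom K ?J ?J ?s" using Suc by (intro Suc.IH) (auto simp: square_nonzero)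
  have ia: "inv\<^bsub>K\<^esub> a \<in> carrier K" using Suc.prems by (rule inv_carrier)
  define \<sigma> where "\<sigma> = (\<lambda>z. (?s (fst z), a \<odot>\<^bsub>?J\<^esub> ?s (fst (snd z)), inv\<^bsub>K\<^esub> a \<otimes>\<^bsub>K\<^esub> snd (snd z)))"
  have "tvs_hom K ?B ?B \<sigma>"
  proof (rule tvs_homI[OF bracket_tvs_tvs[OF iter_tvs] bracket_tvs_tvs[OF iter_tvs]])
    have c: "continuous_map (topol ?B) (topol ?J) (\<lambda>z. ?s (fst z))"
      "continuous_map (topol ?B) (topol ?J) (\<lambda>z. ?s (fst (snd z)))"
      "continuous_map (topol ?B) (val_topology K) (\<lambda>z. snd (snd z))"
      using continuous_map_compose[OF continuous_map_fst tvs_hom_continuous[OF s]]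
        continuous_map_compose[OF continuous_map_compose[OF continuous_map_snd continuous_map_fst] tvs_hom_continuous[OF s]]
        continuous_map_compose[OF continuous_map_snd continuous_map_snd]
      by (simp_all add: o_def)
    have "continuous_map (topol ?B) (val_topology K) (\<lambda>z. inv\<^bsub>K\<^esub> a \<otimes>\<^bsub>K\<^esub> snd (snd z))"
      by (intro continuous_map_val_mult c) (simp add: ia)
    then show "continuous_map (topol ?B) (topol ?B) \<sigma>"
      using c J.continuous_map_smult_const[OF Suc.prems(1) c(2)]
      by (simp add: \<sigma>_def continuous_map_pairedI)
  next
    fix z w assume "z \<in> carrier ?B" "w \<in> carrier ?B"
    then show "\<sigma> (z \<oplus>\<^bsub>?B\<^esub> w) = \<sigma> z \<oplus>\<^bsub>?B\<^esub> \<sigma> w"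
      using Suc.prems ia
      by (cases z, cases w) (simp add: \<sigma>_def tvs_homD[OF s] J.smult_r_distr r_distr del: iter_tvs.simps)
  next
    fix t z assume "t \<in> carrier K" "z \<in> carrier ?B"
    then show "\<sigma> (t \<odot>\<^bsub>?B\<^esub> z) = t \<odot>\<^bsub>?B\<^esub> \<sigma> z"
      using Suc.prems ia
      by (cases z) (simp add: \<sigma>_def tvs_homD[OF s] J.smult_assoc1[symmetric] m_lcomm m_comm)
  qed
  moreover have "tvs_hom K (iter_tvs K E (Suc j)) ?B unNode" "tvs_hom K ?B (iter_tvs K E (Suc j)) node"
    unfolding iter_tvs.simps by (rule tvs_hom_dec tvs_hom_enc, rule bracket_tvs_tvs[OF iter_tvs], simp)+
  ultimately have "tvs_hom K (iter_tvs K E (Suc j)) (iter_tvs K E (Suc j)) (node \<circ> (\<sigma> \<circ> unNode))"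
    by (blast intro: tvs_hom_compose)
  then show ?case
    by (rule tvs_hom_cong[OF iter_tvs]) (auto simp: \<sigma>_def)
qed

lemma smult_cancel_inv:
  assumes "a \<in> carrier K" "a \<noteq> \<zero>\<^bsub>K\<^esub>" "s \<in> carrier K" "y \<in> carrier E"
  shows "(inv\<^bsub>K\<^esub> a \<otimes>\<^bsub>K\<^esub> s) \<odot>\<^bsub>E\<^esub> (a \<odot>\<^bsub>E\<^esub> y) = s \<odot>\<^bsub>E\<^esub> y"
proof -
  have "inv\<^bsub>K\<^esub> a \<otimes>\<^bsub>K\<^esub> s \<otimes>\<^bsub>K\<^esub> a = s"
    using assms inv_nonzero[OF assms(1,2)] by (metis m_assoc m_comm r_one)
  then show ?thesis
    using assms inv_carrier[OF assms(1,2)] by (simp add: smult_assoc1[symmetric])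
qed

text \<open>Both base points of the scaled node, X and X + tY after scaling, are images of the
  original ones under the scaling by the square of \<open>a\<close>, so the induction hypothesis
  applies to each. At depth 0 nothing changes.\<close>

lemma tree_scale_in_iter_dom:
  "\<lbrakk>a \<in> carrier K; a \<noteq> \<zero>\<^bsub>K\<^esub>; T \<in> carrier (iter_tvs K E j)\<rbrakk> \<Longrightarrow>
    tree_scale K E j a T \<in> iter_dom K E U j \<longleftrightarrow> T \<in> iter_dom K E U j"
proof (induction j arbitrary: a T)
  case (Suc j)
  interpret J: topological_vector_space K "iter_tvs K E j" by (rule iter_tvs)
  let ?J = "iter_tvs K E j" and ?s = "tree_scale K E j (a \<otimes>\<^bsub>K\<^esub> a)"
  have aa: "a \<otimes>\<^bsub>K\<^esub> a \<in> carrier K" "a \<otimes>\<^bsub>K\<^esub> a \<noteq> \<zero>\<^bsub>K\<^esub>" using Suc.prems by (auto simp: square_nonzero)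
  note s = tvs_homD[OF tvs_hom_tree_scale[OF aa, of j]]
  have ia: "inv\<^bsub>K\<^esub> a \<in> carrier K" using Suc.prems(1,2) by (rule inv_carrier)
  obtain X Y t where T: "T = node (X, Y, t)" and c: "X \<in> carrier ?J" "Y \<in> carrier ?J" "t \<in> carrier K"
    using Suc.prems(3) unfolding iter_carrier_Suc by blast
  have e: "?s X \<oplus>\<^bsub>?J\<^esub> (inv\<^bsub>K\<^esub> a \<otimes>\<^bsub>K\<^esub> t) \<odot>\<^bsub>?J\<^esub> (a \<odot>\<^bsub>?J\<^esub> ?s Y) = ?s (X \<oplus>\<^bsub>?J\<^esub> t \<odot>\<^bsub>?J\<^esub> Y)"
    using c Suc.prems(1,2) by (simp add: s J.smult_cancel_inv)
  have "(?s X, a \<odot>\<^bsub>?J\<^esub> ?s Y, inv\<^bsub>K\<^esub> a \<otimes>\<^bsub>K\<^esub> t) \<in> bracket_dom K ?J (iter_dom K E U j) \<longleftrightarrow>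
      (X, Y, t) \<in> bracket_dom K ?J (iter_dom K E U j)"
    using c Suc.prems(1) ia by (simp add: bracket_dom_def e Suc.IH[OF aa] s(2))
  then show ?case by (simp only: T tree_scale_node iter_dom.simps node_in_image)
qed simp

lemma openin_tree_box:
  assumes V: "openin (topol E) V" and B: "openin (val_topology K) B"
  shows "openin (topol (iter_tvs K E j)) {T \<in> carrier (iter_tvs K E j). pred_dtree (\<lambda>x. x \<in> V) (\<lambda>t. t \<in> B) T}"
    (is "openin _ (?S j)")
proof (induction j)
  case 0
  have "V \<subseteq> carrier E" using openin_subset[OF V] topspace_topol by simp
  then have "?S 0 = Leaf ` V" by auto
  then show ?case unfolding iter_tvs.simps using openin_transport[OF tvs _ V, of unLeaf Leaf] by simp
next
  case (Suc j)
  have "B \<subseteq> carrier K" using openin_subset[OF B] by simp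
  then have "?S (Suc j) = node ` (?S j \<times> ?S j \<times> B)" by (auto simp: image_iff)
  moreover have "openin (topol (bracket_tvs K (iter_tvs K E j))) (?S j \<times> ?S j \<times> B)"
    using Suc B by (simp add: openin_prod_Times_iff)
  ultimately show ?case
    unfolding iter_tvs.simps
    using openin_transport[OF bracket_tvs_tvs[OF iter_tvs[of j]], of unNode node "?S j \<times> ?S j \<times> B"] by simp
qed

text \<open>Trees carry a product topology with finitely many factors, so one \<open>V\<close> can
  serve all leaves and one radius all scalars.\<close>

lemma tree_box_nbhd_zero:
  "\<lbrakk>openin (topol (iter_tvs K E j)) N; \<zero>\<^bsub>iter_tvs K E j\<^esub> \<in> N\<rbrakk> \<Longrightarrow>
    \<exists>V e. openin (topol E) V \<and> \<zero>\<^bsub>E\<^esub> \<in> V \<and> 0 < e \<and>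
      (\<forall>T\<in>carrier (iter_tvs K E j). pred_dtree (\<lambda>x. x \<in> V) (\<lambda>t. absv K t < e) T \<longrightarrow> T \<in> N)"
proof (induction j arbitrary: N)
  case 0
  have "tvs_hom K E (iter_tvs K E 0) Leaf"
    unfolding iter_tvs.simps by (rule tvs_hom_enc[OF tvs]) simp
  from openin_continuous_map_preimage[OF tvs_hom_continuous[OF this] 0(1)]
  have "openin (topol E) {x \<in> carrier E. Leaf x \<in> N}" by (simp add: topspace_topol)
  \<comment> \<open>A tree of depth 0 has no scalars, so any positive radius will do.\<close>
  then show ?case using 0(2)
    by (intro exI[of _ "{x \<in> carrier E. Leaf x \<in> N}"] exI[of _ 1]) auto
next
  case (Suc j)
  let ?J = "iter_tvs K E j"
  interpret J: topological_vector_space K ?J by (rule iter_tvs)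
  have "tvs_hom K (bracket_tvs K ?J) (iter_tvs K E (Suc j)) node"
    unfolding iter_tvs.simps by (rule tvs_hom_enc[OF bracket_tvs_tvs[OF iter_tvs]]) simp
  from openin_continuous_map_preimage[OF tvs_hom_continuous[OF this] Suc.prems(1)]
  have P: "openin (prod_topology (topol ?J) (prod_topology (topol ?J) (val_topology K)))
      {z \<in> carrier (bracket_tvs K ?J). node z \<in> N}" (is "openin _ ?P")
    by (simp add: J.topspace_topol)
  have "(\<zero>\<^bsub>?J\<^esub>, \<zero>\<^bsub>?J\<^esub>, \<zero>\<^bsub>K\<^esub>) \<in> ?P" using Suc.prems(2) by simp
  from openin_prod_topology_alt[THEN iffD1, rule_format, OF P this]
  obtain S R where SR: "openin (topol ?J) S" "openin (prod_topology (topol ?J) (val_topology K)) R"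
     "\<zero>\<^bsub>?J\<^esub> \<in> S" "(\<zero>\<^bsub>?J\<^esub>, \<zero>\<^bsub>K\<^esub>) \<in> R" "S \<times> R \<subseteq> ?P" by (elim exE conjE)
  from openin_prod_topology_alt[THEN iffD1, rule_format, OF SR(2,4)]
  obtain S' B where SB: "openin (topol ?J) S'" "openin (val_topology K) B" "\<zero>\<^bsub>?J\<^esub> \<in> S'" "\<zero>\<^bsub>K\<^esub> \<in> B" "S' \<times> B \<subseteq> R"
    by (elim exE conjE)
  obtain d where d: "0 < d" "\<And>t. \<lbrakk>t \<in> carrier K; absv K t < d\<rbrakk> \<Longrightarrow> t \<in> B" using openin_val_zero[OF SB(2,4)] by blast
  \<comment> \<open>The intersection makes the same \<open>V\<close> and \<open>e\<close> work for
    the left and the right subtree.\<close>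
  have SS': "openin (topol ?J) (S \<inter> S')" "\<zero>\<^bsub>?J\<^esub> \<in> S \<inter> S'" using SR SB by auto
  from Suc.IH[OF SS'] obtain V e where V: "openin (topol E) V" "\<zero>\<^bsub>E\<^esub> \<in> V" "0 < e"
    "\<And>T. \<lbrakk>T \<in> carrier ?J; pred_dtree (\<lambda>x. x \<in> V) (\<lambda>t. absv K t < e) T\<rbrakk> \<Longrightarrow> T \<in> S \<inter> S'" by blast
  have "T \<in> N" if T: "T \<in> carrier (iter_tvs K E (Suc j))" "pred_dtree (\<lambda>x. x \<in> V) (\<lambda>t. absv K t < min d e) T" for T
  proof -
    obtain X Y s where T': "T = node (X, Y, s)" "X \<in> carrier ?J" "Y \<in> carrier ?J" "s \<in> carrier K"
      using T(1) unfolding iter_carrier_Suc by blast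
    have p: "pred_dtree (\<lambda>x. x \<in> V) (\<lambda>t. absv K t < e) X" "pred_dtree (\<lambda>x. x \<in> V) (\<lambda>t. absv K t < e) Y" "absv K s < d"
      using T(2) by (auto simp: T'(1) elim!: pred_dtree_mono)
    have "X \<in> S" "Y \<in> S'" "s \<in> B" using V(4)[OF T'(2) p(1)] V(4)[OF T'(3) p(2)] d(2)[OF T'(4) p(3)] by auto
    then have "(X, Y, s) \<in> ?P" using SR(5) SB(5) by blast
    then show ?thesis by (simp add: T'(1))
  qed
  then show ?case using V d by (intro exI[of _ V] exI[of _ "min d e"]) auto
qed

lemma pred_dtree_smult:
  "\<lbrakk>T \<in> carrier (iter_tvs K E j); pred_dtree P Q T; \<And>x. \<lbrakk>x \<in> carrier E; P x\<rbrakk> \<Longrightarrow> P' (a \<odot>\<^bsub>E\<^esub> x);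
    \<And>t. \<lbrakk>t \<in> carrier K; Q t\<rbrakk> \<Longrightarrow> Q' (a \<otimes>\<^bsub>K\<^esub> t)\<rbrakk> \<Longrightarrow> pred_dtree P' Q' (a \<odot>\<^bsub>iter_tvs K E j\<^esub> T)"
  by (induction j arbitrary: T) auto

text \<open>Scaling by the square of \<open>a\<close> brings the scalars of both subtrees down to
  R/|a|^2. The right subtree is then multiplied by \<open>a\<close>, which gives R/|a|; on the left
  |a| >= 1 gives the same bound, and the scalar at the root is divided by \<open>a\<close>.\<close>

lemma tree_scale_absv:
  "\<lbrakk>a \<in> carrier K; 1 \<le> absv K a; 0 \<le> R; T \<in> carrier (iter_tvs K E j);
    pred_dtree (\<lambda>_. True) (\<lambda>t. absv K t \<le> R) T\<rbrakk> \<Longrightarrow>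
    pred_dtree (\<lambda>_. True) (\<lambda>t. absv K t \<le> R / absv K a) (tree_scale K E j a T)"
proof (induction j arbitrary: a T)
  case (Suc j)
  let ?J = "iter_tvs K E j" and ?s = "tree_scale K E j (a \<otimes>\<^bsub>K\<^esub> a)"
  have a0: "a \<noteq> \<zero>\<^bsub>K\<^esub>" using Suc.prems(2) by auto
  have a1: "1 \<le> absv K a * absv K a" using Suc.prems(2) mult_mono[of 1 "absv K a" 1 "absv K a"] by simp
  obtain X Y t where T: "T = node (X, Y, t)" and c: "X \<in> carrier ?J" "Y \<in> carrier ?J" "t \<in> carrier K"
    using Suc.prems(4) unfolding iter_carrier_Suc by blast
  have IH: "pred_dtree (\<lambda>_. True) (\<lambda>t. absv K t \<le> R / (absv K a * absv K a)) (?s Z)"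
    if "Z \<in> carrier ?J" "pred_dtree (\<lambda>_. True) (\<lambda>t. absv K t \<le> R) Z" for Z
    using Suc.IH[of "a \<otimes>\<^bsub>K\<^esub> a" Z] that Suc.prems a1 by (simp add: absv_mult)
  have p: "pred_dtree (\<lambda>_. True) (\<lambda>t. absv K t \<le> R) X" "pred_dtree (\<lambda>_. True) (\<lambda>t. absv K t \<le> R) Y" "absv K t \<le> R"
    using Suc.prems(5) by (auto simp: T)
  have "R / (absv K a * absv K a) \<le> R / absv K a"
    using Suc.prems(2,3) by (intro divide_left_mono) auto
  then have "pred_dtree (\<lambda>_. True) (\<lambda>t. absv K t \<le> R / absv K a) (?s X)"
    by (intro pred_dtree_mono[OF IH[OF c(1) p(1)]]) auto
  moreover have "pred_dtree (\<lambda>_. True) (\<lambda>t. absv K t \<le> R / absv K a) (a \<odot>\<^bsub>?J\<^esub> ?s Y)"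
  proof (rule pred_dtree_smult[OF _ IH[OF c(2) p(2)]])
    show "?s Y \<in> carrier ?J"
      using tvs_hom_closed[OF tvs_hom_tree_scale c(2)] Suc.prems(1) a0 square_nonzero by simp
    show "absv K (a \<otimes>\<^bsub>K\<^esub> u) \<le> R / absv K a" if "u \<in> carrier K" "absv K u \<le> R / (absv K a * absv K a)" for u
      using that Suc.prems a0 absv_pos[OF Suc.prems(1) a0] by (simp add: absv_mult field_simps)
  qed simp
  moreover have "absv K (inv\<^bsub>K\<^esub> a \<otimes>\<^bsub>K\<^esub> t) \<le> R / absv K a"
  proof -
    have "absv K (inv\<^bsub>K\<^esub> a \<otimes>\<^bsub>K\<^esub> t) = absv K t / absv K a"
      using c(3) inv_carrier[OF Suc.prems(1) a0] absv_inv[OF Suc.prems(1) a0]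
      by (simp add: absv_mult divide_inverse)
    then show ?thesis using p(3) Suc.prems(2) by (simp add: divide_right_mono)
  qed
  ultimately show ?case by (simp only: T tree_scale_node pred_dtree_node)
qed auto

text \<open>Each leaf is multiplied by a power of \<open>a\<close> depending only on its position,
  hence by one of finitely many scalars. In the induction \<open>W\<close> is chosen so that its
  points lie in \<open>V\<close> both before and after multiplication by \<open>a\<close>: the left
  subtree needs the former, the right one the latter.\<close>

lemma tree_scale_leaves:
  "\<lbrakk>a \<in> carrier K; a \<noteq> \<zero>\<^bsub>K\<^esub>; openin (topol E) V; \<zero>\<^bsub>E\<^esub> \<in> V\<rbrakk> \<Longrightarrow>
    \<exists>V'. openin (topol E) V' \<and> \<zero>\<^bsub>E\<^esub> \<in> V' \<and>
      (\<forall>T\<in>carrier (iter_tvs K E j). pred_dtree (\<lambda>x. x \<in> V') (\<lambda>_. True) T \<longrightarrow>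
         pred_dtree (\<lambda>x. x \<in> V) (\<lambda>_. True) (tree_scale K E j a T))"
proof (induction j arbitrary: a V)
  case 0
  then show ?case by (intro exI[of _ V]) auto
next
  case (Suc j)
  let ?J = "iter_tvs K E j" and ?s = "tree_scale K E j (a \<otimes>\<^bsub>K\<^esub> a)"
  have aa: "a \<otimes>\<^bsub>K\<^esub> a \<in> carrier K" "a \<otimes>\<^bsub>K\<^esub> a \<noteq> \<zero>\<^bsub>K\<^esub>" using Suc.prems by (auto simp: square_nonzero)
  define W where "W = V \<inter> {x \<in> carrier E. a \<odot>\<^bsub>E\<^esub> x \<in> V}"
  have W: "openin (topol E) W" "\<zero>\<^bsub>E\<^esub> \<in> W"
    using Suc.prems openin_smult_preimage[of a V] by (auto simp: W_def)
  from Suc.IH[OF aa W] obtain V' where V': "openin (topol E) V'" "\<zero>\<^bsub>E\<^esub> \<in> V'"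
    "\<And>T. \<lbrakk>T \<in> carrier ?J; pred_dtree (\<lambda>x. x \<in> V') (\<lambda>_. True) T\<rbrakk> \<Longrightarrow> pred_dtree (\<lambda>x. x \<in> W) (\<lambda>_. True) (?s T)"
    by blast
  have "pred_dtree (\<lambda>x. x \<in> V) (\<lambda>_. True) (tree_scale K E (Suc j) a T)"
    if T: "T \<in> carrier (iter_tvs K E (Suc j))" "pred_dtree (\<lambda>x. x \<in> V') (\<lambda>_. True) T" for T
  proof -
    obtain X Y t where T': "T = node (X, Y, t)" "X \<in> carrier ?J" "Y \<in> carrier ?J" "t \<in> carrier K"
      using T(1) unfolding iter_carrier_Suc by blast
    have p: "pred_dtree (\<lambda>x. x \<in> W) (\<lambda>_. True) (?s X)" "pred_dtree (\<lambda>x. x \<in> W) (\<lambda>_. True) (?s Y)"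
      using T(2) V'(3)[OF T'(2)] V'(3)[OF T'(3)] by (auto simp: T'(1))
    have "pred_dtree (\<lambda>x. x \<in> V) (\<lambda>_. True) (a \<odot>\<^bsub>?J\<^esub> ?s Y)"
      by (rule pred_dtree_smult[OF tvs_hom_closed[OF tvs_hom_tree_scale[OF aa] T'(3)] p(2)]) (auto simp: W_def)
    moreover have "pred_dtree (\<lambda>x. x \<in> V) (\<lambda>_. True) (?s X)"
      by (rule pred_dtree_mono[OF p(1)]) (auto simp: W_def)
    ultimately show ?thesis by (simp only: T' tree_scale_node pred_dtree_node)
  qed
  then show ?case using V' by blast
qed

end

section \<open>A single map: homogeneity of its difference quotients and their size near zero
  vectors\<close>

locale continuous_tvs_map =
  E: topological_vector_space K E + F: topological_vector_space K F
  for K :: "'k valued_ring" and E :: "('k, 'a) tvs" and F :: "('k, 'b) tvs" +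
  fixes U :: "'a set" and f :: "'a \<Rightarrow> 'b"
  assumes open_U: "openin (topol E) U" and C0: "C0_on E U F f"
begin

lemma U_subset: "U \<subseteq> carrier E"
  using openin_subset[OF open_U] E.topspace_topol by simp

abbreviation dom :: "nat \<Rightarrow> ('a, 'k) dtree set" where
  "dom \<equiv> iter_dom K E U"

abbreviation der :: "nat \<Rightarrow> ('a, 'k) dtree \<Rightarrow> 'b" where
  "der \<equiv> iter_map K E U F f"

text \<open>Differentiability is kept out of the locale: each result on \<open>f^[j]\<close> asks
  only for the levels below j, so the locale also applies to the direct sum as soon as it is known
  to be continuous.\<close>

abbreviation differentiable_below :: "nat \<Rightarrow> bool" where
  "differentiable_below j \<equiv> \<forall>i<j. iter_differentiable K E U F f i"

lemma dom_subset: "dom j \<subseteq> carrier (iter_tvs K E j)"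
  by (rule iter_dom_subset[OF E.tvs open_U])

lemma der_continuous: "differentiable_below j \<Longrightarrow> C0_on (iter_tvs K E j) (dom j) F (der j)"
  by (cases j) (use C0_on_iter_map_0[OF E.tvs C0] C0_on_iter_map_Suc[OF E.tvs open_U] in \<open>auto simp only: lessI\<close>)

lemma der_closed: "\<lbrakk>differentiable_below j; T \<in> dom j\<rbrakk> \<Longrightarrow> der j T \<in> carrier F"
  using der_continuous[of j] dom_subset[of j] topological_vector_space.topspace_topol[OF E.iter_tvs, of j]
  unfolding C0_on_def by (auto simp: F.topspace_topol Pi_iff subset_iff dest!: continuous_map_funspace)

lemma der_Suc:
  assumes "iter_differentiable K E U F f j" "(X, Y, t) \<in> bracket_dom K (iter_tvs K E j) (dom j)" "t \<noteq> \<zero>\<^bsub>K\<^esub>"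
  shows "der (Suc j) (node (X, Y, t)) =
    inv\<^bsub>K\<^esub> t \<odot>\<^bsub>F\<^esub> (der j (X \<oplus>\<^bsub>iter_tvs K E j\<^esub> t \<odot>\<^bsub>iter_tvs K E j\<^esub> Y) \<ominus>\<^bsub>F\<^esub> der j X)"
  using is_bracket_mapD(2)[OF iter_differentiableD[OF assms(1)] assms(2,3)] by (simp add: o_def)

text \<open>
  From \<open>f\<^sup>[\<^sup>1\<^sup>](x, y, s) = a\<^sup>-\<^sup>1 f\<^sup>[\<^sup>1\<^sup>](x, a y, a\<^sup>-\<^sup>1 s)\<close>, applied at every level: for large
  \<open>a\<close>, the right-hand side only involves small scalars. The parameter is squared in the
  subtrees because the factor \<open>a\<close> in the second one enlarges its scalars again.
\<close>

lemma der_tree_scale: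
  "\<lbrakk>differentiable_below j; a \<in> carrier K; 1 \<le> absv K a\<rbrakk> \<Longrightarrow>
    \<exists>b\<in>carrier K. absv K b \<le> 1 \<and> (\<forall>T\<in>dom j. der j T = b \<odot>\<^bsub>F\<^esub> der j (tree_scale K E j a T))"
proof (induction j arbitrary: a)
  case 0
  then show ?case using der_closed[of 0] by (intro bexI[of _ "\<one>\<^bsub>K\<^esub>"]) auto
next
  case (Suc j)
  interpret J: topological_vector_space K "iter_tvs K E j" by (rule E.iter_tvs)
  let ?J = "iter_tvs K E j" and ?B = "bracket_tvs K (iter_tvs K E j)"
  let ?D = "bracket_dom K ?J (dom j)"
  let ?s = "tree_scale K E j (a \<otimes>\<^bsub>K\<^esub> a)" and ?S = "tree_scale K E (Suc j) a"
  have dj: "differentiable_below j" "iter_differentiable K E U F f j" using Suc.prems(1) by auto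
  have a: "a \<in> carrier K" "a \<noteq> \<zero>\<^bsub>K\<^esub>" using Suc.prems by auto
  have aa: "a \<otimes>\<^bsub>K\<^esub> a \<in> carrier K" "a \<otimes>\<^bsub>K\<^esub> a \<noteq> \<zero>\<^bsub>K\<^esub>" using a by (auto simp: E.square_nonzero)
  have "1 \<le> absv K (a \<otimes>\<^bsub>K\<^esub> a)"
    using Suc.prems(3) mult_mono[of 1 "absv K a" 1 "absv K a"] a by (simp add: E.absv_mult)
  from Suc.IH[OF dj(1) aa(1) this] obtain b where b: "b \<in> carrier K" "absv K b \<le> 1"
    "\<And>T. T \<in> dom j \<Longrightarrow> der j T = b \<odot>\<^bsub>F\<^esub> der j (?s T)" by blast
  note ia = E.inv_nonzero[OF a]
  note s = tvs_homD[OF E.tvs_hom_tree_scale[OF aa, of j]]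
  \<comment> \<open>The quotient at the scaled node divides by t/a, which produces an extra factor
    \<open>a\<close> to be cancelled. The factor \<open>b\<close> restores both values of
    \<open>f^[j]\<close>; this works because it does not depend on the tree.\<close>
  define c where "c = b \<otimes>\<^bsub>K\<^esub> inv\<^bsub>K\<^esub> a"
  have c: "c \<in> carrier K" "absv K c \<le> 1"
    using a b ia Suc.prems(3) by (simp_all add: c_def E.absv_mult E.absv_inv mult_le_one inverse_le_1_iff)
  have homs: "tvs_hom K (iter_tvs K E (Suc j)) ?B unNode" "tvs_hom K ?B (iter_tvs K E (Suc j)) node"
    unfolding iter_tvs.simps by (rule tvs_hom_dec tvs_hom_enc, rule bracket_tvs_tvs[OF E.iter_tvs], simp)+
  have Sdom: "?S (node z) \<in> dom (Suc j)" if "z \<in> ?D" for z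
  proof -
    have "node z \<in> dom (Suc j)" using that by simp
    moreover from this have "node z \<in> carrier (iter_tvs K E (Suc j))" using dom_subset by blast
    ultimately show ?thesis using E.tree_scale_in_iter_dom[OF a] by blast
  qed
  \<comment> \<open>The right-hand side of the scaling law, as a function of the unscaled node, is
    offered as a candidate for the quotient; uniqueness then extends the law to t = 0.\<close>
  have "is_bracket_map K ?J (dom j) F (der j) (\<lambda>z. c \<odot>\<^bsub>F\<^esub> der (Suc j) (?S (node z)))"
    unfolding is_bracket_map_def
  proof (intro conjI)
    have "continuous_map (topol ?B) (topol (iter_tvs K E (Suc j))) (\<lambda>z. ?S (node z))"
      using continuous_map_compose[OF tvs_hom_continuous[OF homs(2)] tvs_hom_continuous[OF E.tvs_hom_tree_scale[OF a]]]
      by (simp only: o_def)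
    then have "continuous_map (subtopology (topol ?B) ?D)
        (subtopology (topol (iter_tvs K E (Suc j))) (dom (Suc j))) (\<lambda>z. ?S (node z))"
      using Sdom by (auto simp only: continuous_map_in_subtopology continuous_map_from_subtopology topspace_subtopology)
    from continuous_map_compose[OF this der_continuous[OF Suc.prems(1), unfolded C0_on_def]]
    show "continuous_map (subtopology (topol ?B) ?D) (topol F) (\<lambda>z. c \<odot>\<^bsub>F\<^esub> der (Suc j) (?S (node z)))"
      unfolding o_def by (intro F.continuous_map_smult_const c)
    have "c \<odot>\<^bsub>F\<^esub> der (Suc j) (?S (node (X, Y, t))) =
         inv\<^bsub>K\<^esub> t \<odot>\<^bsub>F\<^esub> (der j (X \<oplus>\<^bsub>?J\<^esub> t \<odot>\<^bsub>?J\<^esub> Y) \<ominus>\<^bsub>F\<^esub> der j X)"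
      if z: "(X, Y, t) \<in> ?D" and t0: "t \<noteq> \<zero>\<^bsub>K\<^esub>" for X Y t
    proof -
      have m: "X \<in> dom j" "Y \<in> carrier ?J" "t \<in> carrier K" "X \<oplus>\<^bsub>?J\<^esub> t \<odot>\<^bsub>?J\<^esub> Y \<in> dom j"
        using z by (auto simp: bracket_dom_def)
      have X: "X \<in> carrier ?J" using m dom_subset by blast
      note it = E.inv_nonzero[OF m(3) t0]
      have sX: "?s X \<in> dom j" "?s (X \<oplus>\<^bsub>?J\<^esub> t \<odot>\<^bsub>?J\<^esub> Y) \<in> dom j"
        using m X by (simp_all add: E.tree_scale_in_iter_dom[OF aa])
      have sXY: "?s X \<oplus>\<^bsub>?J\<^esub> (inv\<^bsub>K\<^esub> a \<otimes>\<^bsub>K\<^esub> t) \<odot>\<^bsub>?J\<^esub> (a \<odot>\<^bsub>?J\<^esub> ?s Y) = ?s (X \<oplus>\<^bsub>?J\<^esub> t \<odot>\<^bsub>?J\<^esub> Y)"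
        using a X m by (simp add: s J.smult_cancel_inv)
      have n0: "inv\<^bsub>K\<^esub> a \<otimes>\<^bsub>K\<^esub> t \<noteq> \<zero>\<^bsub>K\<^esub>" using E.integral[of "inv\<^bsub>K\<^esub> a" t] ia m(3) t0 by blast
      have inv: "inv\<^bsub>K\<^esub> (inv\<^bsub>K\<^esub> a \<otimes>\<^bsub>K\<^esub> t) = a \<otimes>\<^bsub>K\<^esub> inv\<^bsub>K\<^esub> t"
      proof (rule E.comm_inv_char)
        have "inv\<^bsub>K\<^esub> a \<otimes>\<^bsub>K\<^esub> t \<otimes>\<^bsub>K\<^esub> (a \<otimes>\<^bsub>K\<^esub> inv\<^bsub>K\<^esub> t) = (inv\<^bsub>K\<^esub> a \<otimes>\<^bsub>K\<^esub> a) \<otimes>\<^bsub>K\<^esub> (t \<otimes>\<^bsub>K\<^esub> inv\<^bsub>K\<^esub> t)"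
          using a(1) ia(1) m(3) it(1) by (simp add: E.m_ac)
        then show "inv\<^bsub>K\<^esub> a \<otimes>\<^bsub>K\<^esub> t \<otimes>\<^bsub>K\<^esub> (a \<otimes>\<^bsub>K\<^esub> inv\<^bsub>K\<^esub> t) = \<one>\<^bsub>K\<^esub>" using ia it by simp
      qed (use a ia m it in auto)
      let ?d = "der j (?s (X \<oplus>\<^bsub>?J\<^esub> t \<odot>\<^bsub>?J\<^esub> Y)) \<ominus>\<^bsub>F\<^esub> der j (?s X)"
      have d: "?d \<in> carrier F" using der_closed[OF dj(1)] sX by simp
      have "(?s X, a \<odot>\<^bsub>?J\<^esub> ?s Y, inv\<^bsub>K\<^esub> a \<otimes>\<^bsub>K\<^esub> t) \<in> ?D"
        using sX m a ia s(2)[OF m(2)] by (simp add: bracket_dom_def sXY)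
      from der_Suc[OF dj(2) this n0]
      have "der (Suc j) (?S (node (X, Y, t))) = (a \<otimes>\<^bsub>K\<^esub> inv\<^bsub>K\<^esub> t) \<odot>\<^bsub>F\<^esub> ?d"
        by (simp only: tree_scale_node inv sXY)
      then have "c \<odot>\<^bsub>F\<^esub> der (Suc j) (?S (node (X, Y, t))) = (c \<otimes>\<^bsub>K\<^esub> (a \<otimes>\<^bsub>K\<^esub> inv\<^bsub>K\<^esub> t)) \<odot>\<^bsub>F\<^esub> ?d"
        using c a it d by (simp only: F.smult_assoc1 E.m_closed)
      also have "c \<otimes>\<^bsub>K\<^esub> (a \<otimes>\<^bsub>K\<^esub> inv\<^bsub>K\<^esub> t) = (inv\<^bsub>K\<^esub> t \<otimes>\<^bsub>K\<^esub> b) \<otimes>\<^bsub>K\<^esub> (inv\<^bsub>K\<^esub> a \<otimes>\<^bsub>K\<^esub> a)"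
        using a(1) b(1) ia(1) it(1) by (simp add: c_def E.m_ac)
      also have "\<dots> = inv\<^bsub>K\<^esub> t \<otimes>\<^bsub>K\<^esub> b" using ia it b by simp
      also have "(inv\<^bsub>K\<^esub> t \<otimes>\<^bsub>K\<^esub> b) \<odot>\<^bsub>F\<^esub> ?d = inv\<^bsub>K\<^esub> t \<odot>\<^bsub>F\<^esub> (b \<odot>\<^bsub>F\<^esub> ?d)"
        using it b d by (simp only: F.smult_assoc1)
      also have "b \<odot>\<^bsub>F\<^esub> ?d = der j (X \<oplus>\<^bsub>?J\<^esub> t \<odot>\<^bsub>?J\<^esub> Y) \<ominus>\<^bsub>F\<^esub> der j X"
        using F.smult_minus_right[OF b(1)] der_closed[OF dj(1)] sX b(3)[OF m(1)] b(3)[OF m(4)] by simp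
      finally show ?thesis .
    qed
    then show "\<forall>(X, Y, t)\<in>?D. t \<noteq> \<zero>\<^bsub>K\<^esub> \<longrightarrow> c \<odot>\<^bsub>F\<^esub> der (Suc j) (?S (node (X, Y, t))) =
         inv\<^bsub>K\<^esub> t \<odot>\<^bsub>F\<^esub> (der j (X \<oplus>\<^bsub>?J\<^esub> t \<odot>\<^bsub>?J\<^esub> Y) \<ominus>\<^bsub>F\<^esub> der j X)" by blast
  qed
  from iter_map_eq[OF E.tvs open_U F.tvs this]
  have "der (Suc j) T = c \<odot>\<^bsub>F\<^esub> der (Suc j) (?S T)" if "T \<in> dom (Suc j)" for T
    using that by (auto simp only: iter_dom.simps)
  then show ?case using c by blast
qed

lemma zero_in_dom: "\<zero>\<^bsub>E\<^esub> \<in> U \<Longrightarrow> \<zero>\<^bsub>iter_tvs K E j\<^esub> \<in> dom j"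
proof (induction j)
  case (Suc j)
  interpret J: topological_vector_space K "iter_tvs K E j" by (rule E.iter_tvs)
  show ?case using Suc by (simp add: bracket_dom_def)
qed simp

text \<open>By the induction hypothesis all quotients at (0, 0, t) with t nonzero vanish, and the
  value at t = 0 is their limit.\<close>

lemma der_zero:
  "\<lbrakk>\<zero>\<^bsub>E\<^esub> \<in> U; f \<zero>\<^bsub>E\<^esub> = \<zero>\<^bsub>F\<^esub>; differentiable_below j\<rbrakk> \<Longrightarrow> der j \<zero>\<^bsub>iter_tvs K E j\<^esub> = \<zero>\<^bsub>F\<^esub>"
proof (induction j)
  case (Suc j)
  interpret J: topological_vector_space K "iter_tvs K E j" by (rule E.iter_tvs)
  let ?J = "iter_tvs K E j"
  have dj: "iter_differentiable K E U F f j" and IH: "der j \<zero>\<^bsub>?J\<^esub> = \<zero>\<^bsub>F\<^esub>" using Suc by auto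
  have "(der (Suc j) \<circ> node) (\<zero>\<^bsub>?J\<^esub>, \<zero>\<^bsub>?J\<^esub>, \<zero>\<^bsub>K\<^esub>) = (\<lambda>_. \<zero>\<^bsub>F\<^esub>) (\<zero>\<^bsub>?J\<^esub>, \<zero>\<^bsub>?J\<^esub>, \<zero>\<^bsub>K\<^esub>)"
  proof (rule bracket_zero_limit[OF E.iter_tvs openin_iter_dom[OF E.tvs open_U] F.Hausdorff
        is_bracket_mapD(1)[OF iter_differentiableD[OF dj]]])
    show "(\<zero>\<^bsub>?J\<^esub>, \<zero>\<^bsub>?J\<^esub>, \<zero>\<^bsub>K\<^esub>) \<in> bracket_dom K ?J (dom j)"
      using zero_in_dom[OF Suc.prems(1)] by (simp add: bracket_dom_def)
    fix t assume t: "t \<noteq> \<zero>\<^bsub>K\<^esub>" "(\<zero>\<^bsub>?J\<^esub>, \<zero>\<^bsub>?J\<^esub>, t) \<in> bracket_dom K ?J (dom j)"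
    then have "t \<in> carrier K" by (simp add: bracket_dom_def)
    then show "(der (Suc j) \<circ> node) (\<zero>\<^bsub>?J\<^esub>, \<zero>\<^bsub>?J\<^esub>, t) = \<zero>\<^bsub>F\<^esub>"
      using der_Suc[OF dj t(2,1)] t(1) IH E.inv_carrier[of t]
      by (simp add: a_minus_def F.M.r_neg del: iter_map.simps)
  qed (simp add: F.topspace_topol)
  then show ?case by simp
qed simp

text \<open>
  The key to continuity in the box topology: \<open>R\<close> is prescribed, and only \<open>V\<close> depends on the map.
\<close>

lemma der_uniformly_small:
  assumes U0: "\<zero>\<^bsub>E\<^esub> \<in> U" and f0: "f \<zero>\<^bsub>E\<^esub> = \<zero>\<^bsub>F\<^esub>" and dj: "differentiable_below j"
    and W: "openin (topol F) W" "\<zero>\<^bsub>F\<^esub> \<in> W"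
  obtains V where "openin (topol E) V" "\<zero>\<^bsub>E\<^esub> \<in> V"
    "\<And>T. \<lbrakk>T \<in> carrier (iter_tvs K E j); pred_dtree (\<lambda>x. x \<in> V) (\<lambda>t. absv K t \<le> R) T\<rbrakk> \<Longrightarrow>
       T \<in> dom j \<and> der j T \<in> W"
proof -
  \<comment> \<open>Leaves room for the factor \<open>b\<close> with |b| <= 1 in the scaling
    law.\<close>
  obtain W' where W': "openin (topol F) W'" "\<zero>\<^bsub>F\<^esub> \<in> W'"
    "\<And>b x. \<lbrakk>b \<in> carrier K; absv K b \<le> 1; x \<in> W'\<rbrakk> \<Longrightarrow> b \<odot>\<^bsub>F\<^esub> x \<in> W"
    using F.bounded_smult_nbhd[OF W, of 1] by blast
  have D: "openin (topol (iter_tvs K E j)) (dom j)" by (rule openin_iter_dom[OF E.tvs open_U])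
  have top: "topspace (subtopology (topol (iter_tvs K E j)) (dom j)) = dom j"
    using openin_subset[OF D] by auto
  from openin_continuous_map_preimage[OF der_continuous[OF dj, unfolded C0_on_def] W'(1)]
  have "openin (topol (iter_tvs K E j)) {T \<in> dom j. der j T \<in> W'}"
    unfolding top using D openin_trans_full by blast
  moreover have "\<zero>\<^bsub>iter_tvs K E j\<^esub> \<in> {T \<in> dom j. der j T \<in> W'}"
    using zero_in_dom[OF U0] der_zero[OF U0 f0 dj] W'(2) by simp
  ultimately obtain V0 e where V0: "openin (topol E) V0" "\<zero>\<^bsub>E\<^esub> \<in> V0" "0 < e"
    "\<And>T. \<lbrakk>T \<in> carrier (iter_tvs K E j); pred_dtree (\<lambda>x. x \<in> V0) (\<lambda>t. absv K t < e) T\<rbrakk> \<Longrightarrow>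
       T \<in> dom j \<and> der j T \<in> W'"
    using E.tree_box_nbhd_zero[of j "{T \<in> dom j. der j T \<in> W'}"] by blast
  \<comment> \<open>The scaling bound wants a nonnegative radius. The scalar \<open>a\<close> is
    then taken with |a| > R'/e, so that scalars up to \<open>R\<close> are scaled below
    \<open>e\<close>, and with |a| > 1, as the scaling law requires.\<close>
  define R' where "R' = max R 0"
  obtain a where a: "a \<in> carrier K" "a \<noteq> \<zero>\<^bsub>K\<^esub>" "max 1 (R' / e) < absv K a"
    using E.large_scalar by blast
  have a1: "1 \<le> absv K a" "0 < absv K a" and ae: "R' / absv K a < e"
    using a(3) V0(3) by (auto simp: field_simps)
  obtain b where b: "b \<in> carrier K" "absv K b \<le> 1"
    "\<And>T. T \<in> dom j \<Longrightarrow> der j T = b \<odot>\<^bsub>F\<^esub> der j (tree_scale K E j a T)"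
    using der_tree_scale[OF dj a(1) a1(1)] by blast
  \<comment> \<open>The price of scaling: the vectors grow with powers of \<open>a\<close>, so
    \<open>V\<close> must be small enough to be carried into \<open>V0\<close>.\<close>
  obtain V where V: "openin (topol E) V" "\<zero>\<^bsub>E\<^esub> \<in> V"
    "\<And>T. \<lbrakk>T \<in> carrier (iter_tvs K E j); pred_dtree (\<lambda>x. x \<in> V) (\<lambda>_. True) T\<rbrakk> \<Longrightarrow>
       pred_dtree (\<lambda>x. x \<in> V0) (\<lambda>_. True) (tree_scale K E j a T)"
    using E.tree_scale_leaves[OF a(1,2) V0(1,2), of j] by blast
  show thesis
  proof (rule that[OF V(1,2)])
    fix T assume T: "T \<in> carrier (iter_tvs K E j)" "pred_dtree (\<lambda>x. x \<in> V) (\<lambda>t. absv K t \<le> R) T"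
    have 1: "pred_dtree (\<lambda>x. x \<in> V) (\<lambda>_. True) T" by (rule pred_dtree_mono[OF T(2)]) auto
    have 2: "pred_dtree (\<lambda>_. True) (\<lambda>t. absv K t \<le> R') T"
      by (rule pred_dtree_mono[OF T(2)]) (auto simp: R'_def)
    have 3: "pred_dtree (\<lambda>_. True) (\<lambda>t. absv K t < e) (tree_scale K E j a T)"
      by (rule pred_dtree_mono[OF E.tree_scale_absv[OF a(1) a1(1) _ T(1) 2]]) (use ae in \<open>auto simp: R'_def\<close>)
    have S: "tree_scale K E j a T \<in> carrier (iter_tvs K E j)"
      by (rule tvs_hom_closed[OF E.tvs_hom_tree_scale[OF a(1,2)] T(1)])
    from V0(4)[OF S pred_dtree_conj[OF V(3)[OF T(1) 1] 3]]
    show "T \<in> dom j \<and> der j T \<in> W"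
      using E.tree_scale_in_iter_dom[OF a(1,2) T(1)] b W'(3) by auto
  qed
qed

text \<open>Zero vectors lie in every neighbourhood \<open>V\<close> of 0, so with a radius
  \<open>R\<close> bounding the scalars of \<open>T\<close> the smallness estimate puts the value
  into every neighbourhood of 0; the target being Hausdorff, the value is 0.\<close>

lemma der_zero_leaves:
  assumes U0: "\<zero>\<^bsub>E\<^esub> \<in> U" and f0: "f \<zero>\<^bsub>E\<^esub> = \<zero>\<^bsub>F\<^esub>" and dj: "differentiable_below j"
    and T: "T \<in> carrier (iter_tvs K E j)" "pred_dtree (\<lambda>x. x = \<zero>\<^bsub>E\<^esub>) (\<lambda>_. True) T"
  shows "T \<in> dom j" "der j T = \<zero>\<^bsub>F\<^esub>"
proof -
  obtain R where R: "pred_dtree (\<lambda>_. True) (\<lambda>t. absv K t \<le> R) T"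
    using pred_dtree_absv_bound by blast
  note p = pred_dtree_conj[OF T(2) R]
  have *: "T \<in> dom j \<and> der j T \<in> W" if W: "openin (topol F) W" "\<zero>\<^bsub>F\<^esub> \<in> W" for W
  proof -
    obtain V where V: "openin (topol E) V" "\<zero>\<^bsub>E\<^esub> \<in> V"
      "\<And>T. \<lbrakk>T \<in> carrier (iter_tvs K E j); pred_dtree (\<lambda>x. x \<in> V) (\<lambda>t. absv K t \<le> R) T\<rbrakk> \<Longrightarrow>
         T \<in> dom j \<and> der j T \<in> W"
      by (rule der_uniformly_small[OF U0 f0 dj W, where R=R]) blast
    have "pred_dtree (\<lambda>x. x \<in> V) (\<lambda>t. absv K t \<le> R) T"
      by (rule pred_dtree_mono[OF p]) (auto simp: V(2))
    then show ?thesis using V(3) T(1) by blast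
  qed
  \<comment> \<open>Taking the whole space as target neighbourhood gives the membership
    alone.\<close>
  show dom: "T \<in> dom j"
    using *[OF openin_topspace] F.topspace_topol by simp
  show "der j T = \<zero>\<^bsub>F\<^esub>"
  proof (rule ccontr)
    assume "der j T \<noteq> \<zero>\<^bsub>F\<^esub>"
    moreover have "der j T \<in> topspace (topol F)" "\<zero>\<^bsub>F\<^esub> \<in> topspace (topol F)"
      using der_closed[OF dj dom] by (auto simp: F.topspace_topol)
    ultimately obtain A B where "openin (topol F) A" "openin (topol F) B" "der j T \<in> A" "\<zero>\<^bsub>F\<^esub> \<in> B" "disjnt A B"
      using F.Hausdorff[unfolded Hausdorff_space_def, rule_format, of "der j T" "\<zero>\<^bsub>F\<^esub>"] by auto
    then show False using *[of B] by (auto simp: disjnt_iff)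
  qed
qed

end

section \<open>Difference quotients of a direct sum\<close>

lemma pred_dtree_all:
  "pred_dtree (\<lambda>x. \<forall>i\<in>A. P i x) (\<lambda>_. True) T \<longleftrightarrow> (\<forall>i\<in>A. pred_dtree (P i) (\<lambda>_. True) T)"
  by (induction T) auto

lemma pred_dtree_Int:
  "\<lbrakk>pred_dtree P Q T; pred_dtree P' Q' T\<rbrakk> \<Longrightarrow> pred_dtree (\<lambda>x. P x \<and> P' x) (\<lambda>t. Q t \<and> Q' t) T"
  by (induction T) auto

lemma pred_dtree_tree_map:
  "pred_dtree P Q (tree_map g T) \<longleftrightarrow> pred_dtree (\<lambda>x. P (g x)) Q T"
  by (induction T) auto

lemma pred_dtree_carrier:
  "T \<in> carrier (iter_tvs K E j) \<Longrightarrow> pred_dtree (\<lambda>x. x \<in> carrier E) (\<lambda>t. t \<in> carrier K) T"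
  by (induction j arbitrary: T) auto

section \<open>Componentwise difference quotients on trees over the direct sum\<close>

locale dsum_of_maps = E: tvs_family K I E + F: tvs_family K I F
  for K :: "'k valued_ring" and I :: "'i set" and E :: "'i \<Rightarrow> ('k, 'a) tvs" and F :: "'i \<Rightarrow> ('k, 'b) tvs" +
  fixes U :: "'i \<Rightarrow> 'a set" and f :: "'i \<Rightarrow> 'a \<Rightarrow> 'b" and J :: "'i set"
  assumes map: "i \<in> I \<Longrightarrow> continuous_tvs_map K (E i) (F i) (U i) (f i)"
    and finite_J: "finite J"
    and zero: "\<lbrakk>i \<in> I; i \<notin> J\<rbrakk> \<Longrightarrow> \<zero>\<^bsub>E i\<^esub> \<in> U i \<and> f i \<zero>\<^bsub>E i\<^esub> = \<zero>\<^bsub>F i\<^esub>"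
begin

abbreviation "SE \<equiv> dsum_tvs I E"
abbreviation "SF \<equiv> dsum_tvs I F"
abbreviation "SU \<equiv> dsum_set I E U"
abbreviation "cmp i \<equiv> tree_map (\<lambda>x. x i)"

text \<open>The candidate for the difference quotient of depth j, made from the components alone and
  thus available before the direct sum is known to be differentiable.\<close>

definition dsum_der :: "nat \<Rightarrow> ('i \<Rightarrow> 'a, 'k) dtree \<Rightarrow> 'i \<Rightarrow> 'b" where
  "dsum_der j T = (\<lambda>i\<in>I. iter_map K (E i) (U i) (F i) (f i) j (cmp i T))"

lemma openin_U: "i \<in> I \<Longrightarrow> openin (topol (E i)) (U i)"
  using map by (simp add: continuous_tvs_map_def continuous_tvs_map_axioms_def)

lemma openin_SU: "openin (topol SE) SU"
  using E.openin_dsum_set openin_U by simp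

lemma tvs_hom_component: "i \<in> I \<Longrightarrow> tvs_hom K SE (E i) (\<lambda>x. x i)"
  by (rule tvs_homI[OF E.dsum_tvs_tvs E.tvs]) (simp_all add: E.continuous_map_component)

lemma tvs_hom_cmp: "i \<in> I \<Longrightarrow> tvs_hom K (iter_tvs K SE j) (iter_tvs K (E i) j) (cmp i)"
  by (rule tvs_hom_tree_map[OF E.dsum_tvs_tvs E.tvs tvs_hom_component])

text \<open>The projections \<open>cmp i\<close> are linear, so they commute with forming X + tY;
  both conditions of \<open>bracket_dom\<close> can be tested in each component, and the carrier
  takes care of finite supports.\<close>

lemma iter_dom_dsum:
  "iter_dom K SE SU j =
    {T \<in> carrier (iter_tvs K SE j). \<forall>i\<in>I. cmp i T \<in> iter_dom K (E i) (U i) j}"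
proof (induction j)
  case 0
  show ?case by (auto simp: dsum_set_iff image_iff)
next
  case (Suc j)
  let ?J = "iter_tvs K SE j"
  interpret S: topological_vector_space K SE by (rule E.dsum_tvs_tvs)
  interpret J: topological_vector_space K ?J by (rule S.iter_tvs)
  have A: "node z \<in> iter_dom K SE SU (Suc j) \<longleftrightarrow> (\<forall>i\<in>I. cmp i (node z) \<in> iter_dom K (E i) (U i) (Suc j))"
    if z: "z \<in> carrier (bracket_tvs K ?J)" for z
  proof -
    obtain X Y t where [simp]: "z = (X, Y, t)" by (cases z)
    have c: "X \<in> carrier ?J" "Y \<in> carrier ?J" "t \<in> carrier K" using z by auto
    have "bracket_lift (cmp i) z \<in> bracket_dom K (iter_tvs K (E i) j) (iter_dom K (E i) (U i) j) \<longleftrightarrow>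
        cmp i X \<in> iter_dom K (E i) (U i) j \<and> cmp i (X \<oplus>\<^bsub>?J\<^esub> t \<odot>\<^bsub>?J\<^esub> Y) \<in> iter_dom K (E i) (U i) j"
      if i: "i \<in> I" for i
      using c tvs_homD[OF tvs_hom_cmp[OF i, of j]] by (simp add: bracket_dom_def)
    moreover have "z \<in> bracket_dom K ?J (iter_dom K SE SU j) \<longleftrightarrow>
        (\<forall>i\<in>I. cmp i X \<in> iter_dom K (E i) (U i) j \<and> cmp i (X \<oplus>\<^bsub>?J\<^esub> t \<odot>\<^bsub>?J\<^esub> Y) \<in> iter_dom K (E i) (U i) j)"
      using c by (auto simp: bracket_dom_def Suc)
    ultimately show ?thesis
      by (simp only: iter_dom.simps tree_map_node node_in_image cong: ball_cong)
  qed
  have B: "iter_dom K SE SU (Suc j) \<subseteq> carrier (iter_tvs K SE (Suc j))"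
    by (rule iter_dom_subset[OF E.dsum_tvs_tvs openin_SU])
  have C: "\<exists>z\<in>carrier (bracket_tvs K ?J). T = node z" if "T \<in> carrier (iter_tvs K SE (Suc j))" for T
    using that by auto
  show ?case
  proof (intro equalityI subsetI CollectI conjI)
    fix T assume T: "T \<in> iter_dom K SE SU (Suc j)"
    then show "T \<in> carrier (iter_tvs K SE (Suc j))" by (rule subsetD[OF B])
    from C[OF this] obtain z where "z \<in> carrier (bracket_tvs K ?J)" "T = node z" by (elim bexE)
    then show "\<forall>i\<in>I. cmp i T \<in> iter_dom K (E i) (U i) (Suc j)" using A T by metis
  next
    fix T assume T: "T \<in> {T \<in> carrier (iter_tvs K SE (Suc j)). \<forall>i\<in>I. cmp i T \<in> iter_dom K (E i) (U i) (Suc j)}"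
    then obtain z where "z \<in> carrier (bracket_tvs K ?J)" "T = node z" using C[of T] by (elim CollectE conjE) metis
    then show "T \<in> iter_dom K SE SU (Suc j)" using A T by simp
  qed
qed

text \<open>A tree has finitely many leaves, each of finite support.\<close>

lemma finite_tree_support:
  "T \<in> carrier (iter_tvs K SE j) \<Longrightarrow> finite {i \<in> I. \<not> pred_dtree (\<lambda>x. x i = \<zero>\<^bsub>E i\<^esub>) (\<lambda>_. True) T}"
proof -
  assume "T \<in> carrier (iter_tvs K SE j)"
  then have "pred_dtree (\<lambda>x. x \<in> dsum_carrier I E) (\<lambda>t. t \<in> carrier K) T"
    using pred_dtree_carrier by fastforce
  then show ?thesis
  proof (induction T)
    case (Node X Y t)
    have "{i \<in> I. \<not> pred_dtree (\<lambda>x. x i = \<zero>\<^bsub>E i\<^esub>) (\<lambda>_. True) (Node X Y t)} =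
      {i \<in> I. \<not> pred_dtree (\<lambda>x. x i = \<zero>\<^bsub>E i\<^esub>) (\<lambda>_. True) X} \<union> {i \<in> I. \<not> pred_dtree (\<lambda>x. x i = \<zero>\<^bsub>E i\<^esub>) (\<lambda>_. True) Y}"
      by auto
    then show ?case using Node by simp
  qed (simp add: dsum_carrier_iff)
qed

text \<open>Ordinary continuity handles the finitely many indices in \<open>supp T\<close>, giving
  the sets \<open>N2 i\<close>. For every other index the component of \<open>T\<close> has zero
  vectors and value 0; \<open>der_uniformly_small\<close>, with one radius \<open>R\<close> for all
  of them, lets the single set \<open>N1\<close> handle these infinitely many indices.\<close>

lemma continuous_dsum_der:
  assumes diff: "\<And>i l. \<lbrakk>i \<in> I; l < j\<rbrakk> \<Longrightarrow> iter_differentiable K (E i) (U i) (F i) (f i) l"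
  shows "C0_on (iter_tvs K SE j) (iter_dom K SE SU j) SF (dsum_der j)"
proof -
  let ?X = "topol (iter_tvs K SE j)" and ?D = "iter_dom K SE SU j"
  interpret S: topological_vector_space K SE by (rule E.dsum_tvs_tvs)
  interpret SJ: topological_vector_space K "iter_tvs K SE j" by (rule S.iter_tvs)
  have D: "openin ?X ?D" by (rule openin_iter_dom[OF E.dsum_tvs_tvs openin_SU])
  have top: "topspace (subtopology ?X ?D) = ?D" using openin_subset[OF D] by auto
  \<comment> \<open>The indices to be treated individually: those where \<open>f i\<close> is not
    assumed to fix 0, and those where some vector of \<open>T\<close> is nonzero.\<close>
  define supp where "supp T = J \<union> {i \<in> I. \<not> pred_dtree (\<lambda>x. x i = \<zero>\<^bsub>E i\<^esub>) (\<lambda>_. True) T}" for T :: "('i \<Rightarrow> 'a, 'k) dtree"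
  have fin: "finite (supp T)" if "T \<in> ?D" for T
    using that finite_J finite_tree_support[of T j] by (auto simp: supp_def iter_dom_dsum)
  have cD: "cmp i T \<in> iter_dom K (E i) (U i) j" "T \<in> carrier (iter_tvs K SE j)" if "T \<in> ?D" "i \<in> I" for T i
    using that by (simp_all add: iter_dom_dsum)
  have off: "iter_map K (E i) (U i) (F i) (f i) j (cmp i T) = \<zero>\<^bsub>F i\<^esub>"
    if T: "T \<in> ?D" and i: "i \<in> I" "i \<notin> supp T" for T i
  proof -
    interpret M: continuous_tvs_map K "E i" "F i" "U i" "f i" by (rule map[OF i(1)])
    have "pred_dtree (\<lambda>x. x = \<zero>\<^bsub>E i\<^esub>) (\<lambda>_. True) (cmp i T)"
      using i by (simp add: supp_def pred_dtree_tree_map)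
    moreover have "cmp i T \<in> carrier (iter_tvs K (E i) j)"
      using cD(1)[OF T i(1)] M.dom_subset by blast
    ultimately show ?thesis using zero[of i] i diff by (intro M.der_zero_leaves) (auto simp: supp_def)
  qed
  have "continuous_map (subtopology ?X ?D) (box_topology I F) (dsum_der j)"
  proof (rule F.continuous_map_into_box, unfold top)
    fix T assume T: "T \<in> ?D"
    show "dsum_der j T \<in> dsum_carrier I F"
      unfolding dsum_der_def
    proof (rule dsum_carrier_restrict[OF _ fin[OF T]])
      fix i assume i: "i \<in> I"
      interpret M: continuous_tvs_map K "E i" "F i" "U i" "f i" by (rule map[OF i])
      show "iter_map K (E i) (U i) (F i) (f i) j (cmp i T) \<in> carrier (F i)"
        using diff i by (intro M.der_closed cD(1)[OF T i]) auto
    qed (rule off[OF T])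
    fix A assume A: "\<And>i. i \<in> I \<Longrightarrow> openin (topol (F i)) (A i) \<and> dsum_der j T i \<in> A i"
    obtain R0 where R0: "pred_dtree (\<lambda>_. True) (\<lambda>t. absv K t \<le> R0) T"
      using pred_dtree_absv_bound by blast
    \<comment> \<open>One more than the bound for \<open>T\<close> itself, so that the open ball of
      radius \<open>R\<close> contains all its scalars.\<close>
    define R where "R = R0 + 1"
    have "\<exists>V. openin (topol (E i)) V \<and> \<zero>\<^bsub>E i\<^esub> \<in> V \<and>
        (\<forall>S\<in>carrier (iter_tvs K (E i) j). pred_dtree (\<lambda>x. x \<in> V) (\<lambda>t. absv K t \<le> R) S \<longrightarrow>
           iter_map K (E i) (U i) (F i) (f i) j S \<in> A i)"
      if i: "i \<in> I - supp T" for i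
    proof -
      have iI: "i \<in> I" "i \<notin> supp T" "i \<notin> J" using i by (auto simp: supp_def)
      interpret M: continuous_tvs_map K "E i" "F i" "U i" "f i" by (rule map[OF iI(1)])
      have "\<zero>\<^bsub>F i\<^esub> \<in> A i" using A[OF iI(1)] off[OF T iI(1,2)] iI(1) by (simp add: dsum_der_def)
      then show ?thesis
        using M.der_uniformly_small[of j "A i" R] zero[OF iI(1,3)] diff iI(1) A[OF iI(1)] by metis
    qed
    then obtain V0 where V0: "\<And>i. i \<in> I - supp T \<Longrightarrow> openin (topol (E i)) (V0 i) \<and> \<zero>\<^bsub>E i\<^esub> \<in> V0 i \<and>
        (\<forall>S\<in>carrier (iter_tvs K (E i) j). pred_dtree (\<lambda>x. x \<in> V0 i) (\<lambda>t. absv K t \<le> R) S \<longrightarrow>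
           iter_map K (E i) (U i) (F i) (f i) j S \<in> A i)"
      by metis
    \<comment> \<open>On the support the box imposes nothing: \<open>T\<close> need not be near 0
      there, and the sets \<open>N2 i\<close> take over.\<close>
    define V where "V i = (if i \<in> supp T then topspace (topol (E i)) else V0 i)" for i
    define N1 where "N1 = {S \<in> carrier (iter_tvs K SE j).
      pred_dtree (\<lambda>x. x \<in> dsum_set I E V) (\<lambda>t. t \<in> {t \<in> carrier K. absv K t < R}) S}"
    define N2 where "N2 i = {S \<in> ?D. iter_map K (E i) (U i) (F i) (f i) j (cmp i S) \<in> A i}" for i
    have N1: "openin ?X N1"
      unfolding N1_def
    proof (rule S.openin_tree_box)
      show "openin (topol SE) (dsum_set I E V)"
        using V0 by (auto simp: V_def intro!: E.openin_dsum_set)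
    qed (rule S.openin_absv_less)
    have N2: "openin ?X (N2 i)" if i: "i \<in> I" for i
    proof -
      interpret M: continuous_tvs_map K "E i" "F i" "U i" "f i" by (rule map[OF i])
      have "continuous_map (subtopology ?X ?D) (subtopology (topol (iter_tvs K (E i) j)) (iter_dom K (E i) (U i) j)) (cmp i)"
        using continuous_map_from_subtopology[OF tvs_hom_continuous[OF tvs_hom_cmp[OF i]]] cD(1) i
        by (simp only: continuous_map_in_subtopology top image_subset_iff_funcset[symmetric] image_subset_iff) blast
      moreover have "C0_on (iter_tvs K (E i) j) (iter_dom K (E i) (U i) j) (F i) (iter_map K (E i) (U i) (F i) (f i) j)"
        using diff i by (intro M.der_continuous) auto
      ultimately have "continuous_map (subtopology ?X ?D) (topol (F i)) (\<lambda>S. iter_map K (E i) (U i) (F i) (f i) j (cmp i S))"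
        using continuous_map_compose by (fastforce simp: C0_on_def o_def)
      from openin_continuous_map_preimage[OF this, of "A i"] A[OF i]
      show ?thesis unfolding top N2_def using D openin_trans_full by blast
    qed
    define N where "N = (N1 \<inter> ?D) \<inter> \<Inter>(N2 ` (supp T \<inter> I))"
    have "openin ?X N"
    proof (cases "supp T \<inter> I = {}")
      case False
      then show ?thesis
        unfolding N_def using N1 N2 D fin[OF T] by (intro openin_Int openin_Inter) auto
    qed (auto simp: N_def N1 D)
    moreover have "T \<in> N"
    proof -
      have Tc: "T \<in> carrier (iter_tvs K SE j)" using T by (simp add: iter_dom_dsum)
      have p1: "pred_dtree (\<lambda>x. x \<in> dsum_carrier I E) (\<lambda>t. t \<in> carrier K) T"
        using pred_dtree_carrier[OF Tc] by simp
      \<comment> \<open>The support is described index by index, membership in a box leaf by leaf;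
        \<open>pred_dtree_all\<close> exchanges the two quantifiers.\<close>
      have p2: "pred_dtree (\<lambda>x. \<forall>i\<in>I - supp T. x i = \<zero>\<^bsub>E i\<^esub>) (\<lambda>_. True) T"
        unfolding pred_dtree_all by (auto simp: supp_def)
      have "pred_dtree (\<lambda>x. x \<in> dsum_carrier I E \<and> (\<forall>i\<in>I - supp T. x i = \<zero>\<^bsub>E i\<^esub>)) (\<lambda>t. t \<in> carrier K \<and> absv K t \<le> R0) T"
        by (rule pred_dtree_Int[OF p1 pred_dtree_conj[OF p2 R0]])
      then have "pred_dtree (\<lambda>x. x \<in> dsum_set I E V) (\<lambda>t. t \<in> {t \<in> carrier K. absv K t < R}) T"
      proof (rule pred_dtree_mono)
        fix x assume x: "x \<in> dsum_carrier I E \<and> (\<forall>i\<in>I - supp T. x i = \<zero>\<^bsub>E i\<^esub>)"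
        then have "x i \<in> V i" if "i \<in> I" for i
          using that V0[of i] by (cases "i \<in> supp T") (auto simp: V_def E.topspace_E dsum_carrier_iff)
        then show "x \<in> dsum_set I E V" using x by (simp add: dsum_set_iff)
      qed (simp add: R_def)
      moreover have "T \<in> N2 i" if "i \<in> I" for i
        using A[OF that] T that by (simp add: N2_def dsum_der_def)
      ultimately show ?thesis using T Tc by (auto simp: N_def N1_def)
    qed
    moreover have "dsum_der j S i \<in> A i" if S: "S \<in> N" and i: "i \<in> I" for S i
    proof (cases "i \<in> supp T")
      case True
      then show ?thesis using S i by (auto simp: N_def N2_def dsum_der_def)
    next
      case False
      have SD: "S \<in> ?D" and S1: "pred_dtree (\<lambda>x. x \<in> dsum_set I E V) (\<lambda>t. t \<in> {t \<in> carrier K. absv K t < R}) S"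
        using S by (auto simp: N_def N1_def)
      have "cmp i S \<in> carrier (iter_tvs K (E i) j)"
        using tvs_hom_closed[OF tvs_hom_cmp[OF i] cD(2)[OF SD i]] .
      moreover have "pred_dtree (\<lambda>x. x \<in> V0 i) (\<lambda>t. absv K t \<le> R) (cmp i S)"
        unfolding pred_dtree_tree_map
        by (rule pred_dtree_mono[OF S1]) (use False i in \<open>auto simp: dsum_set_iff V_def split: if_splits\<close>)
      ultimately show ?thesis using V0[of i] i False by (simp add: dsum_der_def)
    qed
    ultimately have "openin (subtopology ?X ?D) N \<and> T \<in> N \<and> (\<forall>S\<in>N. \<forall>i\<in>I. dsum_der j S i \<in> A i)"
      by (auto simp: N_def openin_subtopology_alt intro!: image_eqI[of _ _ N])
    then show "\<exists>N. openin (subtopology ?X ?D) N \<and> T \<in> N \<and> (\<forall>S\<in>N. \<forall>i\<in>I. dsum_der j S i \<in> A i)"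
      by blast
  qed
  then show ?thesis by (simp add: C0_on_def)
qed

lemma C0_on_dsum_map: "C0_on SE SU SF (dsum_map I f)"
proof -
  have "tvs_hom K SE (iter_tvs K SE 0) Leaf"
    unfolding iter_tvs.simps by (rule tvs_hom_enc[OF E.dsum_tvs_tvs]) simp
  from continuous_map_from_subtopology[OF tvs_hom_continuous[OF this]]
  have "continuous_map (subtopology (topol SE) SU) (subtopology (topol (iter_tvs K SE 0)) (iter_dom K SE SU 0)) Leaf"
    by (simp only: continuous_map_in_subtopology) auto
  from continuous_map_compose[OF this] continuous_dsum_der[of 0]
  have "continuous_map (subtopology (topol SE) SU) (topol SF) (dsum_der 0 \<circ> Leaf)"
    by (simp add: C0_on_def)
  moreover have "dsum_der 0 \<circ> Leaf = dsum_map I f"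
    by (auto simp: dsum_der_def dsum_map_def)
  ultimately show ?thesis by (simp add: C0_on_def)
qed

text \<open>Continuity is \<open>continuous_dsum_der\<close> one level up, so only t \<noteq> 0
  requires a computation, done in each component. The hypothesis \<open>eq\<close> will be the
  induction hypothesis of \<open>iter_map_dsum\<close>.\<close>

lemma dsum_der_is_bracket_map:
  assumes diff: "\<And>i l. \<lbrakk>i \<in> I; l < Suc j\<rbrakk> \<Longrightarrow> iter_differentiable K (E i) (U i) (F i) (f i) l"
    and eq: "\<And>T. T \<in> iter_dom K SE SU j \<Longrightarrow> iter_map K SE SU SF (dsum_map I f) j T = dsum_der j T"
  shows "is_bracket_map K (iter_tvs K SE j) (iter_dom K SE SU j) SF (iter_map K SE SU SF (dsum_map I f) j)
    (\<lambda>z. dsum_der (Suc j) (node z))"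
  unfolding is_bracket_map_def
proof (intro conjI)
  interpret S: topological_vector_space K SE by (rule E.dsum_tvs_tvs)
  interpret SJ: topological_vector_space K "iter_tvs K SE j" by (rule S.iter_tvs)
  interpret SF: topological_vector_space K SF by (rule F.dsum_tvs_tvs)
  let ?J = "iter_tvs K SE j" and ?D = "bracket_dom K (iter_tvs K SE j) (iter_dom K SE SU j)"
  have "tvs_hom K (bracket_tvs K ?J) (iter_tvs K SE (Suc j)) node"
    unfolding iter_tvs.simps by (rule tvs_hom_enc[OF bracket_tvs_tvs[OF S.iter_tvs]]) simp
  from continuous_map_from_subtopology[OF tvs_hom_continuous[OF this]]
  have "continuous_map (subtopology (topol (bracket_tvs K ?J)) ?D)
      (subtopology (topol (iter_tvs K SE (Suc j))) (iter_dom K SE SU (Suc j))) node"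
    by (simp only: continuous_map_in_subtopology) auto
  from continuous_map_compose[OF this] continuous_dsum_der[OF diff]
  show "continuous_map (subtopology (topol (bracket_tvs K ?J)) ?D) (topol SF) (\<lambda>z. dsum_der (Suc j) (node z))"
    unfolding C0_on_def o_def by blast
  have "dsum_der (Suc j) (node (X, Y, t)) = inv\<^bsub>K\<^esub> t \<odot>\<^bsub>SF\<^esub>
      (iter_map K SE SU SF (dsum_map I f) j (X \<oplus>\<^bsub>?J\<^esub> t \<odot>\<^bsub>?J\<^esub> Y) \<ominus>\<^bsub>SF\<^esub> iter_map K SE SU SF (dsum_map I f) j X)"
    if z: "(X, Y, t) \<in> ?D" and t: "t \<noteq> \<zero>\<^bsub>K\<^esub>" for X Y t
  proof -
    let ?Z = "X \<oplus>\<^bsub>?J\<^esub> t \<odot>\<^bsub>?J\<^esub> Y"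
    have m: "X \<in> iter_dom K SE SU j" "?Z \<in> iter_dom K SE SU j" "Y \<in> carrier ?J" "t \<in> carrier K"
      using z by (auto simp: bracket_dom_def)
    have X: "X \<in> carrier ?J" using m(1) by (simp add: iter_dom_dsum)
    \<comment> \<open>Subtraction in the direct sum is componentwise only for elements of its
      carrier; finite support is read off from the continuity statement.\<close>
    have dc: "dsum_der j T \<in> dsum_carrier I F" if "T \<in> iter_dom K SE SU j" for T
    proof -
      have "continuous_map (subtopology (topol ?J) (iter_dom K SE SU j)) (topol SF) (dsum_der j)"
        using continuous_dsum_der[of j] diff by (simp add: C0_on_def)
      from continuous_map_funspace[OF this] that show ?thesis
        by (auto simp: SJ.topspace_topol F.topspace_box iter_dom_dsum)
    qed
    have "dsum_der (Suc j) (node (X, Y, t)) i =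
        inv\<^bsub>K\<^esub> t \<odot>\<^bsub>F i\<^esub> (dsum_der j ?Z i \<ominus>\<^bsub>F i\<^esub> dsum_der j X i)" if i: "i \<in> I" for i
    proof -
      interpret M: continuous_tvs_map K "E i" "F i" "U i" "f i" by (rule map[OF i])
      let ?Ji = "iter_tvs K (E i) j"
      note h = tvs_homD[OF tvs_hom_cmp[OF i, of j]]
      have Z: "cmp i ?Z = cmp i X \<oplus>\<^bsub>?Ji\<^esub> t \<odot>\<^bsub>?Ji\<^esub> cmp i Y"
        using m X by (simp add: h)
      have "(cmp i X, cmp i Y, t) \<in> bracket_dom K ?Ji (iter_dom K (E i) (U i) j)"
        using m i h(2)[OF m(3)] by (auto simp: bracket_dom_def iter_dom_dsum Z[symmetric])
      from M.der_Suc[OF diff[OF i lessI] this t] show ?thesis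
        using i by (simp only: dsum_der_def restrict_apply if_True tree_map_node bracket_lift_simp Z)
    qed
    then have "dsum_der (Suc j) (node (X, Y, t)) =
        (\<lambda>i\<in>I. inv\<^bsub>K\<^esub> t \<odot>\<^bsub>F i\<^esub> (dsum_der j ?Z i \<ominus>\<^bsub>F i\<^esub> dsum_der j X i))"
      by (intro ext) (simp add: dsum_der_def)
    then show ?thesis
      using m dc by (simp add: eq F.dsum_minus cong: restrict_cong)
  qed
  then show "\<forall>(X, Y, t)\<in>?D. t \<noteq> \<zero>\<^bsub>K\<^esub> \<longrightarrow> dsum_der (Suc j) (node (X, Y, t)) = inv\<^bsub>K\<^esub> t \<odot>\<^bsub>SF\<^esub>
      (iter_map K SE SU SF (dsum_map I f) j (X \<oplus>\<^bsub>?J\<^esub> t \<odot>\<^bsub>?J\<^esub> Y) \<ominus>\<^bsub>SF\<^esub> iter_map K SE SU SF (dsum_map I f) j X)"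
    by blast
qed

lemma iter_map_dsum:
  "\<lbrakk>\<And>i l. \<lbrakk>i \<in> I; l < j\<rbrakk> \<Longrightarrow> iter_differentiable K (E i) (U i) (F i) (f i) l; T \<in> iter_dom K SE SU j\<rbrakk> \<Longrightarrow>
    iter_map K SE SU SF (dsum_map I f) j T = dsum_der j T"
proof (induction j arbitrary: T)
  case 0
  then show ?case by (auto simp: dsum_der_def dsum_map_def)
next
  case (Suc j)
  then have "is_bracket_map K (iter_tvs K SE j) (iter_dom K SE SU j) SF (iter_map K SE SU SF (dsum_map I f) j)
      (\<lambda>z. dsum_der (Suc j) (node z))"
    by (intro dsum_der_is_bracket_map) auto
  from iter_map_eq[OF E.dsum_tvs_tvs openin_SU F.dsum_tvs_tvs this] Suc.prems(2)
  show ?case by (auto simp only: iter_dom.simps)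
qed

lemma iter_differentiable_dsum:
  assumes "\<And>i l. \<lbrakk>i \<in> I; l < Suc j\<rbrakk> \<Longrightarrow> iter_differentiable K (E i) (U i) (F i) (f i) l"
  shows "iter_differentiable K SE SU SF (dsum_map I f) j"
  unfolding iter_differentiable_def
  by (rule exI, rule dsum_der_is_bracket_map[OF assms iter_map_dsum]) (use assms in auto)

end

section \<open>Reordered difference quotients\<close>

text \<open>The linear reordering under which \<open>f^{j}\<close> becomes \<open>f^[j]\<close>; it
  reduces the assertions about reordered quotients to those about trees.\<close>

primrec brace_tree :: "nat \<Rightarrow> (nat \<Rightarrow> 'a) \<times> (nat \<Rightarrow> 'k) \<Rightarrow> ('a, 'k) dtree" where
  "brace_tree 0 = (\<lambda>z. Leaf (fst z 0))"
| "brace_tree (Suc j) = node \<circ> (bracket_lift (brace_tree j) \<circ> regroup j)"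

lemma brace_tvs_simps [simp]:
  "carrier (brace_tvs K E j) = (\<Pi>\<^sub>E m\<in>{..<2 ^ j}. carrier E) \<times> (\<Pi>\<^sub>E m\<in>{..<2 ^ j - 1}. carrier K)"
  "z \<oplus>\<^bsub>brace_tvs K E j\<^esub> w =
    (\<lambda>m\<in>{..<2 ^ j}. fst z m \<oplus>\<^bsub>E\<^esub> fst w m, \<lambda>m\<in>{..<2 ^ j - 1}. snd z m \<oplus>\<^bsub>K\<^esub> snd w m)"
  "t \<odot>\<^bsub>brace_tvs K E j\<^esub> z =
    (\<lambda>m\<in>{..<2 ^ j}. t \<odot>\<^bsub>E\<^esub> fst z m, \<lambda>m\<in>{..<2 ^ j - 1}. t \<otimes>\<^bsub>K\<^esub> snd z m)"
  "topol (brace_tvs K E j) =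
    prod_topology (product_topology (\<lambda>m. topol E) {..<2 ^ j}) (product_topology (\<lambda>m. val_topology K) {..<2 ^ j - 1})"
  by (simp_all add: brace_tvs_def)

lemma regroup_index:
  "m < 2 ^ j \<Longrightarrow> m < 2 ^ Suc j" "m < 2 ^ j \<Longrightarrow> 2 ^ j + m < 2 ^ Suc j"
  "m < 2 ^ j - 1 \<Longrightarrow> m < 2 ^ Suc j - 1" "m < 2 ^ j - 1 \<Longrightarrow> 2 ^ j - 1 + m < 2 ^ Suc j - 1"
  "2 * (2 ^ j - 1) < 2 ^ Suc j - (1::nat)"
  for m :: nat
proof -
  \<comment> \<open>Makes the truncated subtractions exact: blocks of lengths 2^j - 1, 2^j - 1 and 1
    fill exactly 2^(j+1) - 1 positions.\<close>
  have "1 \<le> (2::nat) ^ j" by simp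
  then show "m < 2 ^ j \<Longrightarrow> m < 2 ^ Suc j" "m < 2 ^ j \<Longrightarrow> 2 ^ j + m < 2 ^ Suc j"
    "m < 2 ^ j - 1 \<Longrightarrow> m < 2 ^ Suc j - 1" "m < 2 ^ j - 1 \<Longrightarrow> 2 ^ j - 1 + m < 2 ^ Suc j - 1"
    "2 * (2 ^ j - 1) < 2 ^ Suc j - (1::nat)"
    unfolding power_Suc by linarith+
qed

lemma tvs_hom_regroup:
  assumes E: "topological_vector_space K E"
  shows "tvs_hom K (brace_tvs K E (Suc j)) (bracket_tvs K (brace_tvs K E j)) (regroup j)"
proof (rule tvs_homI[OF brace_tvs_tvs[OF E] bracket_tvs_tvs[OF brace_tvs_tvs[OF E]]])
  let ?X = "topol (brace_tvs K E (Suc j))"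
  have f: "continuous_map ?X (topol E) (\<lambda>z. fst z m)" if "m < 2 ^ Suc j" for m
    using continuous_map_compose[OF continuous_map_fst continuous_map_product_projection[of m "{..<2 ^ Suc j}"]] that
    by (simp add: o_def)
  have s: "continuous_map ?X (val_topology K) (\<lambda>z. snd z m)" if "m < 2 ^ Suc j - 1" for m
    using continuous_map_compose[OF continuous_map_snd continuous_map_product_projection[of m "{..<2 ^ Suc j - 1}"]] that
    by (simp add: o_def)
  have "continuous_map ?X (product_topology (\<lambda>m. topol E) {..<2 ^ j}) (\<lambda>z. \<lambda>m\<in>{..<2 ^ j}. fst z m)"
    "continuous_map ?X (product_topology (\<lambda>m. topol E) {..<2 ^ j}) (\<lambda>z. \<lambda>m\<in>{..<2 ^ j}. fst z (2 ^ j + m))"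
    "continuous_map ?X (product_topology (\<lambda>m. val_topology K) {..<2 ^ j - 1}) (\<lambda>z. \<lambda>m\<in>{..<2 ^ j - 1}. snd z m)"
    "continuous_map ?X (product_topology (\<lambda>m. val_topology K) {..<2 ^ j - 1})
      (\<lambda>z. \<lambda>m\<in>{..<2 ^ j - 1}. snd z (2 ^ j - 1 + m))"
    using f[OF regroup_index(1)] f[OF regroup_index(2)] s[OF regroup_index(3)] s[OF regroup_index(4)]
    by (simp_all add: continuous_map_componentwise image_subset_iff del: brace_tvs_simps power_Suc)
  moreover have "continuous_map ?X (val_topology K) (\<lambda>z. snd z (2 * (2 ^ j - 1)))"
    by (rule s[OF regroup_index(5)])
  ultimately show "continuous_map ?X (topol (bracket_tvs K (brace_tvs K E j))) (regroup j)"
    unfolding regroup_def case_prod_unfold bracket_tvs_simps brace_tvs_simps(4)[of K E j]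
    by (intro continuous_map_pairedI)
qed (use regroup_index[where j = j] in
    \<open>auto simp: regroup_def case_prod_unfold intro!: restrict_ext simp del: power_Suc\<close>)

lemma tvs_hom_brace_tree:
  assumes E: "topological_vector_space K E"
  shows "tvs_hom K (brace_tvs K E j) (iter_tvs K E j) (brace_tree j)"
proof (induction j)
  case 0
  have "tvs_hom K (brace_tvs K E 0) E (\<lambda>z. fst z 0)"
  proof (rule tvs_homI[OF brace_tvs_tvs[OF E] E])
    show "continuous_map (topol (brace_tvs K E 0)) (topol E) (\<lambda>z. fst z 0)"
      using continuous_map_compose[OF continuous_map_fst continuous_map_product_projection[of 0 "{..<Suc 0}" "\<lambda>m. topol E"]]
      by (simp add: o_def)
  qed auto
  moreover have "tvs_hom K E (iter_tvs K E 0) Leaf"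
    unfolding iter_tvs.simps by (rule tvs_hom_enc[OF E]) simp
  ultimately have "tvs_hom K (brace_tvs K E 0) (iter_tvs K E 0) (Leaf \<circ> (\<lambda>z. fst z 0))"
    by (rule tvs_hom_compose)
  then show ?case by (simp only: brace_tree.simps o_def)
next
  case (Suc j)
  have "tvs_hom K (bracket_tvs K (iter_tvs K E j)) (iter_tvs K E (Suc j)) node"
    unfolding iter_tvs.simps by (rule tvs_hom_enc[OF bracket_tvs_tvs[OF iter_tvs_tvs[OF E]]]) simp
  from tvs_hom_compose[OF tvs_hom_compose[OF tvs_hom_regroup[OF E]
      tvs_hom_bracket_lift[OF brace_tvs_tvs[OF E] iter_tvs_tvs[OF E] Suc]] this]
  show ?case by (simp only: brace_tree.simps)
qed

lemma brace_dom_eq: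
  assumes E: "topological_vector_space K E" and U: "U \<subseteq> carrier E"
  shows "brace_dom K E U j = {z \<in> carrier (brace_tvs K E j). brace_tree j z \<in> iter_dom K E U j}"
proof (induction j)
  case (Suc j)
  have "regroup j z \<in> carrier (bracket_tvs K (brace_tvs K E j))" if "z \<in> carrier (brace_tvs K E (Suc j))" for z
    by (rule tvs_hom_closed[OF tvs_hom_regroup[OF E] that])
  then have "regroup j z \<in> bracket_dom K (brace_tvs K E j) (brace_dom K E U j) \<longleftrightarrow>
      bracket_lift (brace_tree j) (regroup j z) \<in> bracket_dom K (iter_tvs K E j) (iter_dom K E U j)"
    if "z \<in> carrier (brace_tvs K E (Suc j))" for z
    using bracket_lift_in_bracket_dom[OF brace_tvs_tvs[OF E] tvs_hom_brace_tree[OF E] Suc] that by blast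
  then show ?case
    by (simp only: brace_dom.simps brace_tree.simps iter_dom.simps o_apply node_in_image cong: conj_cong)
qed auto

lemma openin_brace_dom:
  assumes E: "topological_vector_space K E" and U: "openin (topol E) U"
  shows "openin (topol (brace_tvs K E j)) (brace_dom K E U j)"
proof -
  interpret topological_vector_space K E by (rule E)
  have top: "topspace (topol (brace_tvs K E j)) = carrier (brace_tvs K E j)"
    by (rule topological_vector_space.topspace_topol[OF brace_tvs_tvs[OF E]])
  have "U \<subseteq> carrier E" using openin_subset[OF U] topspace_topol by simp
  from openin_continuous_map_preimage[OF tvs_hom_continuous[OF tvs_hom_brace_tree[OF E]] openin_iter_dom[OF E U]]
  show ?thesis unfolding brace_dom_eq[OF E \<open>U \<subseteq> carrier E\<close>] top[symmetric] .
qed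

text \<open>By induction the reordered quotient of depth j is \<open>f^[j]\<close> after a linear
  map, so the chain rule provides a candidate for the next quotient. Uniqueness identifies it with
  the chosen one, and composing with \<open>regroup j\<close> gives depth j + 1.\<close>

lemma (in continuous_tvs_map) brace_map_eq:
  "\<lbrakk>differentiable_below j; z \<in> brace_dom K E U j\<rbrakk> \<Longrightarrow> brace_map K E U F f j z = der j (brace_tree j z)"
proof (induction j arbitrary: z)
  case (Suc j)
  have dj: "differentiable_below j" "iter_differentiable K E U F f j" using Suc.prems(1) by auto
  note D = brace_dom_eq[OF E.tvs U_subset]
  have "is_bracket_map K (brace_tvs K E j) (brace_dom K E U j) F (brace_map K E U F f j)
      ((der (Suc j) \<circ> node) \<circ> bracket_lift (brace_tree j))"
    by (rule is_bracket_map_comp[OF brace_tvs_tvs[OF E.tvs] E.iter_tvs tvs_hom_brace_tree[OF E.tvs] _ _ _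
          iter_differentiableD[OF dj(2)]])
      (use Suc.IH[OF dj(1)] in \<open>auto simp only: D\<close>)
  moreover have "regroup j z \<in> bracket_dom K (brace_tvs K E j) (brace_dom K E U j)"
    using Suc.prems(2) by (simp only: brace_dom.simps mem_Collect_eq)
  ultimately have "bracket_map K (brace_tvs K E j) (brace_dom K E U j) F (brace_map K E U F f j) (regroup j z) =
      ((der (Suc j) \<circ> node) \<circ> bracket_lift (brace_tree j)) (regroup j z)"
    by (rule bracket_map_eq[OF brace_tvs_tvs[OF E.tvs] openin_brace_dom[OF E.tvs open_U] F.tvs])
  then show ?case by (simp only: brace_map.simps brace_tree.simps o_apply)
qed simp

lemma regroup_component:
  "regroup j (component (2 ^ Suc j) i X, p) = bracket_lift (\<lambda>(X, p). (component (2 ^ j) i X, p)) (regroup j (X, p))"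
  using regroup_index[where j = j]
  by (auto simp: regroup_def component_def fun_eq_iff simp del: power_Suc)

text \<open>Reordering moves positions, while taking a component acts on the vector at each
  position; the two commute.\<close>

lemma brace_tree_component:
  "brace_tree j (component (2 ^ j) i X, p) = tree_map (\<lambda>x. x i) (brace_tree j (X, p))"
proof (induction j arbitrary: X p)
  case 0
  show ?case by (simp add: component_def)
next
  case (Suc j)
  obtain X1 p1 X2 p2 t where r: "regroup j (X, p) = ((X1, p1), (X2, p2), t)"
    by (metis prod.collapse)
  show ?case
    by (simp only: brace_tree.simps o_apply regroup_component r bracket_lift_simp case_prod_conv Suc tree_map_node)
qed

lemma component_closed:
  assumes "(X, p) \<in> carrier (brace_tvs K (dsum_tvs I E) j)" "i \<in> I"
  shows "(component (2 ^ j) i X, p) \<in> carrier (brace_tvs K (E i) j)"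
  using assms by (auto simp: component_def dsum_carrier_iff PiE_iff)

section \<open>Back from trees to the reordered domains and quotients\<close>

context dsum_of_maps
begin

lemma U_subset: "i \<in> I \<Longrightarrow> U i \<subseteq> carrier (E i)"
  using openin_subset[OF openin_U] E.topspace_E by simp

lemma SU_subset: "SU \<subseteq> carrier SE"
  by (auto simp: dsum_set_iff)

text \<open>Both sides are preimages of tree domains under \<open>brace_tree\<close>, which commutes
  with components; the claim is thus \<open>iter_dom_dsum\<close> in other coordinates.\<close>

lemma brace_dom_dsum:
  "brace_dom K SE SU j =
    {(X, p) \<in> carrier (brace_tvs K SE j). \<forall>i\<in>I. (component (2 ^ j) i X, p) \<in> brace_dom K (E i) (U i) j}"
proof -
  have "(X, p) \<in> brace_dom K SE SU j \<longleftrightarrow>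
      (X, p) \<in> carrier (brace_tvs K SE j) \<and> (\<forall>i\<in>I. (component (2 ^ j) i X, p) \<in> brace_dom K (E i) (U i) j)" for X p
  proof (cases "(X, p) \<in> carrier (brace_tvs K SE j)")
    case True
    have "brace_tree j (X, p) \<in> carrier (iter_tvs K SE j)"
      by (rule tvs_hom_closed[OF tvs_hom_brace_tree[OF E.dsum_tvs_tvs] True])
    moreover have "(component (2 ^ j) i X, p) \<in> brace_dom K (E i) (U i) j \<longleftrightarrow>
        cmp i (brace_tree j (X, p)) \<in> iter_dom K (E i) (U i) j" if i: "i \<in> I" for i
      unfolding brace_dom_eq[OF E.tvs[OF i] U_subset[OF i]] mem_Collect_eq brace_tree_component
      using component_closed[OF True i] by blast
    ultimately show ?thesis
      using True unfolding brace_dom_eq[OF E.dsum_tvs_tvs SU_subset] iter_dom_dsum mem_Collect_eq by blast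
  qed (simp only: brace_dom_eq[OF E.dsum_tvs_tvs SU_subset] mem_Collect_eq simp_thms)
  then show ?thesis by (auto simp only: split_paired_all)
qed

text \<open>Translation to trees by \<open>brace_map_eq\<close> for the direct sum, the
  componentwise formula there, and translation back by \<open>brace_map_eq\<close> in each
  component.\<close>

lemma brace_map_dsum:
  assumes diff: "\<And>i l. \<lbrakk>i \<in> I; l < j\<rbrakk> \<Longrightarrow> iter_differentiable K (E i) (U i) (F i) (f i) l"
    and z: "(X, p) \<in> brace_dom K SE SU j"
  shows "brace_map K SE SU SF (dsum_map I f) j (X, p) =
    (\<lambda>i\<in>I. brace_map K (E i) (U i) (F i) (f i) j (component (2 ^ j) i X, p))"
proof -
  interpret S: continuous_tvs_map K SE SF SU "dsum_map I f"
    by (intro continuous_tvs_map.intro continuous_tvs_map_axioms.intro E.dsum_tvs_tvs F.dsum_tvs_tvs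
        openin_SU C0_on_dsum_map)
  have "S.differentiable_below j"
    using diff by (auto intro!: iter_differentiable_dsum)
  then have "brace_map K SE SU SF (dsum_map I f) j (X, p) = S.der j (brace_tree j (X, p))"
    using z by (rule S.brace_map_eq)
  also have "\<dots> = dsum_der j (brace_tree j (X, p))"
    using z unfolding brace_dom_eq[OF E.dsum_tvs_tvs SU_subset] by (intro iter_map_dsum diff) auto
  also have "\<dots> = (\<lambda>i\<in>I. brace_map K (E i) (U i) (F i) (f i) j (component (2 ^ j) i X, p))"
    unfolding dsum_der_def
  proof (rule restrict_ext)
    fix i assume i: "i \<in> I"
    interpret M: continuous_tvs_map K "E i" "F i" "U i" "f i" by (rule map[OF i])
    have c: "(component (2 ^ j) i X, p) \<in> brace_dom K (E i) (U i) j"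
      using z i unfolding brace_dom_dsum by blast
    have "M.differentiable_below j" using diff i by blast
    from M.brace_map_eq[OF this c]
    show "M.der j (cmp i (brace_tree j (X, p))) =
        brace_map K (E i) (U i) (F i) (f i) j (component (2 ^ j) i X, p)"
      by (simp only: brace_tree_component)
  qed
  finally show ?thesis .
qed

end

theorem proposition6p9:
  fixes K :: "'k valued_ring"
    and I J :: "'i set"
    and E :: "'i \<Rightarrow> ('k, 'a) tvs"
    and F :: "'i \<Rightarrow> ('k, 'b) tvs"
    and U :: "'i \<Rightarrow> 'a set"
    and f :: "'i \<Rightarrow> 'a \<Rightarrow> 'b"
    and k :: enat
  assumes "valued_field K"
    and "\<And>i. i \<in> I \<Longrightarrow> topological_vector_space K (E i)"
    and "\<And>i. i \<in> I \<Longrightarrow> topological_vector_space K (F i)"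
    and "\<And>i. i \<in> I \<Longrightarrow> openin (topol (E i)) (U i)"
    and "\<And>i. i \<in> I \<Longrightarrow> U i \<noteq> {}"
    and "\<And>i. i \<in> I \<Longrightarrow> Ck_on K (E i) (U i) (F i) k (f i)"
    and "finite J" and "J \<subseteq> I"
    and "\<And>i. i \<in> I - J \<Longrightarrow> \<zero>\<^bsub>E i\<^esub> \<in> U i \<and> f i \<zero>\<^bsub>E i\<^esub> = \<zero>\<^bsub>F i\<^esub>"
  shows "openin (topol (dsum_tvs I E)) (dsum_set I E U) \<and>
    Ck_on K (dsum_tvs I E) (dsum_set I E U) (dsum_tvs I F) k (dsum_map I f) \<and>
    (\<forall>j::nat. 1 \<le> j \<and> enat j \<le> k \<longrightarrow>
       brace_dom K (dsum_tvs I E) (dsum_set I E U) j =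
         {(X, p) \<in> carrier (brace_tvs K (dsum_tvs I E) j).
            \<forall>i\<in>I. (component (2 ^ j) i X, p) \<in> brace_dom K (E i) (U i) j} \<and>
       (\<forall>(X, p) \<in> brace_dom K (dsum_tvs I E) (dsum_set I E U) j.
          brace_map K (dsum_tvs I E) (dsum_set I E U) (dsum_tvs I F) (dsum_map I f) j (X, p) =
            (\<lambda>i\<in>I. brace_map K (E i) (U i) (F i) (f i) j (component (2 ^ j) i X, p))))"
proof -
  have C0: "C0_on (E i) (U i) (F i) (f i)"
    and diff: "\<And>j. enat j < k \<Longrightarrow> iter_differentiable K (E i) (U i) (F i) (f i) j" if "i \<in> I" for i
    using Ck_on_iff[OF assms(2,4)[OF that], of "F i" k "f i"] assms(6)[OF that] by simp_all
  interpret dsum_of_maps K I E F U f J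
  proof (intro dsum_of_maps.intro dsum_of_maps_axioms.intro tvs_family.intro continuous_tvs_map.intro
      continuous_tvs_map_axioms.intro)
    show "\<zero>\<^bsub>E i\<^esub> \<in> U i \<and> f i \<zero>\<^bsub>E i\<^esub> = \<zero>\<^bsub>F i\<^esub>" if "i \<in> I" "i \<notin> J" for i
      using assms(9) that by blast
  qed (fact assms C0)+
  \<comment> \<open>Depth j involves the levels l < j, all strictly below \<open>k\<close>.
    Differentiability at level j of the direct sum is obtained with \<open>Suc j\<close> in place of
    j, since it produces depth j + 1.\<close>
  have below: "iter_differentiable K (E i) (U i) (F i) (f i) l" if "i \<in> I" "l < j" "enat j \<le> k" for i l j
    using that by (intro diff) (auto intro: less_le_trans[of "enat l" "enat j" k])
  have "iter_differentiable K SE SU SF (dsum_map I f) j" if "enat j < k" for j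
    by (rule iter_differentiable_dsum, rule below[of _ _ "Suc j"]) (use that in \<open>auto simp: Suc_ile_eq\<close>)
  then have "Ck_on K SE SU SF k (dsum_map I f)"
    by (simp add: Ck_on_iff[OF E.dsum_tvs_tvs openin_SU] C0_on_dsum_map)
  moreover have "brace_map K SE SU SF (dsum_map I f) j (X, p) =
      (\<lambda>i\<in>I. brace_map K (E i) (U i) (F i) (f i) j (component (2 ^ j) i X, p))"
    if "enat j \<le> k" "(X, p) \<in> brace_dom K SE SU j" for j X p
    by (rule brace_map_dsum[OF below[OF _ _ that(1)] that(2)])
  ultimately show ?thesis
    using openin_SU by (intro conjI allI impI ballI brace_dom_dsum) auto
qed

end
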